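(* Let $G$ be a finite group and let $R$ be a commutative ring. (a) For every subgroup $U\le G$ one has $\alpha_G([G/U])=[N_G(U):U]\cdot [U]_G^+$. In particular, if $R$ has trivial $|G|$-torsion then $\alpha_G\colon RB(G)\to R\mathscr{S}_G$ is injective. (b) One has $\zeta_G\circ\alpha_G=\rho_G$ as maps $RB(G)\to R\mathscr{S}_G$. (c) The images of $\alpha_G$ and $\rho_G$ are contained in the fixed point module $(R\mathscr{S}_G)^G$. In particular, one obtains a commutative diagram of $R$-module homomorphisms: $\alpha_G\colon RB(G)\to (R\mathscr{S}_G)^G\subseteq R\mathscr{S}_G$ followed by the vertical maps $\zeta_G\colon (R\mathscr{S}_G)^G\to(R\mathscr{S}_G)^G$ and $\zeta_G\colon R\mathscr{S}_G\to R\mathscr{S}_G$ (compatible with the inclusions $(R\mathscr{S}_G)^G\subseteq R\mathscr{S}_G$), with $\zeta_G\circ\alpha_G=\rho_G\colon RB(G)\to (R\mathscr{S}_G)^G$, in which both vertical maps $\zeta_G$ are isomorphisms. If $|G|$ is invertible in $R$ then also $\alpha_G\colon RB(G)\to (R\mathscr{S}_G)^G$ and $\rho_G\colon RB(G)\to (R\mathscr{S}_G)^G$ are isomorphisms. For $R=\mathbb{Z}$ one has $$[(\mathbb{Z}\mathscr{S}_G)^G:\alpha_G(B(G))]=\prod_{U\in\tilde{\mathscr{S}}_G}[N_G(U):U]=[(\mathbb{Z}\mathscr{S}_G)^G:\rho_G(B(G))].$$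
   Context: Commutative rings are associative and unitary. For a finite group $G$, $\mathscr{S}_G$ is the set of all subgroups of $G$, $\tilde{\mathscr{S}}_G\subseteq\mathscr{S}_G$ is a transversal for the conjugacy classes of subgroups, and $R\mathscr{S}_G$ is the free $R$-module with basis $\mathscr{S}_G$, viewed as a permutation $RG$-module via the conjugation action of $G$ on $\mathscr{S}_G$; $(R\mathscr{S}_G)^G$ denotes its $G$-fixed points. For $U\le G$, $[U]_G^+\in R\mathscr{S}_G$ is the sum of all elements of the $G$-conjugacy class of $U$. $B(G)$ is the Burnside ring of $G$, i.e. the Grothendieck ring of the category of finite left $G$-sets with respect to disjoint unions and direct products; $[X]$ is the class of a finite $G$-set $X$; $RB(G):=R\otimes_{\mathbb{Z}}B(G)$. The additive maps $\alpha_G,\rho_G\colon B(G)\to\mathbb{Z}\mathscr{S}_G$ and $\zeta_G\colon\mathbb{Z}\mathscr{S}_G\to\mathbb{Z}\mathscr{S}_G$ are defined by $$\alpha_G([X])=\sum_{x\in X}\mathrm{stab}_G(x),\qquad \rho_G([X])=\sum_{U\le G}|X^U|\cdot U,\qquad \zeta_G(U)=\sum_{U'\le U}U',$$ where $X^U$ is the set of $U$-fixed points of $X$. The same symbols denote the $R$-linear maps obtained by extension of scalars from $\mathbb{Z}$ to $R$. "$R$ has trivial $|G|$-torsion" means that $r\in R$ and $|G|\cdot r=0$ imply $r=0$. *)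

theory Defs
  imports "HOL-Algebra.Module" "HOL-Algebra.IntRing" "HOL-Algebra.Group_Action"
    "HOL-Algebra.Left_Coset" "HOL-Algebra.Free_Abelian_Groups"
begin

section \<open>Modules\<close>

definition module_hom ::
  "('r, 'k) ring_scheme \<Rightarrow> ('r, 'a, 'm) module_scheme \<Rightarrow> ('r, 'b, 'n) module_scheme \<Rightarrow> ('a \<Rightarrow> 'b) set"
  where "module_hom R M N = {f. f \<in> carrier M \<rightarrow> carrier N \<and>
    (\<forall>x\<in>carrier M. \<forall>y\<in>carrier M. f (x \<oplus>\<^bsub>M\<^esub> y) = f x \<oplus>\<^bsub>N\<^esub> f y) \<and>
    (\<forall>r\<in>carrier R. \<forall>x\<in>carrier M. f (r \<odot>\<^bsub>M\<^esub> x) = r \<odot>\<^bsub>N\<^esub> f x)}"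

definition module_iso ::
  "('r, 'k) ring_scheme \<Rightarrow> ('r, 'a, 'm) module_scheme \<Rightarrow> ('r, 'b, 'n) module_scheme \<Rightarrow> ('a \<Rightarrow> 'b) set"
  where "module_iso R M N = {f \<in> module_hom R M N. bij_betw f (carrier M) (carrier N)}"

text \<open>The free module \<open>RS\<close> on a finite set \<open>S\<close>, an element being given by its coefficients.
  The fields \<open>mult\<close> and \<open>one\<close> exist only because the record of modules extends that of rings.\<close>

definition free_module :: "('r, 'k) ring_scheme \<Rightarrow> 's set \<Rightarrow> ('r, 's \<Rightarrow> 'r) module"
  where "free_module R S = \<lparr>carrier = S \<rightarrow>\<^sub>E carrier R, monoid.mult = undefined, one = undefined,
    ring.zero = (\<lambda>s\<in>S. \<zero>\<^bsub>R\<^esub>), ring.add = (\<lambda>v w. \<lambda>s\<in>S. v s \<oplus>\<^bsub>R\<^esub> w s),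
    smult = (\<lambda>r v. \<lambda>s\<in>S. r \<otimes>\<^bsub>R\<^esub> v s)\<rparr>"

definition basis_vec :: "('r, 'k) ring_scheme \<Rightarrow> 's set \<Rightarrow> 's \<Rightarrow> 's \<Rightarrow> 'r"
  where "basis_vec R S t = (\<lambda>s\<in>S. if s = t then \<one>\<^bsub>R\<^esub> else \<zero>\<^bsub>R\<^esub>)"

text \<open>The linear map from the free module on \<open>S\<close> to \<open>M\<close> that sends each basis element \<open>s\<close>
  to \<open>f s\<close>.\<close>

definition linear_ext :: "('r, 'b, 'm) module_scheme \<Rightarrow> 's set \<Rightarrow> ('s \<Rightarrow> 'b) \<Rightarrow> ('s \<Rightarrow> 'r) \<Rightarrow> 'b"
  where "linear_ext M S f v = finsum M (\<lambda>s. v s \<odot>\<^bsub>M\<^esub> f s) S"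

text \<open>The canonical map from \<open>\<int>S\<close> to \<open>RS\<close>.\<close>

definition int_coeffs :: "('r, 'k) ring_scheme \<Rightarrow> 's set \<Rightarrow> ('s \<Rightarrow> int) \<Rightarrow> 's \<Rightarrow> 'r"
  where "int_coeffs R S v = (\<lambda>s\<in>S. [v s] \<cdot>\<^bsub>R\<^esub> \<one>\<^bsub>R\<^esub>)"


section \<open>Extension of scalars from the integers\<close>

text \<open>\<open>R \<otimes> B\<close>, over the integers, is the free abelian group on the pairs \<open>(r, b)\<close> modulo
  the subgroup generated by the biadditivity relations; its elements are cosets.\<close>

definition tensor_free ::
  "('r, 'k) ring_scheme \<Rightarrow> ('b, 'l) ring_scheme \<Rightarrow> ('r \<times> 'b \<Rightarrow>\<^sub>0 int) monoid"
  where "tensor_free R B = free_Abelian_group (carrier R \<times> carrier B)"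

definition tensor_rels ::
  "('r, 'k) ring_scheme \<Rightarrow> ('b, 'l) ring_scheme \<Rightarrow> ('r \<times> 'b \<Rightarrow>\<^sub>0 int) set"
  where "tensor_rels R B = generate (tensor_free R B)
    ({frag_of (r \<oplus>\<^bsub>R\<^esub> s, b) - frag_of (r, b) - frag_of (s, b) | r s b.
        r \<in> carrier R \<and> s \<in> carrier R \<and> b \<in> carrier B} \<union>
     {frag_of (r, b \<oplus>\<^bsub>B\<^esub> c) - frag_of (r, b) - frag_of (r, c) | r b c.
        r \<in> carrier R \<and> b \<in> carrier B \<and> c \<in> carrier B})"

definition tensor_coset ::
  "('r, 'k) ring_scheme \<Rightarrow> ('b, 'l) ring_scheme \<Rightarrow> ('r \<times> 'b \<Rightarrow>\<^sub>0 int) \<Rightarrow> ('r \<times> 'b \<Rightarrow>\<^sub>0 int) set"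
  where "tensor_coset R B c = tensor_rels R B #>\<^bsub>tensor_free R B\<^esub> c"

definition pure_tensor ::
  "('r, 'k) ring_scheme \<Rightarrow> ('b, 'l) ring_scheme \<Rightarrow> 'r \<Rightarrow> 'b \<Rightarrow> ('r \<times> 'b \<Rightarrow>\<^sub>0 int) set"
  where "pure_tensor R B r b = tensor_coset R B (frag_of (r, b))"

text \<open>The \<open>R\<close>-algebra \<open>R \<otimes> B\<close>.  The scalar action and the product are the ones determined by
  \<open>r (s \<otimes> b) = rs \<otimes> b\<close> and \<open>(r \<otimes> b) (s \<otimes> b') = rs \<otimes> bb'\<close>.\<close>

definition base_change ::
  "('r, 'k) ring_scheme \<Rightarrow> ('b, 'l) ring_scheme \<Rightarrow> ('r, ('r \<times> 'b \<Rightarrow>\<^sub>0 int) set) module"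
  where "base_change R B = \<lparr>
    carrier = carrier (tensor_free R B Mod tensor_rels R B),
    monoid.mult = (\<lambda>t u. \<Union>c\<in>t. \<Union>d\<in>u. tensor_coset R B
      (frag_extend (\<lambda>(r, b). frag_extend (\<lambda>(s, b'). frag_of (r \<otimes>\<^bsub>R\<^esub> s, b \<otimes>\<^bsub>B\<^esub> b')) d) c)),
    one = pure_tensor R B \<one>\<^bsub>R\<^esub> \<one>\<^bsub>B\<^esub>,
    ring.zero = \<one>\<^bsub>tensor_free R B Mod tensor_rels R B\<^esub>,
    ring.add = monoid.mult (tensor_free R B Mod tensor_rels R B),
    smult = (\<lambda>r t. \<Union>c\<in>t. tensor_coset R B
      (frag_extend (\<lambda>(s, b). frag_of (r \<otimes>\<^bsub>R\<^esub> s, b)) c))\<rparr>"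

text \<open>The extension of an additive map \<open>f\<close> from \<open>B\<close> to \<open>\<int>S\<close> to the linear map from \<open>R \<otimes> B\<close>
  to \<open>RS\<close> with \<open>r \<otimes> b \<mapsto> r f(b)\<close>.  The image under \<^const>\<open>the_elem\<close> is a singleton
  because the value does not depend on the representative \<open>c\<close> of the coset \<open>t\<close>.\<close>

definition scalar_ext ::
  "('r, 'k) ring_scheme \<Rightarrow> 's set \<Rightarrow> ('b \<Rightarrow> 's \<Rightarrow> int) \<Rightarrow> ('r \<times> 'b \<Rightarrow>\<^sub>0 int) set \<Rightarrow> 's \<Rightarrow> 'r"
  where "scalar_ext R S f t = (let M = free_module R S in
    the_elem ((\<lambda>c. finsum M
      (\<lambda>(r, b). [Poly_Mapping.lookup c (r, b)] \<cdot>\<^bsub>M\<^esub> (r \<odot>\<^bsub>M\<^esub> int_coeffs R S (f b)))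
      (Poly_Mapping.keys c)) ` t))"


section \<open>The Burnside ring\<close>

type_synonym ('g, 'x) gset = "'x set \<times> ('g \<Rightarrow> 'x \<Rightarrow> 'x)"

definition finite_gset :: "('g, 'm) monoid_scheme \<Rightarrow> ('g, 'x) gset \<Rightarrow> bool"
  where "finite_gset G X \<longleftrightarrow> finite (fst X) \<and> group_action G (fst X) (snd X)"

definition gset_iso :: "('g, 'm) monoid_scheme \<Rightarrow> ('g, 'x) gset \<Rightarrow> ('g, 'y) gset \<Rightarrow> bool"
  where "gset_iso G X Y \<longleftrightarrow> (\<exists>f. bij_betw f (fst X) (fst Y) \<and>
    (\<forall>g\<in>carrier G. \<forall>x\<in>fst X. f (snd X g x) = snd Y g (f x)))"

definition gset_empty :: "('g, 'x) gset"
  where "gset_empty = ({}, \<lambda>g. \<lambda>x\<in>{}. x)"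

definition gset_point :: "('g, unit) gset"
  where "gset_point = ({()}, \<lambda>g. \<lambda>x\<in>{()}. x)"

definition gset_sum :: "('g, 'x) gset \<Rightarrow> ('g, 'y) gset \<Rightarrow> ('g, 'x + 'y) gset"
  where "gset_sum X Y = (Sum_Type.Plus (fst X) (fst Y),
    \<lambda>g. \<lambda>z\<in>Sum_Type.Plus (fst X) (fst Y). map_sum (snd X g) (snd Y g) z)"

definition gset_prod :: "('g, 'x) gset \<Rightarrow> ('g, 'y) gset \<Rightarrow> ('g, 'x \<times> 'y) gset"
  where "gset_prod X Y = (fst X \<times> fst Y,
    \<lambda>g. \<lambda>z\<in>fst X \<times> fst Y. map_prod (snd X g) (snd Y g) z)"

definition coset_gset :: "('g, 'm) monoid_scheme \<Rightarrow> 'g set \<Rightarrow> ('g, 'g set) gset"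
  where "coset_gset G U = (lcosets\<^bsub>G\<^esub> U, \<lambda>g. \<lambda>C\<in>lcosets\<^bsub>G\<^esub> U. g <#\<^bsub>G\<^esub> C)"

text \<open>The Grothendieck ring of finite \<open>G\<close>-sets: the group completion of the semiring of
  isomorphism classes.  The formal difference \<open>[X] - [Y]\<close> is the set of all pairs \<open>(X', Y')\<close> with
  \<open>X + Y' + Z \<cong> X' + Y + Z\<close> for some \<open>Z\<close>.  The representatives \<open>X'\<close>, \<open>Y'\<close>, \<open>Z\<close> are carried by
  sets of natural numbers, which is no restriction since every finite \<open>G\<close>-set is isomorphic to such
  a one; \<open>X\<close> and \<open>Y\<close> may live on any types.\<close>

type_synonym 'g burnside = "(('g, nat) gset \<times> ('g, nat) gset) set"

definition burnside_diff ::
  "('g, 'm) monoid_scheme \<Rightarrow> ('g, 'x) gset \<Rightarrow> ('g, 'y) gset \<Rightarrow> 'g burnside"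
  where "burnside_diff G X Y = {(X', Y'). finite_gset G X' \<and> finite_gset G Y' \<and>
    (\<exists>Z :: ('g, nat) gset. finite_gset G Z \<and>
      gset_iso G (gset_sum (gset_sum X Y') Z) (gset_sum (gset_sum X' Y) Z))}"

definition burnside_class :: "('g, 'm) monoid_scheme \<Rightarrow> ('g, 'x) gset \<Rightarrow> 'g burnside"
  where "burnside_class G X = burnside_diff G X (gset_empty :: ('g, nat) gset)"

definition burnside_ring :: "('g, 'm) monoid_scheme \<Rightarrow> 'g burnside ring"
  where "burnside_ring G = \<lparr>
    carrier = {burnside_diff G X Y | (X :: ('g, nat) gset) (Y :: ('g, nat) gset).
      finite_gset G X \<and> finite_gset G Y},
    monoid.mult = (\<lambda>A B. \<Union>(X, Y)\<in>A. \<Union>(X', Y')\<in>B. burnside_diff G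
      (gset_sum (gset_prod X X') (gset_prod Y Y')) (gset_sum (gset_prod X Y') (gset_prod Y X'))),
    one = burnside_class G gset_point,
    ring.zero = burnside_class G (gset_empty :: ('g, nat) gset),
    ring.add = (\<lambda>A B. \<Union>(X, Y)\<in>A. \<Union>(X', Y')\<in>B. burnside_diff G (gset_sum X X') (gset_sum Y Y'))\<rparr>"

abbreviation burnside_alg ::
  "('r, 'k) ring_scheme \<Rightarrow> ('g, 'm) monoid_scheme \<Rightarrow> ('r, ('r \<times> 'g burnside \<Rightarrow>\<^sub>0 int) set) module"
  where "burnside_alg R G \<equiv> base_change R (burnside_ring G)"

text \<open>The additive map on the Burnside group determined by its values \<open>f X\<close> on classes of
  \<open>G\<close>-sets; as above, the value is independent of the representative \<open>(X, Y)\<close>.\<close>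

definition burnside_lift ::
  "('a, 'n) ring_scheme \<Rightarrow> (('g, nat) gset \<Rightarrow> 'a) \<Rightarrow> 'g burnside \<Rightarrow> 'a"
  where "burnside_lift M f A = the_elem ((\<lambda>(X, Y). f X \<ominus>\<^bsub>M\<^esub> f Y) ` A)"


section \<open>The permutation module on the set of subgroups\<close>

definition subgroups_of :: "('g, 'm) monoid_scheme \<Rightarrow> 'g set set"
  where "subgroups_of G = {U. subgroup U G}"

definition conj_set :: "('g, 'm) monoid_scheme \<Rightarrow> 'g \<Rightarrow> 'g set \<Rightarrow> 'g set"
  where "conj_set G g U = g <#\<^bsub>G\<^esub> U #>\<^bsub>G\<^esub> inv\<^bsub>G\<^esub> g"

definition conj_class :: "('g, 'm) monoid_scheme \<Rightarrow> 'g set \<Rightarrow> 'g set set"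
  where "conj_class G U = {conj_set G g U | g. g \<in> carrier G}"

definition conj_transversal :: "('g, 'm) monoid_scheme \<Rightarrow> 'g set set \<Rightarrow> bool"
  where "conj_transversal G T \<longleftrightarrow>
    T \<subseteq> subgroups_of G \<and> (\<forall>U\<in>subgroups_of G. \<exists>!V. V \<in> T \<and> V \<in> conj_class G U)"

definition normalizer_index :: "('g, 'm) monoid_scheme \<Rightarrow> 'g set \<Rightarrow> nat"
  where "normalizer_index G U = card (rcosets\<^bsub>G\<lparr>carrier := normalizer G U\<rparr>\<^esub> U)"

definition sg_module ::
  "('r, 'k) ring_scheme \<Rightarrow> ('g, 'm) monoid_scheme \<Rightarrow> ('r, 'g set \<Rightarrow> 'r) module"
  where "sg_module R G = free_module R (subgroups_of G)"

definition sg_basis ::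
  "('r, 'k) ring_scheme \<Rightarrow> ('g, 'm) monoid_scheme \<Rightarrow> 'g set \<Rightarrow> 'g set \<Rightarrow> 'r"
  where "sg_basis R G U = basis_vec R (subgroups_of G) U"

definition class_sum ::
  "('r, 'k) ring_scheme \<Rightarrow> ('g, 'm) monoid_scheme \<Rightarrow> 'g set \<Rightarrow> 'g set \<Rightarrow> 'r"
  where "class_sum R G U = finsum (sg_module R G) (sg_basis R G) (conj_class G U)"

definition sg_action ::
  "('r, 'k) ring_scheme \<Rightarrow> ('g, 'm) monoid_scheme \<Rightarrow> 'g \<Rightarrow> ('g set \<Rightarrow> 'r) \<Rightarrow> 'g set \<Rightarrow> 'r"
  where "sg_action R G g =
    linear_ext (sg_module R G) (subgroups_of G) (\<lambda>U. sg_basis R G (conj_set G g U))"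

definition sg_fixed ::
  "('r, 'k) ring_scheme \<Rightarrow> ('g, 'm) monoid_scheme \<Rightarrow> ('r, 'g set \<Rightarrow> 'r) module"
  where "sg_fixed R G = sg_module R G
    \<lparr>carrier := {v \<in> carrier (sg_module R G). \<forall>g\<in>carrier G. sg_action R G g v = v}\<rparr>"


section \<open>The maps \<open>\<alpha>\<close>, \<open>\<rho>\<close> and \<open>\<zeta>\<close>\<close>

definition alpha_gset :: "('g, 'm) monoid_scheme \<Rightarrow> ('g, 'x) gset \<Rightarrow> 'g set \<Rightarrow> int"
  where "alpha_gset G X =
    finsum (sg_module \<Z> G) (\<lambda>x. sg_basis \<Z> G (stabilizer G (snd X) x)) (fst X)"

definition gset_fixed :: "('g, 'x) gset \<Rightarrow> 'g set \<Rightarrow> 'x set"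
  where "gset_fixed X U = {x \<in> fst X. \<forall>u\<in>U. snd X u x = x}"

definition rho_gset :: "('g, 'm) monoid_scheme \<Rightarrow> ('g, 'x) gset \<Rightarrow> 'g set \<Rightarrow> int"
  where "rho_gset G X = finsum (sg_module \<Z> G)
    (\<lambda>U. int (card (gset_fixed X U)) \<odot>\<^bsub>sg_module \<Z> G\<^esub> sg_basis \<Z> G U) (subgroups_of G)"

definition alpha_int :: "('g, 'm) monoid_scheme \<Rightarrow> 'g burnside \<Rightarrow> 'g set \<Rightarrow> int"
  where "alpha_int G = burnside_lift (sg_module \<Z> G) (alpha_gset G)"

definition rho_int :: "('g, 'm) monoid_scheme \<Rightarrow> 'g burnside \<Rightarrow> 'g set \<Rightarrow> int"
  where "rho_int G = burnside_lift (sg_module \<Z> G) (rho_gset G)"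

definition alpha :: "('r, 'k) ring_scheme \<Rightarrow> ('g, 'm) monoid_scheme \<Rightarrow>
    ('r \<times> 'g burnside \<Rightarrow>\<^sub>0 int) set \<Rightarrow> 'g set \<Rightarrow> 'r"
  where "alpha R G = scalar_ext R (subgroups_of G) (alpha_int G)"

definition rho :: "('r, 'k) ring_scheme \<Rightarrow> ('g, 'm) monoid_scheme \<Rightarrow>
    ('r \<times> 'g burnside \<Rightarrow>\<^sub>0 int) set \<Rightarrow> 'g set \<Rightarrow> 'r"
  where "rho R G = scalar_ext R (subgroups_of G) (rho_int G)"

definition zeta ::
  "('r, 'k) ring_scheme \<Rightarrow> ('g, 'm) monoid_scheme \<Rightarrow> ('g set \<Rightarrow> 'r) \<Rightarrow> 'g set \<Rightarrow> 'r"
  where "zeta R G = linear_ext (sg_module R G) (subgroups_of G)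
    (\<lambda>U. finsum (sg_module R G) (sg_basis R G) {V \<in> subgroups_of G. V \<subseteq> U})"

end

theory Submission
  imports Defs
begin

text \<open>
  The proof rests on one numerical invariant of a finite \<open>G\<close>-set \<open>X\<close>: the function that counts, for
  each subgroup \<open>U\<close>, the points with stabilizer \<open>U\<close> (\<open>stab_count\<close>).  These numbers are the
  coefficients of \<open>\<alpha>([X])\<close>, and they classify \<open>X\<close> up to isomorphism (\<open>gset_iso_iff_stab_count\<close>),
  because a point with stabilizer \<open>U\<close> has an orbit isomorphic to \<open>G/U\<close> and orbits can be split off
  one by one.  Hence a formal difference in the Burnside group is the same as a difference of
  counting functions (\<open>burnside_diff_eq\<close>), and all identities in \<open>B(G)\<close> become identities between
  integers.

  A coset \<open>gU\<close> has stabilizer \<open>gUg\<inverse>\<close>, and the elements that conjugate \<open>U\<close> to a given conjugate form a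
  coset of the normalizer; this gives \<open>\<alpha>([G/U]) = [N(U) : U] [U]\<^sup>+\<close> (\<open>stab_count_coset_gset\<close>).  A
  point is fixed by \<open>U\<close> exactly if its stabilizer contains \<open>U\<close>, so summing the stabilizer counts over
  the subgroups above \<open>U\<close> counts fixed points; this is \<open>\<zeta> \<circ> \<alpha> = \<rho>\<close> (\<open>zeta_alpha\<close>).  The map \<open>\<zeta>\<close> is
  unitriangular for the inclusion of subgroups and commutes with conjugation, so it is an automorphism
  of \<open>RS\<close> and of its fixed points (\<open>zeta_iso\<close>, \<open>zeta_fixed_iso\<close>), where \<open>S\<close> is the set of subgroups.
  All statements on \<open>\<rho>\<close> thus follow from those on \<open>\<alpha>\<close>.

  Let \<open>T\<close> be a transversal of the conjugacy classes of subgroups.  A fixed vector is determined by its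
  coefficients on \<open>T\<close>, and these can be arbitrary.  The algebra \<open>R \<otimes> B(G)\<close> is spanned by the elements
  \<open>1 \<otimes> [G/U]\<close> with \<open>U\<close> in \<open>T\<close> (\<open>coset_combination_surj\<close>), and in the coordinates on \<open>T\<close> the map \<open>\<alpha>\<close>
  multiplies the coefficient of \<open>1 \<otimes> [G/U]\<close> by \<open>[N(U) : U]\<close> (\<open>alpha_combination_apply\<close>).  These indices
  divide \<open>|G|\<close>, which gives injectivity in the absence of \<open>|G|\<close>-torsion and bijectivity if \<open>|G|\<close> is
  invertible.  Over the integers the image of \<open>\<alpha>\<close> consists of the fixed vectors whose coefficient at
  each \<open>U\<close> in \<open>T\<close> is divisible by \<open>[N(U) : U]\<close>, so its index is the product of these numbers.
\<close>

section \<open>Module homomorphisms and free modules in coordinates\<close>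

lemma module_hom_closed: "f \<in> module_hom R M N \<Longrightarrow> x \<in> carrier M \<Longrightarrow> f x \<in> carrier N"
  by (auto simp: module_hom_def)

lemma module_hom_add:
  "f \<in> module_hom R M N \<Longrightarrow> x \<in> carrier M \<Longrightarrow> y \<in> carrier M \<Longrightarrow> f (x \<oplus>\<^bsub>M\<^esub> y) = f x \<oplus>\<^bsub>N\<^esub> f y"
  by (auto simp: module_hom_def)

lemma module_hom_smult:
  "f \<in> module_hom R M N \<Longrightarrow> r \<in> carrier R \<Longrightarrow> x \<in> carrier M \<Longrightarrow> f (r \<odot>\<^bsub>M\<^esub> x) = r \<odot>\<^bsub>N\<^esub> f x"
  by (auto simp: module_hom_def)

lemma module_hom_compose:
  assumes "f \<in> module_hom R L M" and "g \<in> module_hom R M N"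
  shows "(\<lambda>x. g (f x)) \<in> module_hom R L N"
  using assms by (auto simp: module_hom_def Pi_iff)

lemma submodule_finsum_closed:
  assumes "module R M" and H: "submodule H R M" and x: "x \<in> I \<rightarrow> H"
  shows "finsum M x I \<in> H"
proof -
  interpret module R M by fact
  note sub = submoduleE(1)[OF H]
  have zero: "\<zero>\<^bsub>M\<^esub> \<in> H"
    using subgroup.one_closed[OF submodule.axioms(1)[OF H]] by simp
  show ?thesis
    using x
  proof (induction I rule: infinite_finite_induct)
    case (insert i I)
    then have "x \<in> I \<rightarrow> carrier M" "x i \<in> carrier M" "x i \<in> H" "finsum M x I \<in> H"
      using sub by auto
    then show ?case
      using insert(1,2) submoduleE(5)[OF H] by simp
  qed (simp_all add: zero)
qed

lemma module_hom_abelian_group_hom: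
  assumes "abelian_group M" and "abelian_group N" and "f \<in> module_hom R M N"
  shows "abelian_group_hom M N f"
  using assms
  by (intro abelian_group_homI group_hom.intro group_hom_axioms.intro abelian_group.a_group)
    (auto simp: module_hom_def hom_def)

lemma module_hom_minus:
  assumes "abelian_group M" and "abelian_group N" and "f \<in> module_hom R M N"
    and "x \<in> carrier M" and "y \<in> carrier M"
  shows "f (x \<ominus>\<^bsub>M\<^esub> y) = f x \<ominus>\<^bsub>N\<^esub> f y"
proof -
  interpret abelian_group_hom M N f
    using assms module_hom_abelian_group_hom by blast
  show ?thesis
    using assms by (simp add: a_minus_def)
qed

lemma module_hom_finsum:
  assumes "abelian_group M" and "abelian_group N" and "f \<in> module_hom R M N"
    and "finite I" and "x \<in> I \<rightarrow> carrier M"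
  shows "f (finsum M x I) = finsum N (\<lambda>i. f (x i)) I"
proof -
  interpret abelian_group_hom M N f
    using assms module_hom_abelian_group_hom by blast
  show ?thesis
    using assms(4,5)
  proof (induction I rule: finite_induct)
    case (insert i I)
    then have "(\<lambda>j. f (x j)) \<in> I \<rightarrow> carrier N" "f (x i) \<in> carrier N" "x \<in> I \<rightarrow> carrier M"
      "x i \<in> carrier M"
      using module_hom_closed[OF assms(3)] by (auto simp: Pi_iff)
    with insert show ?case
      by simp
  qed simp
qed

lemma (in abelian_group) minus_eq_zero_iff:
  assumes "x \<in> carrier G" and "y \<in> carrier G"
  shows "x \<ominus> y = \<zero> \<longleftrightarrow> x = y"
  using assms by (metis add.inv_solve_right' a_minus_def l_zero r_neg zero_closed)

lemma (in abelian_group) add_minus_add: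
  assumes "a \<in> carrier G" "b \<in> carrier G" "c \<in> carrier G" "d \<in> carrier G"
  shows "(a \<oplus> b) \<ominus> (c \<oplus> d) = (a \<ominus> c) \<oplus> (b \<ominus> d)"
  using assms by (simp add: a_minus_def minus_add a_ac)

lemma (in abelian_group) add_pow_sum:
  assumes "finite I" and "x \<in> carrier G"
  shows "[(\<Sum>i\<in>I. k i)] \<cdot> x = (\<Oplus>i\<in>I. [(k i :: int)] \<cdot> x)"
  using assms(1)
proof (induction I rule: finite_induct)
  case (insert i I)
  then show ?case
    using assms(2) by (simp add: add.int_pow_mult)
qed (simp add: add_pow_def)

lemma (in abelian_group) add_pow_int_of_nat: "[int n] \<cdot> x = [n] \<cdot> x"
  by (simp add: add_pow_def int_pow_int)

lemma free_module_carrier [simp]: "carrier (free_module R S) = S \<rightarrow>\<^sub>E carrier R"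
  and free_module_zero [simp]: "\<zero>\<^bsub>free_module R S\<^esub> = (\<lambda>s\<in>S. \<zero>\<^bsub>R\<^esub>)"
  and free_module_add [simp]: "v \<oplus>\<^bsub>free_module R S\<^esub> w = (\<lambda>s\<in>S. v s \<oplus>\<^bsub>R\<^esub> w s)"
  and free_module_smult [simp]: "r \<odot>\<^bsub>free_module R S\<^esub> v = (\<lambda>s\<in>S. r \<otimes>\<^bsub>R\<^esub> v s)"
  by (simp_all add: free_module_def)

context cring
begin

lemma free_module_eqI:
  assumes "v \<in> carrier (free_module R S)" and "w \<in> carrier (free_module R S)"
    and "\<And>s. s \<in> S \<Longrightarrow> v s = w s"
  shows "v = w"
  using assms by (auto intro: PiE_ext)

lemma free_module_coord: "v \<in> S \<rightarrow>\<^sub>E carrier R \<Longrightarrow> s \<in> S \<Longrightarrow> v s \<in> carrier R"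
  by (rule PiE_mem)

lemma module_free_module: "module R (free_module R S)"
proof (rule moduleI)
  show "abelian_group (free_module R S)"
  proof (rule abelian_groupI)
    fix v
    assume v: "v \<in> carrier (free_module R S)"
    then show "\<zero>\<^bsub>free_module R S\<^esub> \<oplus>\<^bsub>free_module R S\<^esub> v = v"
      by (intro free_module_eqI) (auto intro: l_zero)
    from v have closed: "(\<lambda>s\<in>S. \<ominus> v s) \<in> carrier (free_module R S)"
      and inverse: "(\<lambda>s\<in>S. \<ominus> v s) \<oplus>\<^bsub>free_module R S\<^esub> v = \<zero>\<^bsub>free_module R S\<^esub>"
      by (auto simp: fun_eq_iff intro: l_neg)
    show "\<exists>w\<in>carrier (free_module R S). w \<oplus>\<^bsub>free_module R S\<^esub> v = \<zero>\<^bsub>free_module R S\<^esub>"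
      by (rule bexI[of _ "\<lambda>s\<in>S. \<ominus> v s"]) (fact inverse closed)+
  qed (auto simp: free_module_coord a_assoc intro!: restrict_ext intro: a_comm)
next
  fix v
  assume "v \<in> carrier (free_module R S)"
  then show "\<one> \<odot>\<^bsub>free_module R S\<^esub> v = v"
    by (intro free_module_eqI) (auto intro: l_one)
qed (auto simp: free_module_coord is_cring l_distr r_distr m_assoc intro!: restrict_ext)

lemma abelian_group_free_module: "abelian_group (free_module R S)"
  using module_free_module[of S] by (rule module.axioms(2))

text \<open>All operations are pointwise.  Through the evaluations, which are homomorphisms, identities in
  the free module reduce to identities in \<open>R\<close>.\<close>

lemma free_module_evaluation_hom:
  assumes "s \<in> S"
  shows "abelian_group_hom (free_module R S) R (\<lambda>v. v s)"
proof -
  have "group (add_monoid (free_module R S))" "group (add_monoid R)"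
    using abelian_group.a_group[OF abelian_group_free_module] add.is_group by auto
  then show ?thesis
    using assms abelian_group_free_module is_abelian_group
    by (intro abelian_group_homI group_hom.intro group_hom_axioms.intro) (auto simp: hom_def)
qed

lemma free_module_finsum_apply:
  assumes "finite A" and "f \<in> A \<rightarrow> carrier (free_module R S)" and "s \<in> S"
  shows "finsum (free_module R S) f A s = (\<Oplus>a\<in>A. f a s)"
proof -
  interpret M: abelian_group "free_module R S"
    by (rule abelian_group_free_module)
  show ?thesis
    using assms(1,2)
  proof (induction A rule: finite_induct)
    case (insert a A)
    moreover from insert.prems \<open>s \<in> S\<close> have "(\<lambda>b. f b s) \<in> A \<rightarrow> carrier R" "f a s \<in> carrier R"
      by (auto simp: Pi_def PiE_def)
    ultimately show ?case
      using \<open>s \<in> S\<close> by (simp del: free_module_carrier)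
  qed (use assms(3) in simp)
qed

lemma free_module_minus_apply:
  assumes "v \<in> carrier (free_module R S)" and "w \<in> carrier (free_module R S)" and "s \<in> S"
  shows "(v \<ominus>\<^bsub>free_module R S\<^esub> w) s = v s \<ominus> w s"
proof -
  interpret abelian_group_hom "free_module R S" R "\<lambda>v. v s"
    using assms(3) by (rule free_module_evaluation_hom)
  interpret M: abelian_group "free_module R S"
    by (rule abelian_group_free_module)
  show ?thesis
    using assms hom_add[of v "\<ominus>\<^bsub>free_module R S\<^esub> w"]
    by (simp add: a_minus_def del: free_module_carrier free_module_add)
qed

lemma free_module_int_pow_apply:
  assumes "v \<in> carrier (free_module R S)" and "s \<in> S"
  shows "([(k :: int)] \<cdot>\<^bsub>free_module R S\<^esub> v) s = [k] \<cdot> v s"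
proof -
  interpret abelian_group_hom "free_module R S" R "\<lambda>v. v s"
    using assms(2) by (rule free_module_evaluation_hom)
  show ?thesis
    using assms a_group_hom group_hom.hom_int_pow[OF a_group_hom, of v k]
    by (simp add: add_pow_def)
qed

lemma free_module_nat_pow_apply:
  assumes "v \<in> carrier (free_module R S)" and "s \<in> S"
  shows "([(k :: nat)] \<cdot>\<^bsub>free_module R S\<^esub> v) s = [k] \<cdot> v s"
  using free_module_int_pow_apply[OF assms, of "int k"] by (simp add: add_pow_def int_pow_int)

lemma finsum_if_eq:
  assumes "finite A" and "a \<in> A" and "x \<in> carrier R"
  shows "(\<Oplus>b\<in>A. if b = a then x else \<zero>) = x"
  using add.finprod_singleton[of a A "\<lambda>_. x"] assms by (simp add: eq_commute)

lemma basis_vec_closed [simp]: "basis_vec R S t \<in> carrier (free_module R S)"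
  by (auto simp: basis_vec_def)

lemma basis_vec_apply [simp]: "s \<in> S \<Longrightarrow> basis_vec R S t s = (if s = t then \<one> else \<zero>)"
  by (simp add: basis_vec_def)

lemma linear_ext_hom:
  assumes "finite S" and M: "module R M" and f: "f \<in> S \<rightarrow> carrier M"
  shows "linear_ext M S f \<in> module_hom R (free_module R S) M"
proof -
  interpret M: module R M by (rule M)
  have f': "f s \<in> carrier M" if "s \<in> S" for s
    using that f by auto
  have closed: "v s \<odot>\<^bsub>M\<^esub> f s \<in> carrier M" if "v \<in> carrier (free_module R S)" "s \<in> S" for v s
    using that f' by auto
  show ?thesis
    unfolding module_hom_def linear_ext_def mem_Collect_eq
  proof (intro conjI ballI funcsetI)
    fix v w
    assume v: "v \<in> carrier (free_module R S)" and w: "w \<in> carrier (free_module R S)"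
    have "(\<Oplus>\<^bsub>M\<^esub>s\<in>S. (v \<oplus>\<^bsub>free_module R S\<^esub> w) s \<odot>\<^bsub>M\<^esub> f s) =
      (\<Oplus>\<^bsub>M\<^esub>s\<in>S. v s \<odot>\<^bsub>M\<^esub> f s \<oplus>\<^bsub>M\<^esub> w s \<odot>\<^bsub>M\<^esub> f s)"
    proof (rule M.finsum_cong')
      fix s
      assume "s \<in> S"
      with v w f' have "v s \<in> carrier R" "w s \<in> carrier R" "f s \<in> carrier M"
        by auto
      with \<open>s \<in> S\<close> show "(v \<oplus>\<^bsub>free_module R S\<^esub> w) s \<odot>\<^bsub>M\<^esub> f s =
        v s \<odot>\<^bsub>M\<^esub> f s \<oplus>\<^bsub>M\<^esub> w s \<odot>\<^bsub>M\<^esub> f s"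
        by (simp add: M.smult_l_distr)
    qed (use v w closed in auto)
    then show "(\<Oplus>\<^bsub>M\<^esub>s\<in>S. (v \<oplus>\<^bsub>free_module R S\<^esub> w) s \<odot>\<^bsub>M\<^esub> f s) =
      (\<Oplus>\<^bsub>M\<^esub>s\<in>S. v s \<odot>\<^bsub>M\<^esub> f s) \<oplus>\<^bsub>M\<^esub> (\<Oplus>\<^bsub>M\<^esub>s\<in>S. w s \<odot>\<^bsub>M\<^esub> f s)"
      using v w closed by (simp add: M.finsum_addf Pi_iff)
  next
    fix r v
    assume r: "r \<in> carrier R" and v: "v \<in> carrier (free_module R S)"
    have "(\<Oplus>\<^bsub>M\<^esub>s\<in>S. (r \<odot>\<^bsub>free_module R S\<^esub> v) s \<odot>\<^bsub>M\<^esub> f s) =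
      (\<Oplus>\<^bsub>M\<^esub>s\<in>S. r \<odot>\<^bsub>M\<^esub> (v s \<odot>\<^bsub>M\<^esub> f s))"
    proof (rule M.finsum_cong')
      fix s
      assume "s \<in> S"
      with v f' have "v s \<in> carrier R" "f s \<in> carrier M"
        by auto
      with \<open>s \<in> S\<close> r show "(r \<odot>\<^bsub>free_module R S\<^esub> v) s \<odot>\<^bsub>M\<^esub> f s = r \<odot>\<^bsub>M\<^esub> (v s \<odot>\<^bsub>M\<^esub> f s)"
        by (simp add: M.smult_assoc1)
    qed (use r v closed in auto)
    then show "(\<Oplus>\<^bsub>M\<^esub>s\<in>S. (r \<odot>\<^bsub>free_module R S\<^esub> v) s \<odot>\<^bsub>M\<^esub> f s) =
      r \<odot>\<^bsub>M\<^esub> (\<Oplus>\<^bsub>M\<^esub>s\<in>S. v s \<odot>\<^bsub>M\<^esub> f s)"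
      using r v closed \<open>finite S\<close> by (simp add: M.finsum_smult_ldistr Pi_iff)
  qed (use closed in \<open>auto intro!: M.finsum_closed\<close>)
qed

lemma linear_ext_apply:
  assumes "finite S" and "f \<in> S \<rightarrow> carrier (free_module R T)"
    and "v \<in> carrier (free_module R S)" and "t \<in> T"
  shows "linear_ext (free_module R T) S f v t = (\<Oplus>s\<in>S. v s \<otimes> f s t)"
proof -
  interpret M: module R "free_module R T" by (rule module_free_module)
  have "(\<lambda>s. v s \<odot>\<^bsub>free_module R T\<^esub> f s) \<in> S \<rightarrow> carrier (free_module R T)"
    using assms(2,3) by (auto simp: PiE_mem Pi_def)
  then show ?thesis
    using assms by (simp add: linear_ext_def free_module_finsum_apply)
qed

lemma linear_ext_basis_vec:
  assumes "finite S" and M: "module R M" and f: "f \<in> S \<rightarrow> carrier M" and t: "t \<in> S"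
  shows "linear_ext M S f (basis_vec R S t) = f t"
proof -
  interpret M: module R M by (rule M)
  have f': "f s \<in> carrier M" if "s \<in> S" for s
    using f that by auto
  have "linear_ext M S f (basis_vec R S t) = (\<Oplus>\<^bsub>M\<^esub>s\<in>S. if t = s then f s else \<zero>\<^bsub>M\<^esub>)"
    unfolding linear_ext_def using f' by (intro M.finsum_cong') auto
  also have "\<dots> = f t"
    using \<open>finite S\<close> t f by (intro M.finsum_singleton) auto
  finally show ?thesis .
qed

end

text \<open>The universal property of a free abelian group, with the induced homomorphism given by the
  formula that occurs in \<^const>\<open>scalar_ext\<close>.\<close>

definition free_lift :: "('a, 'm) ring_scheme \<Rightarrow> ('x \<Rightarrow> 'a) \<Rightarrow> ('x \<Rightarrow>\<^sub>0 int) \<Rightarrow> 'a"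
  where "free_lift M \<phi> c = finsum M (\<lambda>x. [(Poly_Mapping.lookup c x)] \<cdot>\<^bsub>M\<^esub> \<phi> x) (Poly_Mapping.keys c)"

context abelian_group
begin

text \<open>The sum may be taken over any finite set that contains the support; this allows two arguments
  to be summed over a common index set.\<close>

lemma free_lift_superset:
  assumes "\<phi> \<in> F \<rightarrow> carrier G" and "finite F" and "Poly_Mapping.keys c \<subseteq> F"
  shows "free_lift G \<phi> c = (\<Oplus>x\<in>F. [(Poly_Mapping.lookup c x)] \<cdot> \<phi> x)"
  unfolding free_lift_def
proof (rule add.finprod_mono_neutral_cong_left)
  show "[(Poly_Mapping.lookup c x)] \<cdot> \<phi> x = \<zero>" if "x \<in> F - Poly_Mapping.keys c" for x
    using that by (simp add: in_keys_iff add_pow_def)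
qed (use assms in auto)

lemma free_lift_hom:
  assumes "\<phi> \<in> S \<rightarrow> carrier G"
  shows "free_lift G \<phi> \<in> hom (free_Abelian_group S) (add_monoid G)"
proof (rule homI)
  fix c d
  assume cd: "c \<in> carrier (free_Abelian_group S)" "d \<in> carrier (free_Abelian_group S)"
  let ?F = "Poly_Mapping.keys c \<union> Poly_Mapping.keys d"
  have \<phi>: "\<phi> \<in> ?F \<rightarrow> carrier G"
    using assms cd by auto
  have F: "finite ?F" "Poly_Mapping.keys (c + d) \<subseteq> ?F"
    using Poly_Mapping.keys_add[of c d] by auto
  have "free_lift G \<phi> (c + d) =
      (\<Oplus>x\<in>?F. [(Poly_Mapping.lookup c x)] \<cdot> \<phi> x \<oplus> [(Poly_Mapping.lookup d x)] \<cdot> \<phi> x)"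
    unfolding free_lift_superset[OF \<phi> F] using \<phi>
    by (intro finsum_cong') (auto simp: lookup_add Pi_iff intro: add.int_pow_mult)
  also have "\<dots> = free_lift G \<phi> c \<oplus> free_lift G \<phi> d"
    using \<phi> by (subst finsum_addf) (auto simp: free_lift_superset[OF \<phi> F(1)])
  finally show "free_lift G \<phi> (c \<otimes>\<^bsub>free_Abelian_group S\<^esub> d) =
      free_lift G \<phi> c \<otimes>\<^bsub>add_monoid G\<^esub> free_lift G \<phi> d"
    by simp
qed (use assms in \<open>auto simp: free_lift_def intro!: finsum_closed\<close>)

lemma free_lift_of:
  assumes "\<phi> x \<in> carrier G"
  shows "free_lift G \<phi> (frag_of x) = \<phi> x"
  using assms by (simp add: free_lift_def finsum_insert[of "{}"] add.int_pow_1)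

end

section \<open>Extension of scalars\<close>

text \<open>Closure of \<open>B\<close> under addition places the relations for the second argument in the free group
  on the pairs.\<close>

locale scalar_extension = cring R
  for R :: "('r, 'k) ring_scheme" (structure) +
  fixes B :: "('b, 'l) ring_scheme"
  assumes B_add_closed: "b \<in> carrier B \<Longrightarrow> c \<in> carrier B \<Longrightarrow> b \<oplus>\<^bsub>B\<^esub> c \<in> carrier B"
begin

abbreviation RB :: "('r, ('r \<times> 'b \<Rightarrow>\<^sub>0 int) set) module"
  where "RB \<equiv> base_change R B"

abbreviation coset :: "('r \<times> 'b \<Rightarrow>\<^sub>0 int) \<Rightarrow> ('r \<times> 'b \<Rightarrow>\<^sub>0 int) set"
  where "coset \<equiv> tensor_coset R B"

abbreviation rels :: "('r \<times> 'b \<Rightarrow>\<^sub>0 int) set"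
  where "rels \<equiv> tensor_rels R B"

abbreviation formal_sum :: "('r \<times> 'b \<Rightarrow>\<^sub>0 int) \<Rightarrow> bool"
  where "formal_sum c \<equiv> Poly_Mapping.keys c \<subseteq> carrier R \<times> carrier B"

lemma tensor_free_simps [simp]:
  "c \<in> carrier (tensor_free R B) \<longleftrightarrow> formal_sum c"
  "c \<otimes>\<^bsub>tensor_free R B\<^esub> d = c + d"
  "\<one>\<^bsub>tensor_free R B\<^esub> = 0"
  by (simp_all add: tensor_free_def)

lemma comm_group_tensor_free: "comm_group (tensor_free R B)"
  by (simp add: tensor_free_def abelian_free_Abelian_group)

lemma group_tensor_free: "group (tensor_free R B)"
  by (simp add: tensor_free_def)

definition biadditivity_relations :: "('r \<times> 'b \<Rightarrow>\<^sub>0 int) set"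
  where "biadditivity_relations =
    {frag_of (r \<oplus> s, b) - frag_of (r, b) - frag_of (s, b) | r s b.
        r \<in> carrier R \<and> s \<in> carrier R \<and> b \<in> carrier B} \<union>
    {frag_of (r, b \<oplus>\<^bsub>B\<^esub> c) - frag_of (r, b) - frag_of (r, c) | r b c.
        r \<in> carrier R \<and> b \<in> carrier B \<and> c \<in> carrier B}"

lemma tensor_rels_eq: "rels = generate (tensor_free R B) biadditivity_relations"
  by (simp add: tensor_rels_def biadditivity_relations_def)

lemma keys_diff_subset:
  "Poly_Mapping.keys c \<subseteq> A \<Longrightarrow> Poly_Mapping.keys d \<subseteq> A \<Longrightarrow> Poly_Mapping.keys (c - d) \<subseteq> A"
  using keys_diff[of c d] by blast

lemma keys_add_subset:
  "Poly_Mapping.keys c \<subseteq> A \<Longrightarrow> Poly_Mapping.keys d \<subseteq> A \<Longrightarrow> Poly_Mapping.keys (c + d) \<subseteq> A"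
  using Poly_Mapping.keys_add[of c d] by blast

lemma biadditivity_relations_subset: "biadditivity_relations \<subseteq> carrier (tensor_free R B)"
proof -
  have "Poly_Mapping.keys (frag_of x - frag_of y - frag_of z) \<subseteq> {x, y, z}" for x y z :: "'r \<times> 'b"
    by (intro keys_diff_subset) auto
  then show ?thesis
    unfolding biadditivity_relations_def by (fastforce simp: B_add_closed)
qed

lemma subgroup_tensor_rels: "subgroup (rels) (tensor_free R B)"
  unfolding tensor_rels_eq
  using group.generate_is_subgroup[OF group_tensor_free biadditivity_relations_subset] .

lemma normal_tensor_rels: "rels \<lhd> tensor_free R B"
  using comm_group.normal_iff_subgroup[OF comm_group_tensor_free] subgroup_tensor_rels by blast

lemma tensor_rels_diff:
  assumes "c \<in> rels" and "d \<in> rels"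
  shows "c - d \<in> rels"
proof -
  interpret N: subgroup "rels" "tensor_free R B"
    by (rule subgroup_tensor_rels)
  have "formal_sum d"
    using N.mem_carrier[OF assms(2)] by simp
  then have "inv\<^bsub>tensor_free R B\<^esub> d = - d"
    by (simp add: tensor_free_def)
  then show ?thesis
    using N.m_closed[OF assms(1) N.m_inv_closed[OF assms(2)]] by simp
qed

lemma tensor_rels_zero: "0 \<in> rels"
  using subgroup.one_closed[OF subgroup_tensor_rels] by simp

lemma tensor_coset_eq: "coset c = {n + c | n. n \<in> rels}"
  by (auto simp: tensor_coset_def r_coset_def)

lemma tensor_coset_eq_iff: "coset c = coset d \<longleftrightarrow> c - d \<in> rels"
proof
  assume "coset c = coset d"
  moreover have "0 + c \<in> coset c"
    unfolding tensor_coset_eq using tensor_rels_zero by blast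
  ultimately obtain n where "n \<in> rels" "c = n + d"
    unfolding tensor_coset_eq by auto
  then show "c - d \<in> rels"
    by simp
next
  assume *: "c - d \<in> rels"
  have "n + (c - d) \<in> rels" "n + (d - c) \<in> rels" if "n \<in> rels" for n
    using tensor_rels_diff[OF that tensor_rels_diff[OF tensor_rels_zero *]] tensor_rels_diff[OF that *]
    by (simp_all add: algebra_simps)
  moreover have "n + c = (n + (c - d)) + d" "n + d = (n + (d - c)) + c" for n
    by simp_all
  ultimately have "\<exists>m. n + c = m + d \<and> m \<in> rels" "\<exists>m. n + d = m + c \<and> m \<in> rels"
    if "n \<in> rels" for n
    using that by blast+
  then show "coset c = coset d"
    unfolding tensor_coset_eq by blast
qed

lemma base_change_carrier: "carrier RB = coset ` carrier (tensor_free R B)"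
  by (auto simp: base_change_def FactGroup_def RCOSETS_def tensor_coset_def)

lemma base_change_cases:
  assumes "t \<in> carrier RB"
  obtains c where "formal_sum c" and "t = coset c"
  using assms by (auto simp: base_change_carrier)

lemma tensor_coset_closed:
  "formal_sum c \<Longrightarrow> coset c \<in> carrier RB"
  by (auto simp: base_change_carrier)

lemma pure_tensor_closed:
  "r \<in> carrier R \<Longrightarrow> b \<in> carrier B \<Longrightarrow> pure_tensor R B r b \<in> carrier RB"
  by (auto simp: pure_tensor_def intro!: tensor_coset_closed)

lemma base_change_add_coset:
  assumes "formal_sum c"
    and "formal_sum d"
  shows "coset c \<oplus>\<^bsub>RB\<^esub> coset d = coset (c + d)"
  using normal.rcos_sum[OF normal_tensor_rels, of c d] assms
  by (simp add: base_change_def FactGroup_def tensor_coset_def)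

lemma base_change_zero: "\<zero>\<^bsub>RB\<^esub> = coset 0"
  by (auto simp: base_change_def FactGroup_def tensor_coset_eq)

lemma abelian_group_base_change: "abelian_group RB"
proof (rule abelian_groupI)
  fix t
  assume "t \<in> carrier RB"
  then obtain c where c: "formal_sum c" "t = coset c"
    by (rule base_change_cases)
  then have "coset (- c) \<oplus>\<^bsub>RB\<^esub> t = \<zero>\<^bsub>RB\<^esub>"
    by (simp add: base_change_add_coset base_change_zero)
  moreover have "coset (- c) \<in> carrier RB"
    using c by (intro tensor_coset_closed) simp
  ultimately show "\<exists>u\<in>carrier RB. u \<oplus>\<^bsub>RB\<^esub> t = \<zero>\<^bsub>RB\<^esub>"
    by blast
qed (auto simp: base_change_carrier base_change_zero base_change_add_coset keys_add_subset add_ac)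

lemma base_change_minus_coset:
  assumes "formal_sum c"
    and "formal_sum d"
  shows "coset c \<ominus>\<^bsub>RB\<^esub> coset d = coset (c - d)"
proof -
  interpret M: abelian_group RB
    by (rule abelian_group_base_change)
  have "coset (c - d) \<oplus>\<^bsub>RB\<^esub> coset d = coset c"
    using assms by (simp add: base_change_add_coset keys_diff_subset)
  then show ?thesis
    using M.add.inv_solve_right[of "coset (c - d)" "coset c" "coset d"]
      assms by (simp add: a_minus_def tensor_coset_closed keys_diff_subset)
qed

text \<open>The pure tensors generate the additive group, and subtraction yields sums as well as
  negatives.\<close>

lemma base_change_induct [consumes 1, case_names zero pure minus]:
  assumes "t \<in> carrier RB"
    and "P \<zero>\<^bsub>RB\<^esub>"
    and "\<And>r b. r \<in> carrier R \<Longrightarrow> b \<in> carrier B \<Longrightarrow> P (pure_tensor R B r b)"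
    and "\<And>t u. t \<in> carrier RB \<Longrightarrow> u \<in> carrier RB \<Longrightarrow> P t \<Longrightarrow> P u \<Longrightarrow>
      P (t \<ominus>\<^bsub>RB\<^esub> u)"
  shows "P t"
proof -
  obtain c where c: "formal_sum c" and t: "t = coset c"
    using assms(1) by (rule base_change_cases)
  have "P (coset c)"
    using c
  proof (rule free_Abelian_group_induct)
    show "P (coset 0)"
      using assms(2) by (simp add: base_change_zero)
    show "P (coset (c - d))"
      if "formal_sum c" "formal_sum d"
        "P (coset c)" "P (coset d)" for c d
      using that assms(4) by (simp add: tensor_coset_closed flip: base_change_minus_coset)
    show "P (coset (frag_of a))" if "a \<in> carrier R \<times> carrier B" for a
      using that assms(3) by (auto simp: pure_tensor_def)
  qed
  then show ?thesis
    by (simp add: t)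
qed

lemma pure_tensor_add_left:
  assumes "r \<in> carrier R" and "s \<in> carrier R" and "b \<in> carrier B"
  shows "pure_tensor R B (r \<oplus> s) b = pure_tensor R B r b \<oplus>\<^bsub>RB\<^esub> pure_tensor R B s b"
proof -
  have "frag_of (r \<oplus> s, b) - frag_of (r, b) - frag_of (s, b) \<in> rels"
    unfolding tensor_rels_eq biadditivity_relations_def using assms by (intro generate.incl) blast
  then show ?thesis
    using assms by (simp add: pure_tensor_def base_change_add_coset tensor_coset_eq_iff diff_diff_eq)
qed

lemma pure_tensor_add_right:
  assumes "r \<in> carrier R" and "b \<in> carrier B" and "c \<in> carrier B"
  shows "pure_tensor R B r (b \<oplus>\<^bsub>B\<^esub> c) = pure_tensor R B r b \<oplus>\<^bsub>RB\<^esub> pure_tensor R B r c"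
proof -
  have "frag_of (r, b \<oplus>\<^bsub>B\<^esub> c) - frag_of (r, b) - frag_of (r, c) \<in> rels"
    unfolding tensor_rels_eq biadditivity_relations_def using assms by (intro generate.incl) blast
  then show ?thesis
    using assms by (simp add: pure_tensor_def base_change_add_coset tensor_coset_eq_iff diff_diff_eq)
qed

text \<open>The universal property of the tensor product: since the relations are generated by the
  defects of biadditivity, a homomorphism that is biadditive on the generators kills them all.\<close>

lemma biadditive_vanishes_on_tensor_rels:
  assumes A: "abelian_group A" and h: "h \<in> hom (tensor_free R B) (add_monoid A)"
    and left: "\<And>r s b. r \<in> carrier R \<Longrightarrow> s \<in> carrier R \<Longrightarrow> b \<in> carrier B \<Longrightarrow>
      h (frag_of (r \<oplus> s, b)) = h (frag_of (r, b)) \<oplus>\<^bsub>A\<^esub> h (frag_of (s, b))"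
    and right: "\<And>r b c. r \<in> carrier R \<Longrightarrow> b \<in> carrier B \<Longrightarrow> c \<in> carrier B \<Longrightarrow>
      h (frag_of (r, b \<oplus>\<^bsub>B\<^esub> c)) = h (frag_of (r, b)) \<oplus>\<^bsub>A\<^esub> h (frag_of (r, c))"
    and "n \<in> rels"
  shows "h n = \<zero>\<^bsub>A\<^esub>"
proof -
  interpret A: abelian_group A by (rule A)
  interpret h: group_hom "tensor_free R B" "add_monoid A" h
    using h group_tensor_free A.a_group by (simp add: group_hom_def group_hom_axioms_def)
  have vanish: "h (x - y - z) = \<zero>\<^bsub>A\<^esub>"
    if "h x = h y \<oplus>\<^bsub>A\<^esub> h z" "x \<in> carrier (tensor_free R B)" "y \<in> carrier (tensor_free R B)"
      "z \<in> carrier (tensor_free R B)" for x y z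
  proof -
    have d: "x - y - z \<in> carrier (tensor_free R B)" "y + z \<in> carrier (tensor_free R B)"
      using that by (simp_all add: keys_diff_subset keys_add_subset)
    have "h x = h (x - y - z) \<oplus>\<^bsub>A\<^esub> (h y \<oplus>\<^bsub>A\<^esub> h z)"
      using h.hom_mult[of "x - y - z" "y + z"] h.hom_mult[of y z] that(2-4) d
      by (simp add: algebra_simps)
    then show ?thesis
      using that d h.hom_closed[of x] h.hom_closed[of "x - y - z"] A.add.l_cancel_one' by simp
  qed
  have "biadditivity_relations \<subseteq> kernel (tensor_free R B) (add_monoid A) h"
  proof
    fix x
    assume x: "x \<in> biadditivity_relations"
    have "h x = \<zero>\<^bsub>A\<^esub>"
      using x unfolding biadditivity_relations_def
      by (auto intro!: vanish simp: B_add_closed left right)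
    then show "x \<in> kernel (tensor_free R B) (add_monoid A) h"
      using x biadditivity_relations_subset by (auto simp: kernel_def simp del: tensor_free_simps)
  qed
  then have "rels \<subseteq> kernel (tensor_free R B) (add_monoid A) h"
    unfolding tensor_rels_eq
    by (intro group.generate_subgroup_incl[OF group_tensor_free] h.subgroup_kernel)
  then show ?thesis
    using assms(5) by (auto simp: kernel_def)
qed

definition scale :: "'r \<Rightarrow> ('r \<times> 'b \<Rightarrow>\<^sub>0 int) \<Rightarrow> ('r \<times> 'b \<Rightarrow>\<^sub>0 int)"
  where "scale r = frag_extend (\<lambda>(s, b). frag_of (r \<otimes> s, b))"

lemma scale_closed:
  assumes "r \<in> carrier R" and "formal_sum c"
  shows "formal_sum (scale r c)"
  unfolding scale_def using assms
  by (intro order.trans[OF keys_frag_extend]) (auto split: prod.splits)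

lemma scale_add: "scale r (c + d) = scale r c + scale r d"
  and scale_diff: "scale r (c - d) = scale r c - scale r d"
  and scale_of: "scale r (frag_of (s, b)) = frag_of (r \<otimes> s, b)"
  and scale_zero: "scale r 0 = 0"
  by (simp_all add: scale_def frag_extend_add frag_extend_diff)

text \<open>Multiplication by \<open>r\<close> on the representatives, followed by the passage to cosets, sends
  \<open>(s, b)\<close> to \<open>rs \<otimes> b\<close>, which is biadditive in \<open>s\<close> and \<open>b\<close>.\<close>

lemma scale_preserves_tensor_rels:
  assumes r: "r \<in> carrier R" and n: "n \<in> rels"
  shows "scale r n \<in> rels"
proof -
  let ?h = "\<lambda>c. coset (scale r c)"
  have of: "?h (frag_of (s, b)) = pure_tensor R B (r \<otimes> s) b" for s b
    by (simp add: scale_of pure_tensor_def)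
  have "?h n = \<zero>\<^bsub>RB\<^esub>"
  proof (rule biadditive_vanishes_on_tensor_rels[OF abelian_group_base_change _ _ _ n])
    show "?h \<in> hom (tensor_free R B) (add_monoid RB)"
      using scale_closed[OF r]
      by (intro homI) (simp_all add: tensor_coset_closed base_change_add_coset scale_add)
    fix s s' b
    assume "s \<in> carrier R" "s' \<in> carrier R" "b \<in> carrier B"
    then show "?h (frag_of (s \<oplus> s', b)) = ?h (frag_of (s, b)) \<oplus>\<^bsub>RB\<^esub> ?h (frag_of (s', b))"
      unfolding of using r by (simp add: r_distr pure_tensor_add_left)
  next
    fix s b b'
    assume "s \<in> carrier R" "b \<in> carrier B" "b' \<in> carrier B"
    then show "?h (frag_of (s, b \<oplus>\<^bsub>B\<^esub> b')) = ?h (frag_of (s, b)) \<oplus>\<^bsub>RB\<^esub> ?h (frag_of (s, b'))"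
      unfolding of using r by (simp add: pure_tensor_add_right)
  qed
  then show ?thesis
    using tensor_coset_eq_iff[of "scale r n" 0] by (simp add: base_change_zero)
qed

lemma base_change_smult_coset:
  assumes r: "r \<in> carrier R"
  shows "r \<odot>\<^bsub>RB\<^esub> coset c = coset (scale r c)"
proof -
  have "coset (scale r d) = coset (scale r c)" if "d \<in> coset c" for d
  proof -
    from that have "d - c \<in> rels"
      by (auto simp: tensor_coset_eq)
    then show ?thesis
      using scale_preserves_tensor_rels[OF r] by (simp add: tensor_coset_eq_iff flip: scale_diff)
  qed
  moreover have "c \<in> coset c"
    using tensor_rels_zero by (force simp: tensor_coset_eq)
  ultimately have "(\<Union>d\<in>coset c. coset (scale r d)) = coset (scale r c)"
    by blast
  then show ?thesis
    by (simp add: base_change_def scale_def)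
qed

lemma base_change_smult_closed:
  assumes "r \<in> carrier R" and "t \<in> carrier RB"
  shows "r \<odot>\<^bsub>RB\<^esub> t \<in> carrier RB"
  using assms(2) by (rule base_change_cases)
    (simp add: base_change_smult_coset assms(1) scale_closed tensor_coset_closed)

lemma base_change_smult_add:
  assumes r: "r \<in> carrier R" and t: "t \<in> carrier RB" and u: "u \<in> carrier RB"
  shows "r \<odot>\<^bsub>RB\<^esub> (t \<oplus>\<^bsub>RB\<^esub> u) =
    r \<odot>\<^bsub>RB\<^esub> t \<oplus>\<^bsub>RB\<^esub> r \<odot>\<^bsub>RB\<^esub> u"
proof -
  obtain c where "formal_sum c" "t = coset c"
    using t by (rule base_change_cases)
  moreover obtain d where "formal_sum d" "u = coset d"
    using u by (rule base_change_cases)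
  ultimately show ?thesis
    using scale_closed[OF r]
    by (simp add: base_change_add_coset base_change_smult_coset[OF r] scale_add)
qed

lemma base_change_smult_pure:
  assumes "r \<in> carrier R"
  shows "r \<odot>\<^bsub>RB\<^esub> pure_tensor R B s b = pure_tensor R B (r \<otimes> s) b"
  by (simp add: pure_tensor_def base_change_smult_coset[OF assms] scale_of scale_zero)

lemma base_change_smult_minus:
  assumes r: "r \<in> carrier R" and t: "t \<in> carrier RB" and u: "u \<in> carrier RB"
  shows "r \<odot>\<^bsub>RB\<^esub> (t \<ominus>\<^bsub>RB\<^esub> u) =
    r \<odot>\<^bsub>RB\<^esub> t \<ominus>\<^bsub>RB\<^esub> r \<odot>\<^bsub>RB\<^esub> u"
proof -
  interpret M: abelian_group RB
    by (rule abelian_group_base_change)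
  have "r \<odot>\<^bsub>RB\<^esub> (t \<ominus>\<^bsub>RB\<^esub> u) \<oplus>\<^bsub>RB\<^esub> r \<odot>\<^bsub>RB\<^esub> u =
    r \<odot>\<^bsub>RB\<^esub> t"
    using r t u
    by (simp flip: base_change_smult_add) (simp add: a_minus_def M.a_assoc M.l_neg)
  then show ?thesis
    using r t u by (simp add: a_minus_def base_change_smult_closed M.add.inv_solve_right)
qed

lemma base_change_smult_zero:
  assumes "r \<in> carrier R"
  shows "r \<odot>\<^bsub>RB\<^esub> \<zero>\<^bsub>RB\<^esub> = \<zero>\<^bsub>RB\<^esub>"
  by (simp add: base_change_zero base_change_smult_coset[OF assms] scale_of scale_zero)

text \<open>The remaining module axioms are identities between additive maps, hence need to be checked on
  pure tensors only.\<close>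

lemma module_base_change: "module R RB"
proof -
  interpret M: abelian_group RB
    by (rule abelian_group_base_change)
  show ?thesis
  proof (rule moduleI)
    fix r s t
    assume r: "r \<in> carrier R" and s: "s \<in> carrier R" and t: "t \<in> carrier RB"
    show "(r \<oplus> s) \<odot>\<^bsub>RB\<^esub> t = r \<odot>\<^bsub>RB\<^esub> t \<oplus>\<^bsub>RB\<^esub> s \<odot>\<^bsub>RB\<^esub> t"
      using t
    proof (induction t rule: base_change_induct)
      case (minus t u)
      with r s show ?case
        by (simp add: base_change_smult_minus base_change_smult_closed M.add_minus_add)
    qed (use r s in \<open>auto simp: base_change_smult_zero base_change_smult_pure l_distr pure_tensor_add_left\<close>)
    show "(r \<otimes> s) \<odot>\<^bsub>RB\<^esub> t = r \<odot>\<^bsub>RB\<^esub> (s \<odot>\<^bsub>RB\<^esub> t)"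
      using t
    proof (induction t rule: base_change_induct)
      case (minus t u)
      with r s show ?case
        by (simp add: base_change_smult_minus base_change_smult_closed)
    qed (use r s in \<open>auto simp: base_change_smult_zero base_change_smult_pure m_assoc\<close>)
  next
    fix t
    assume "t \<in> carrier RB"
    then show "\<one> \<odot>\<^bsub>RB\<^esub> t = t"
      by (induction t rule: base_change_induct)
        (auto simp: base_change_smult_zero base_change_smult_pure base_change_smult_minus)
  qed (auto simp: is_cring abelian_group_base_change base_change_smult_closed base_change_smult_add)
qed

lemma module_hom_eq_on_base_change:
  assumes N: "abelian_group N" and f: "f \<in> module_hom R RB N"
    and g: "g \<in> module_hom R RB N"
    and eq: "\<And>r b. r \<in> carrier R \<Longrightarrow> b \<in> carrier B \<Longrightarrow> f (pure_tensor R B r b) = g (pure_tensor R B r b)"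
    and "t \<in> carrier RB"
  shows "f t = g t"
proof -
  interpret f: abelian_group_hom "RB" N f
    by (rule module_hom_abelian_group_hom[OF abelian_group_base_change N f])
  interpret g: abelian_group_hom "RB" N g
    by (rule module_hom_abelian_group_hom[OF abelian_group_base_change N g])
  show ?thesis
    using assms(5)
    by (induction t rule: base_change_induct)
      (simp_all add: eq module_hom_minus[OF abelian_group_base_change N f]
        module_hom_minus[OF abelian_group_base_change N g])
qed

lemma int_coeffs_closed [simp]: "int_coeffs R S v \<in> carrier (free_module R S)"
  by (auto simp: int_coeffs_def)

lemma int_coeffs_add:
  assumes "\<And>s. s \<in> S \<Longrightarrow> u s = v s + w s"
  shows "int_coeffs R S u = int_coeffs R S v \<oplus>\<^bsub>free_module R S\<^esub> int_coeffs R S w"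
  using assms by (auto simp: int_coeffs_def add.int_pow_mult)

context
  fixes S :: "'s set" and f :: "'b \<Rightarrow> 's \<Rightarrow> int"
  assumes f_add: "\<And>b c s. b \<in> carrier B \<Longrightarrow> c \<in> carrier B \<Longrightarrow> s \<in> S \<Longrightarrow>
    f (b \<oplus>\<^bsub>B\<^esub> c) s = f b s + f c s"
begin

abbreviation (input) generator_value :: "'r \<times> 'b \<Rightarrow> 's \<Rightarrow> 'r"
  where "generator_value \<equiv> \<lambda>(r, b). r \<odot>\<^bsub>free_module R S\<^esub> int_coeffs R S (f b)"

lemma free_lift_generator_value_hom:
  "free_lift (free_module R S) generator_value \<in> hom (tensor_free R B) (add_monoid (free_module R S))"
  unfolding tensor_free_def
proof (rule abelian_group.free_lift_hom[OF abelian_group_free_module])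
  interpret M: module R "free_module R S" by (rule module_free_module)
  show "generator_value \<in> carrier R \<times> carrier B \<rightarrow> carrier (free_module R S)"
    by (auto simp del: free_module_carrier free_module_smult)
qed

lemma free_lift_generator_value_of:
  assumes "r \<in> carrier R"
  shows "free_lift (free_module R S) generator_value (frag_of (r, b)) =
    r \<odot>\<^bsub>free_module R S\<^esub> int_coeffs R S (f b)"
proof -
  interpret M: module R "free_module R S" by (rule module_free_module)
  show ?thesis
    using abelian_group.free_lift_of[OF abelian_group_free_module, of generator_value "(r, b)"] assms
    by (simp del: free_module_carrier free_module_smult)
qed

text \<open>As \<open>f\<close> is additive, the homomorphism induced by \<open>(r, b) \<mapsto> r f(b)\<close> kills the relations and is
  constant on each coset, so that \<^const>\<open>the_elem\<close> selects its value.\<close>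

lemma scalar_ext_coset:
  assumes c: "formal_sum c"
  shows "scalar_ext R S f (coset c) = free_lift (free_module R S) generator_value c"
proof -
  interpret M: module R "free_module R S" by (rule module_free_module)
  let ?L = "free_lift (free_module R S) generator_value"
  interpret L: group_hom "tensor_free R B" "add_monoid (free_module R S)" ?L
    using free_lift_generator_value_hom group_tensor_free M.a_group
    by (simp add: group_hom_def group_hom_axioms_def)
  have vanish: "?L n = \<zero>\<^bsub>free_module R S\<^esub>" if "n \<in> rels" for n
  proof (rule biadditive_vanishes_on_tensor_rels[OF M.abelian_group_axioms free_lift_generator_value_hom _ _ that])
    fix r s b
    assume "r \<in> carrier R" "s \<in> carrier R" "b \<in> carrier B"
    then show "?L (frag_of (r \<oplus> s, b)) = ?L (frag_of (r, b)) \<oplus>\<^bsub>free_module R S\<^esub> ?L (frag_of (s, b))"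
      using M.smult_l_distr[of r s "int_coeffs R S (f b)"] int_coeffs_closed
      by (simp add: free_lift_generator_value_of del: free_module_carrier free_module_smult free_module_add)
  next
    fix r b b'
    assume "r \<in> carrier R" and b: "b \<in> carrier B" "b' \<in> carrier B"
    then show "?L (frag_of (r, b \<oplus>\<^bsub>B\<^esub> b')) =
      ?L (frag_of (r, b)) \<oplus>\<^bsub>free_module R S\<^esub> ?L (frag_of (r, b'))"
      using M.smult_r_distr[of r "int_coeffs R S (f b)" "int_coeffs R S (f b')"] int_coeffs_closed
        int_coeffs_add[where u = "f (b \<oplus>\<^bsub>B\<^esub> b')" and v = "f b" and w = "f b'" and S = S, OF f_add[OF b]]
      by (simp add: free_lift_generator_value_of del: free_module_carrier free_module_smult free_module_add)
  qed
  have "?L d = ?L c" if "d \<in> coset c" for d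
  proof -
    from that obtain n where n: "n \<in> rels" "d = n + c"
      by (auto simp: tensor_coset_eq)
    moreover have "n \<in> carrier (tensor_free R B)"
      using n subgroup.mem_carrier[OF subgroup_tensor_rels] by blast
    ultimately show ?thesis
      using L.hom_mult[of n c] L.hom_closed[of c] vanish[of n] c M.l_zero
      by (simp del: free_module_carrier free_module_zero free_module_add)
  qed
  moreover have "c \<in> coset c"
    using tensor_rels_zero by (force simp: tensor_coset_eq)
  ultimately have "?L ` coset c = {?L c}"
    by blast
  then show ?thesis
    by (simp add: scalar_ext_def Let_def free_lift_def case_prod_beta')
qed

lemma scalar_ext_pure:
  assumes "r \<in> carrier R" and "b \<in> carrier B"
  shows "scalar_ext R S f (pure_tensor R B r b) = r \<odot>\<^bsub>free_module R S\<^esub> int_coeffs R S (f b)"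
  using assms
  by (simp add: pure_tensor_def scalar_ext_coset free_lift_generator_value_of del: free_module_smult)

lemma scalar_ext_hom: "scalar_ext R S f \<in> module_hom R RB (free_module R S)"
proof -
  interpret M: module R "free_module R S" by (rule module_free_module)
  interpret T: module R "RB" by (rule module_base_change)
  let ?M = "free_module R S"
  let ?L = "free_lift (free_module R S) generator_value"
  interpret L: group_hom "tensor_free R B" "add_monoid ?M" ?L
    using free_lift_generator_value_hom group_tensor_free M.a_group
    by (simp add: group_hom_def group_hom_axioms_def)
  have closed: "scalar_ext R S f t \<in> carrier ?M" if "t \<in> carrier RB" for t
    using that by (rule base_change_cases) (use L.hom_closed in \<open>simp add: scalar_ext_coset\<close>)
  have add: "scalar_ext R S f (t \<oplus>\<^bsub>RB\<^esub> u) = scalar_ext R S f t \<oplus>\<^bsub>?M\<^esub> scalar_ext R S f u"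
    if t: "t \<in> carrier RB" and u: "u \<in> carrier RB" for t u
  proof -
    obtain c where "formal_sum c" "t = coset c"
      using t by (rule base_change_cases)
    moreover obtain d where "formal_sum d" "u = coset d"
      using u by (rule base_change_cases)
    ultimately show ?thesis
      using L.hom_mult[of c d]
      by (simp add: base_change_add_coset scalar_ext_coset keys_add_subset del: free_module_add)
  qed
  interpret E: abelian_group_hom "RB" ?M "scalar_ext R S f"
    using closed add T.a_group M.a_group
    by (intro abelian_group_homI T.abelian_group_axioms M.abelian_group_axioms group_hom.intro
        group_hom_axioms.intro)
      (auto simp: hom_def simp del: free_module_carrier free_module_add)
  have "scalar_ext R S f (r \<odot>\<^bsub>RB\<^esub> t) = r \<odot>\<^bsub>?M\<^esub> scalar_ext R S f t"
    if r: "r \<in> carrier R" and t: "t \<in> carrier RB" for r t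
    using t
  proof (induction t rule: base_change_induct)
    case zero
    then show ?case
      using r M.smult_r_null by (simp add: base_change_smult_zero del: free_module_zero free_module_smult)
  next
    case (pure s b)
    then show ?case
      using r M.smult_assoc1[OF r pure(1) int_coeffs_closed]
      by (simp add: base_change_smult_pure scalar_ext_pure del: free_module_smult)
  next
    case (minus t u)
    have "scalar_ext R S f (x \<ominus>\<^bsub>RB\<^esub> y) = scalar_ext R S f x \<ominus>\<^bsub>?M\<^esub> scalar_ext R S f y"
      if "x \<in> carrier RB" "y \<in> carrier RB" for x y
      using that by (simp add: a_minus_def del: free_module_add)
    moreover have "r \<odot>\<^bsub>?M\<^esub> (v \<ominus>\<^bsub>?M\<^esub> w) = r \<odot>\<^bsub>?M\<^esub> v \<ominus>\<^bsub>?M\<^esub> r \<odot>\<^bsub>?M\<^esub> w"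
      if "v \<in> carrier ?M" "w \<in> carrier ?M" for v w
      using that r by (simp add: a_minus_def M.smult_r_distr M.smult_r_minus del: free_module_smult free_module_add free_module_carrier)
    ultimately show ?case
      using minus r closed
      by (simp add: base_change_smult_minus T.smult_closed del: free_module_smult free_module_carrier)
  qed
  then show ?thesis
    using closed add by (auto simp: module_hom_def simp del: free_module_smult free_module_add free_module_carrier)
qed

end

end

section \<open>Finite sets with an action, up to isomorphism\<close>

lemma (in group) group_actionI:
  assumes closed: "\<And>g x. g \<in> carrier G \<Longrightarrow> x \<in> E \<Longrightarrow> \<phi> g x \<in> E"
    and one: "\<And>x. x \<in> E \<Longrightarrow> \<phi> \<one> x = x"
    and mult: "\<And>g h x. g \<in> carrier G \<Longrightarrow> h \<in> carrier G \<Longrightarrow> x \<in> E \<Longrightarrow> \<phi> (g \<otimes> h) x = \<phi> g (\<phi> h x)"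
    and ext: "\<And>g. g \<in> carrier G \<Longrightarrow> \<phi> g \<in> extensional E"
  shows "group_action G E \<phi>"
proof -
  have "\<phi> g \<in> Bij E" if g: "g \<in> carrier G" for g
  proof -
    have "bij_betw (\<phi> g) E E"
    proof (rule bij_betw_byWitness[where f' = "\<phi> (inv g)"])
      show "\<forall>x\<in>E. \<phi> (inv g) (\<phi> g x) = x" "\<forall>x\<in>E. \<phi> g (\<phi> (inv g) x) = x"
        using g one by (simp_all flip: mult)
    qed (use g closed in auto)
    then show ?thesis
      using ext[OF g] by (simp add: Bij_def)
  qed
  moreover have "\<phi> (g \<otimes> h) = compose E (\<phi> g) (\<phi> h)" if "g \<in> carrier G" "h \<in> carrier G" for g h
    using that mult ext[of "g \<otimes> h"] by (auto simp: compose_def fun_eq_iff extensional_def)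
  ultimately have "\<phi> \<in> hom G (BijGroup E)"
    by (auto simp: hom_def BijGroup_def)
  then show ?thesis
    by (intro group_action.intro group_hom.intro group_hom_axioms.intro group_BijGroup is_group)
qed

text \<open>The coefficient of \<open>U\<close> in \<open>\<alpha>([X])\<close>.\<close>

definition stab_count :: "('g, 'm) monoid_scheme \<Rightarrow> ('g, 'x) gset \<Rightarrow> 'g set \<Rightarrow> nat"
  where "stab_count G X U = card {x \<in> fst X. stabilizer G (snd X) x = U}"

definition gset_restrict :: "('g, 'x) gset \<Rightarrow> 'x set \<Rightarrow> ('g, 'x) gset"
  where "gset_restrict X A = (A, \<lambda>g. \<lambda>x\<in>A. snd X g x)"

lemma gset_iso_sum_cong:
  assumes "gset_iso G X X'" and "gset_iso G Y Y'"
  shows "gset_iso G (gset_sum X Y) (gset_sum X' Y')"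
proof -
  obtain f where f: "bij_betw f (fst X) (fst X')"
    "\<forall>g\<in>carrier G. \<forall>x\<in>fst X. f (snd X g x) = snd X' g (f x)"
    using assms(1) by (auto simp: gset_iso_def)
  obtain h where h: "bij_betw h (fst Y) (fst Y')"
    "\<forall>g\<in>carrier G. \<forall>x\<in>fst Y. h (snd Y g x) = snd Y' g (h x)"
    using assms(2) by (auto simp: gset_iso_def)
  have "bij_betw (map_sum f h) (fst X <+> fst Y) (fst X' <+> fst Y')"
  proof (rule bij_betw_imageI)
    show "inj_on (map_sum f h) (fst X <+> fst Y)"
      using bij_betw_imp_inj_on[OF f(1)] bij_betw_imp_inj_on[OF h(1)]
      by (auto intro!: inj_onI dest: inj_onD)
    have "map_sum f h ` (fst X <+> fst Y) = f ` fst X <+> h ` fst Y"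
      by (simp add: Plus_def image_Un image_image)
    then show "map_sum f h ` (fst X <+> fst Y) = fst X' <+> fst Y'"
      using f(1) h(1) by (simp add: bij_betw_def)
  qed
  moreover have "f x \<in> fst X'" if "x \<in> fst X" for x
    using f(1) that by (auto simp: bij_betw_def)
  moreover have "h x \<in> fst Y'" if "x \<in> fst Y" for x
    using h(1) that by (auto simp: bij_betw_def)
  ultimately show ?thesis
    using f(2) h(2) unfolding gset_iso_def gset_sum_def
    by (intro exI[of _ "map_sum f h"]) auto
qed

lemma gset_iso_trans:
  assumes "gset_iso G X Y" and "gset_iso G Y Z"
  shows "gset_iso G X Z"
proof -
  obtain f where f: "bij_betw f (fst X) (fst Y)"
    "\<forall>g\<in>carrier G. \<forall>x\<in>fst X. f (snd X g x) = snd Y g (f x)"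
    using assms(1) by (auto simp: gset_iso_def)
  obtain h where h: "bij_betw h (fst Y) (fst Z)"
    "\<forall>g\<in>carrier G. \<forall>x\<in>fst Y. h (snd Y g x) = snd Z g (h x)"
    using assms(2) by (auto simp: gset_iso_def)
  have "f x \<in> fst Y" if "x \<in> fst X" for x
    using f(1) that by (auto simp: bij_betw_def)
  then show ?thesis
    using bij_betw_trans[OF f(1) h(1)] f(2) h(2) unfolding gset_iso_def
    by (intro exI[of _ "h \<circ> f"]) auto
qed

lemma gset_iso_refl: "gset_iso G X X"
  unfolding gset_iso_def by (intro exI[of _ id]) auto

locale finite_group = group G
  for G :: "('g, 'm) monoid_scheme" (structure) +
  assumes finite_carrier: "finite (carrier G)"
begin

lemma finite_gset_action: "finite_gset G X \<Longrightarrow> group_action G (fst X) (snd X)"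
  by (simp add: finite_gset_def)

lemma gset_closed:
  "finite_gset G X \<Longrightarrow> g \<in> carrier G \<Longrightarrow> x \<in> fst X \<Longrightarrow> snd X g x \<in> fst X"
  using group_action.element_image[OF finite_gset_action] by metis

lemma gset_one: "finite_gset G X \<Longrightarrow> x \<in> fst X \<Longrightarrow> snd X \<one> x = x"
  using group_action.id_eq_one[OF finite_gset_action] by (metis restrict_apply')

lemma gset_mult:
  "finite_gset G X \<Longrightarrow> g \<in> carrier G \<Longrightarrow> h \<in> carrier G \<Longrightarrow> x \<in> fst X \<Longrightarrow>
    snd X (g \<otimes> h) x = snd X g (snd X h x)"
  by (rule group_action.composition_rule[OF finite_gset_action])

lemma gset_inv_apply:
  "finite_gset G X \<Longrightarrow> g \<in> carrier G \<Longrightarrow> x \<in> fst X \<Longrightarrow> snd X (inv g) (snd X g x) = x"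
  by (simp add: gset_one flip: gset_mult)

lemma gset_apply_inv:
  "finite_gset G X \<Longrightarrow> g \<in> carrier G \<Longrightarrow> x \<in> fst X \<Longrightarrow> snd X g (snd X (inv g) x) = x"
  by (simp add: gset_one flip: gset_mult)

lemma finite_gset_finite: "finite_gset G X \<Longrightarrow> finite (fst X)"
  by (simp add: finite_gset_def)

lemma stabilizer_subgroup:
  "finite_gset G X \<Longrightarrow> x \<in> fst X \<Longrightarrow> subgroup (stabilizer G (snd X) x) G"
  by (rule group_action.stabilizer_subgroup[OF finite_gset_action])

lemma gset_iso_sym:
  assumes X: "finite_gset G X" and "gset_iso G X Y"
  shows "gset_iso G Y X"
proof -
  obtain f where f: "bij_betw f (fst X) (fst Y)"
    "\<forall>g\<in>carrier G. \<forall>x\<in>fst X. f (snd X g x) = snd Y g (f x)"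
    using assms(2) by (auto simp: gset_iso_def)
  let ?f' = "inv_into (fst X) f"
  have inv: "?f' y \<in> fst X" "f (?f' y) = y" if "y \<in> fst Y" for y
    using f(1) that by (auto simp: bij_betw_def inv_into_into f_inv_into_f)
  have "?f' (snd Y g y) = snd X g (?f' y)" if "g \<in> carrier G" "y \<in> fst Y" for g y
  proof -
    have "f (snd X g (?f' y)) = snd Y g y"
      using f(2) that inv by simp
    then show ?thesis
      using f(1) gset_closed[OF X that(1) inv(1)[OF that(2)]]
      by (metis bij_betw_imp_inj_on inv_into_f_f)
  qed
  then show ?thesis
    unfolding gset_iso_def using bij_betw_inv_into[OF f(1)] by blast
qed

lemma gset_iso_stab_count:
  assumes X: "finite_gset G X" and "gset_iso G X Y"
  shows "stab_count G X U = stab_count G Y U"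
proof -
  obtain f where f: "bij_betw f (fst X) (fst Y)"
    and equiv: "\<And>g x. g \<in> carrier G \<Longrightarrow> x \<in> fst X \<Longrightarrow> f (snd X g x) = snd Y g (f x)"
    using assms(2) by (auto simp: gset_iso_def)
  have stab: "stabilizer G (snd Y) (f x) = stabilizer G (snd X) x" if x: "x \<in> fst X" for x
  proof -
    have "snd Y g (f x) = f x \<longleftrightarrow> snd X g x = x" if "g \<in> carrier G" for g
      using equiv[OF that x] inj_onD[OF bij_betw_imp_inj_on[OF f]] gset_closed[OF X that x] x
      by metis
    then show ?thesis
      by (auto simp: stabilizer_def)
  qed
  have "bij_betw f {x \<in> fst X. stabilizer G (snd X) x = U} {y \<in> fst Y. stabilizer G (snd Y) y = U}"
  proof (rule bij_betwI')
    fix y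
    assume "y \<in> {y \<in> fst Y. stabilizer G (snd Y) y = U}"
    moreover then obtain x where "x \<in> fst X" "y = f x"
      using f by (auto simp: bij_betw_def)
    ultimately show "\<exists>x\<in>{x \<in> fst X. stabilizer G (snd X) x = U}. y = f x"
      using stab by auto
  qed (use f stab in \<open>auto simp: bij_betw_def inj_on_def\<close>)
  then show ?thesis
    unfolding stab_count_def by (rule bij_betw_same_card)
qed

lemma finite_gset_empty: "finite_gset G (gset_empty :: ('g, 'x) gset)"
  unfolding finite_gset_def gset_empty_def by (auto intro!: group_actionI)

lemma finite_gset_sum:
  assumes X: "finite_gset G X" and Y: "finite_gset G Y"
  shows "finite_gset G (gset_sum X Y)"
  unfolding finite_gset_def gset_sum_def
  using X Y
  by (auto intro!: group_actionI simp: finite_gset_finite gset_closed gset_one gset_mult)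

lemma finite_gset_restrict:
  assumes X: "finite_gset G X" and "A \<subseteq> fst X"
    and "\<And>g x. g \<in> carrier G \<Longrightarrow> x \<in> A \<Longrightarrow> snd X g x \<in> A"
  shows "finite_gset G (gset_restrict X A)"
  unfolding finite_gset_def gset_restrict_def
  using X assms(2,3) finite_subset[OF assms(2) finite_gset_finite[OF X]]
  by (auto intro!: group_actionI simp: gset_one gset_mult subset_iff)

lemma stab_count_empty: "fst X = {} \<Longrightarrow> stab_count G X U = 0"
  by (simp add: stab_count_def)

lemma stab_count_sum:
  assumes "finite_gset G X" and "finite_gset G Y"
  shows "stab_count G (gset_sum X Y) U = stab_count G X U + stab_count G Y U"
proof -
  have fst_sum: "fst (gset_sum X Y) = fst X <+> fst Y"
    by (simp add: gset_sum_def)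
  have "{z \<in> fst (gset_sum X Y). stabilizer G (snd (gset_sum X Y)) z = U} =
    {x \<in> fst X. stabilizer G (snd X) x = U} <+> {y \<in> fst Y. stabilizer G (snd Y) y = U}"
  proof -
    have "stabilizer G (snd (gset_sum X Y)) (Inl x) = stabilizer G (snd X) x" if "x \<in> fst X" for x
      using that by (auto simp: gset_sum_def stabilizer_def)
    moreover have "stabilizer G (snd (gset_sum X Y)) (Inr y) = stabilizer G (snd Y) y" if "y \<in> fst Y" for y
      using that by (auto simp: gset_sum_def stabilizer_def)
    ultimately show ?thesis
      unfolding fst_sum by auto
  qed
  then show ?thesis
    unfolding stab_count_def using assms by (simp add: card_Plus finite_gset_finite)
qed

lemma stab_count_pos:
  assumes "finite_gset G X" and "x \<in> fst X"
  shows "stab_count G X (stabilizer G (snd X) x) > 0"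
  unfolding stab_count_def card_gt_0_iff using assms finite_gset_finite[OF assms(1)] by auto

text \<open>The action is transported along an enumeration of \<open>X\<close>.\<close>

lemma ex_nat_gset:
  assumes X: "finite_gset G X"
  shows "\<exists>Y :: ('g, nat) gset. finite_gset G Y \<and> gset_iso G X Y"
proof -
  obtain h where h: "bij_betw h (fst X) {0..<card (fst X)}"
    using ex_bij_betw_finite_nat[OF finite_gset_finite[OF X]] by blast
  let ?k = "inv_into (fst X) h"
  let ?A = "{0..<card (fst X)}"
  let ?Y = "(?A, \<lambda>g. \<lambda>n\<in>?A. h (snd X g (?k n)))"
  have k: "?k n \<in> fst X" "h (?k n) = n" if "n \<in> ?A" for n
    using bij_betw_inv_into[OF h] bij_betw_inv_into_right[OF h that] that
    by (auto simp: bij_betw_def)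
  have hk: "h x \<in> ?A" "?k (h x) = x" if "x \<in> fst X" for x
    using h bij_betw_inv_into_left[OF h that] that by (auto simp: bij_betw_def)
  have "group_action G ?A (snd ?Y)"
    by (rule group_actionI)
      (auto simp: k hk gset_closed[OF X] gset_one[OF X] gset_mult[OF X] simp del: atLeastLessThan_iff)
  then have "finite_gset G ?Y"
    by (simp add: finite_gset_def)
  moreover have "gset_iso G X ?Y"
    unfolding gset_iso_def using h hk by (intro exI[of _ h]) auto
  ultimately show ?thesis
    by blast
qed

section \<open>Coset spaces\<close>

lemma lcos_eq_iff:
  assumes U: "subgroup U G" and "g \<in> carrier G" and "h \<in> carrier G"
  shows "g <# U = h <# U \<longleftrightarrow> inv g \<otimes> h \<in> U"
proof
  assume "g <# U = h <# U"
  then show "inv g \<otimes> h \<in> U"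
    using assms lcos_self[of h U] subgroup.lcos_module_imp[OF U is_group] by auto
next
  assume "inv g \<otimes> h \<in> U"
  then show "g <# U = h <# U"
    using assms subgroup.lcos_module_rev[OF U is_group] l_repr_independence by blast
qed

lemma lcosets_iff: "C \<in> lcosets U \<longleftrightarrow> (\<exists>g\<in>carrier G. C = g <# U)"
  by (auto simp: LCOSETS_def)

lemma finite_coset_gset:
  assumes U: "subgroup U G"
  shows "finite_gset G (coset_gset G U)"
proof -
  note sub = subgroup.subset[OF U]
  have "finite (lcosets U)"
    using finite_carrier by (simp add: LCOSETS_def)
  moreover have "group_action G (lcosets U) (snd (coset_gset G U))"
    unfolding coset_gset_def snd_conv
  proof (rule group_actionI)
    show closed: "(\<lambda>C\<in>lcosets U. g <# C) C \<in> lcosets U" if "g \<in> carrier G" "C \<in> lcosets U" for g C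
      using that by (auto simp: lcosets_iff lcos_m_assoc[OF sub])
    fix C
    assume C: "C \<in> lcosets U"
    then have sub_C: "C \<subseteq> carrier G"
      using subgroup.lcosets_carrier[OF U is_group] by blast
    then show "(\<lambda>C\<in>lcosets U. \<one> <# C) C = C"
      using C by (simp add: lcos_mult_one)
    show "(\<lambda>C\<in>lcosets U. (g \<otimes> h) <# C) C = (\<lambda>C\<in>lcosets U. g <# C) ((\<lambda>C\<in>lcosets U. h <# C) C)"
      if "g \<in> carrier G" "h \<in> carrier G" for g h
      using C closed[of h C] that sub_C by (simp add: lcos_m_assoc)
  qed auto
  ultimately show ?thesis
    by (simp add: finite_gset_def coset_gset_def)
qed

lemma mem_conj_set_iff:
  assumes "U \<subseteq> carrier G" and "g \<in> carrier G"
  shows "x \<in> conj_set G g U \<longleftrightarrow> x \<in> carrier G \<and> inv g \<otimes> x \<otimes> g \<in> U"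
proof
  assume "x \<in> conj_set G g U"
  then obtain u where "u \<in> U" "x = g \<otimes> u \<otimes> inv g"
    by (auto simp: conj_set_def l_coset_def r_coset_def)
  moreover then have "u \<in> carrier G"
    using assms by auto
  ultimately show "x \<in> carrier G \<and> inv g \<otimes> x \<otimes> g \<in> U"
    using assms by (simp add: m_assoc[symmetric]) (simp add: m_assoc)
next
  assume x: "x \<in> carrier G \<and> inv g \<otimes> x \<otimes> g \<in> U"
  have "x = g \<otimes> (inv g \<otimes> x \<otimes> g) \<otimes> inv g"
    using x assms by (simp add: m_assoc[symmetric]) (simp add: m_assoc)
  then show "x \<in> conj_set G g U"
    using x by (auto simp: conj_set_def l_coset_def r_coset_def)
qed

lemma conj_set_subset: "U \<subseteq> carrier G \<Longrightarrow> g \<in> carrier G \<Longrightarrow> conj_set G g U \<subseteq> carrier G"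
  using mem_conj_set_iff by blast

lemma conj_set_one: "U \<subseteq> carrier G \<Longrightarrow> conj_set G \<one> U = U"
  using mem_conj_set_iff[of U \<one>] by auto

lemma conj_set_mult:
  assumes "U \<subseteq> carrier G" and "g \<in> carrier G" and "h \<in> carrier G"
  shows "conj_set G (g \<otimes> h) U = conj_set G g (conj_set G h U)"
  using assms by (auto simp: mem_conj_set_iff conj_set_subset inv_mult_group m_assoc)

lemma conj_set_inv:
  assumes "U \<subseteq> carrier G" and "g \<in> carrier G"
  shows "conj_set G (inv g) (conj_set G g U) = U" "conj_set G g (conj_set G (inv g) U) = U"
  using assms by (simp_all add: conj_set_one flip: conj_set_mult)

lemma conj_set_mono: "U \<subseteq> V \<Longrightarrow> conj_set G g U \<subseteq> conj_set G g V"
  by (auto simp: conj_set_def l_coset_def r_coset_def)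

lemma conj_set_subgroup:
  assumes U: "subgroup U G" and g: "g \<in> carrier G"
  shows "subgroup (conj_set G g U) G"
proof (rule subgroupI)
  note sub = subgroup.subset[OF U] and mem = mem_conj_set_iff[OF subgroup.subset[OF U] g]
  show "conj_set G g U \<subseteq> carrier G"
    using conj_set_subset[OF sub g] .
  have "\<one> \<in> conj_set G g U"
    using g subgroup.one_closed[OF U] by (simp add: mem)
  then show "conj_set G g U \<noteq> {}"
    by blast
  fix x
  assume x: "x \<in> conj_set G g U"
  then have "inv (inv g \<otimes> x \<otimes> g) \<in> U"
    using subgroup.m_inv_closed[OF U] by (simp add: mem)
  then show "inv x \<in> conj_set G g U"
    using x g by (simp add: mem inv_mult_group m_assoc)
  fix y
  assume y: "y \<in> conj_set G g U"
  then have "(inv g \<otimes> x \<otimes> g) \<otimes> (inv g \<otimes> y \<otimes> g) \<in> U"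
    using x subgroup.m_closed[OF U] by (simp add: mem)
  moreover have "(inv g \<otimes> x \<otimes> g) \<otimes> (inv g \<otimes> y \<otimes> g) = inv g \<otimes> (x \<otimes> y) \<otimes> g"
  proof -
    have "g \<otimes> (inv g \<otimes> (y \<otimes> g)) = y \<otimes> g"
      using x y g by (simp add: mem flip: m_assoc)
    then show ?thesis
      using x y g by (simp add: mem m_assoc)
  qed
  ultimately show "x \<otimes> y \<in> conj_set G g U"
    using x y by (simp add: mem)
qed

lemma coset_stabilizer:
  assumes U: "subgroup U G" and g: "g \<in> carrier G"
  shows "stabilizer G (snd (coset_gset G U)) (g <# U) = conj_set G g U"
proof -
  note sub = subgroup.subset[OF U]
  have C: "g <# U \<in> lcosets U"
    using g by (auto simp: lcosets_iff)
  have "h <# (g <# U) = g <# U \<longleftrightarrow> inv g \<otimes> h \<otimes> g \<in> U" if h: "h \<in> carrier G" for h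
  proof -
    have "h <# (g <# U) = (h \<otimes> g) <# U"
      using lcos_m_assoc[OF sub h g] .
    then show ?thesis
      using lcos_eq_iff[OF U g, of "h \<otimes> g"] g h by (auto simp: m_assoc)
  qed
  with C have "h \<in> stabilizer G (snd (coset_gset G U)) (g <# U) \<longleftrightarrow> h \<in> conj_set G g U" for h
    by (cases "h \<in> carrier G") (simp_all add: stabilizer_def coset_gset_def mem_conj_set_iff[OF sub g])
  then show ?thesis
    by blast
qed

lemma normalizer_eq:
  assumes "U \<subseteq> carrier G"
  shows "normalizer G U = {g \<in> carrier G. conj_set G g U = U}"
  using assms by (auto simp: normalizer_def stabilizer_def conj_set_def)

lemma subgroup_normalizer_incl:
  assumes U: "subgroup U G"
  shows "subgroup U (G\<lparr>carrier := normalizer G U\<rparr>)"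
proof (rule subgroup_incl[OF U normalizer_imp_subgroup[OF subgroup.subset[OF U]]])
  show "U \<subseteq> normalizer G U"
  proof
    fix u
    assume u: "u \<in> U"
    then have uG: "u \<in> carrier G"
      using subgroup.subset[OF U] by blast
    have "\<one> <# U = u <# U"
      using lcos_eq_iff[OF U _ uG, of \<one>] u uG by simp
    then have "u <# U = U"
      using subgroup.subset[OF U] by (simp add: lcos_mult_one)
    then have "conj_set G u U = U"
      using coset_stabilizer[OF U uG] coset_stabilizer[OF U one_closed] subgroup.subset[OF U]
      by (simp add: lcos_mult_one conj_set_one)
    then show "u \<in> normalizer G U"
      using uG by (simp add: normalizer_eq[OF subgroup.subset[OF U]])
  qed
qed

lemma normalizer_index_mult_card:
  assumes U: "subgroup U G"
  shows "normalizer_index G U * card U = card (normalizer G U)"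
proof -
  interpret N: group "G\<lparr>carrier := normalizer G U\<rparr>"
    by (rule subgroup_imp_group[OF normalizer_imp_subgroup[OF subgroup.subset[OF U]]])
  show ?thesis
    using N.lagrange[OF subgroup_normalizer_incl[OF U]]
    by (simp add: normalizer_index_def order_def)
qed

lemma card_subgroup_pos:
  assumes "subgroup U G"
  shows "card U > 0"
  using assms finite_subset[OF subgroup.subset[OF assms] finite_carrier] subgroup.one_closed[OF assms]
  by (auto simp: card_gt_0_iff)

lemma normalizer_index_dvd_order:
  assumes U: "subgroup U G"
  shows "normalizer_index G U dvd order G"
proof -
  have "card (normalizer G U) dvd order G"
    using lagrange[OF normalizer_imp_subgroup[OF subgroup.subset[OF U]]] by (metis dvd_triv_right)
  then show ?thesis
    using normalizer_index_mult_card[OF U] by (metis dvd_trans dvd_triv_left)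
qed

lemma normalizer_index_pos:
  assumes U: "subgroup U G"
  shows "normalizer_index G U > 0"
proof -
  have "order G > 0"
    using finite_carrier by (auto simp: order_def card_gt_0_iff)
  then show ?thesis
    using normalizer_index_dvd_order[OF U] by (auto intro: dvd_pos_nat)
qed

text \<open>A coset \<open>gU\<close> has stabilizer \<open>gUg\<inverse>\<close>; the elements \<open>g\<close> for which this is a given conjugate
  of \<open>U\<close> form a coset of the normalizer, which is a union of \<open>normalizer_index G U\<close> cosets of \<open>U\<close>.\<close>

lemma stab_count_coset_gset:
  assumes U: "subgroup U G"
  shows "stab_count G (coset_gset G U) V = (if V \<in> conj_class G U then normalizer_index G U else 0)"
proof (cases "V \<in> conj_class G U")
  have fst_coset: "fst (coset_gset G U) = lcosets U"
    by (simp add: coset_gset_def)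
  case False
  then have "{C \<in> fst (coset_gset G U). stabilizer G (snd (coset_gset G U)) C = V} = {}"
    using coset_stabilizer[OF U] by (auto simp: fst_coset lcosets_iff conj_class_def)
  then show ?thesis
    using False unfolding stab_count_def by (simp only: card.empty if_False)
next
  case True
  then obtain h where h: "h \<in> carrier G" and V: "V = conj_set G h U"
    by (auto simp: conj_class_def)
  note sub = subgroup.subset[OF U]
  let ?C = "{C \<in> lcosets U. stabilizer G (snd (coset_gset G U)) C = V}"
  have "\<Union>?C = {g \<in> carrier G. conj_set G g U = V}"
  proof (intro equalityI subsetI)
    fix g
    assume "g \<in> \<Union>?C"
    then obtain C where "C \<in> lcosets U" "g \<in> C" and C: "stabilizer G (snd (coset_gset G U)) C = V"
      by blast
    then obtain k where k: "k \<in> carrier G" "g \<in> k <# U" "C = k <# U"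
      unfolding lcosets_iff by blast
    then have "conj_set G k U = V"
      using coset_stabilizer[OF U k(1)] C by simp
    from k have "g \<in> carrier G" "k <# U = g <# U"
      using l_coset_carrier[OF k(2,1) U] l_repr_independence[OF k(2,1) U] by blast+
    then show "g \<in> {g \<in> carrier G. conj_set G g U = V}"
      using \<open>conj_set G k U = V\<close> coset_stabilizer[OF U k(1)] coset_stabilizer[OF U, of g] by simp
  next
    fix g
    assume "g \<in> {g \<in> carrier G. conj_set G g U = V}"
    then have "g \<in> carrier G" "stabilizer G (snd (coset_gset G U)) (g <# U) = V"
      using coset_stabilizer[OF U, of g] by auto
    then show "g \<in> \<Union>?C"
      using lcos_self[OF _ U, of g] lcosets_iff by blast
  qed
  also have "\<dots> = (\<lambda>n. h \<otimes> n) ` normalizer G U"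
  proof (intro equalityI subsetI)
    fix g
    assume g: "g \<in> {g \<in> carrier G. conj_set G g U = V}"
    then have "conj_set G (inv h \<otimes> g) U = U"
      using h by (simp add: conj_set_mult[OF sub] V conj_set_inv[OF sub])
    moreover have "g = h \<otimes> (inv h \<otimes> g)"
      using g h by (simp flip: m_assoc)
    ultimately show "g \<in> (\<lambda>n. h \<otimes> n) ` normalizer G U"
      using g h by (auto simp: normalizer_eq[OF sub])
  qed (use h in \<open>auto simp: normalizer_eq[OF sub] conj_set_mult[OF sub] V\<close>)
  finally have union: "\<Union>?C = (\<lambda>n. h \<otimes> n) ` normalizer G U" .
  have "inj_on (\<lambda>n. h \<otimes> n) (normalizer G U)"
    using h by (auto simp: inj_on_def normalizer_eq[OF sub])
  then have "card (\<Union>?C) = card (normalizer G U)"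
    by (simp add: union card_image)
  moreover have "card U * card ?C = card (\<Union>?C)"
  proof (rule card_partition)
    show "finite ?C"
      using finite_carrier by (simp add: LCOSETS_def)
    show "finite (\<Union>?C)"
      using union finite_carrier by (simp add: normalizer_eq[OF sub])
    show "card C = card U" if "C \<in> ?C" for C
      using that l_card_cosets_equal[OF _ sub finite_carrier] by auto
    show "C \<inter> D = {}" if "C \<in> ?C" "D \<in> ?C" "C \<noteq> D" for C D
      using that lcos_disjoint[OF U] by auto
  qed
  ultimately have "card U * card ?C = card U * normalizer_index G U"
    using normalizer_index_mult_card[OF U] by (simp add: mult.commute)
  then show ?thesis
    using True card_subgroup_pos[OF U] by (simp add: stab_count_def coset_gset_def)
qed

lemma conj_class_self: "U \<subseteq> carrier G \<Longrightarrow> U \<in> conj_class G U"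
  unfolding conj_class_def by (intro CollectI exI[of _ \<one>]) (simp add: conj_set_one)

section \<open>Classification by stabilizers\<close>

text \<open>The orbit of \<open>x\<close> is the space of cosets of the stabilizer of \<open>x\<close>, and its complement is again
  invariant.\<close>

lemma gset_split_orbit:
  assumes X: "finite_gset G X" and x: "x \<in> fst X"
  defines "Y \<equiv> gset_restrict X (fst X - orbit G (snd X) x)"
  shows "finite_gset G Y" and "card (fst Y) < card (fst X)"
    and "gset_iso G X (gset_sum (coset_gset G (stabilizer G (snd X) x)) Y)"
proof -
  let ?O = "orbit G (snd X) x" and ?U = "stabilizer G (snd X) x"
  note U = stabilizer_subgroup[OF X x]
  have x_in_orbit: "x \<in> ?O"
    using group_action.orbit_refl[OF finite_gset_action[OF X] x] .
  show Y: "finite_gset G Y"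
    unfolding Y_def
  proof (rule finite_gset_restrict[OF X])
    fix g y
    assume g: "g \<in> carrier G" and y: "y \<in> fst X - ?O"
    have "y \<in> ?O" if "snd X g y = snd X h x" "h \<in> carrier G" for h
    proof -
      have "y = snd X (inv g) (snd X h x)"
        using that g y gset_inv_apply[OF X, of g y] by simp
      then show ?thesis
        using that g x gset_mult[OF X, of "inv g" h x] unfolding orbit_def
        by (intro CollectI exI[of _ "inv g \<otimes> h"]) simp
    qed
    then show "snd X g y \<in> fst X - ?O"
      using g y gset_closed[OF X] by (auto simp: orbit_def)
  qed blast
  have "fst Y \<subset> fst X"
    using x x_in_orbit by (auto simp: Y_def gset_restrict_def)
  then show "card (fst Y) < card (fst X)"
    by (rule psubset_card_mono[OF finite_gset_finite[OF X]])
  let ?S = "gset_sum (coset_gset G ?U) Y"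
  \<comment> \<open>All elements of a coset of the stabilizer move \<open>x\<close> to the same point, so any of them may be chosen.\<close>
  define f where "f = case_sum (\<lambda>C. snd X (SOME g. g \<in> C) x) (\<lambda>y. y)"
  have f_coset: "f (Inl (g <# ?U)) = snd X g x" if g: "g \<in> carrier G" for g
  proof -
    have "(SOME h. h \<in> g <# ?U) \<in> g <# ?U"
      using lcos_self[OF g U] by (rule someI)
    then obtain u where "u \<in> ?U" "(SOME h. h \<in> g <# ?U) = g \<otimes> u"
      by (auto simp: l_coset_def)
    then show ?thesis
      using g x gset_mult[OF X] by (auto simp: f_def stabilizer_def)
  qed
  have coset_eq: "g <# ?U = h <# ?U \<longleftrightarrow> snd X g x = snd X h x"
    if "g \<in> carrier G" "h \<in> carrier G" for g h
  proof -
    have "snd X g x = snd X h x \<longleftrightarrow> snd X (inv g) (snd X h x) = x"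
      using that gset_closed[OF X] gset_inv_apply[OF X, of g x] gset_apply_inv[OF X, of g] x by metis
    then show ?thesis
      using lcos_eq_iff[OF U that] that gset_mult[OF X _ _ x, of "inv g" h] by (simp add: stabilizer_def)
  qed
  have S: "fst ?S = lcosets ?U <+> (fst X - ?O)"
    by (simp add: gset_sum_def coset_gset_def Y_def gset_restrict_def)
  have "bij_betw f (fst ?S) (fst X)"
    unfolding bij_betw_def
  proof
    show "inj_on f (fst ?S)"
      unfolding S
    proof (rule inj_onI)
      fix a b
      assume ab: "a \<in> lcosets ?U <+> (fst X - ?O)" "b \<in> lcosets ?U <+> (fst X - ?O)" and eq: "f a = f b"
      have inl: "f (Inl C) \<in> ?O" if "C \<in> lcosets ?U" for C
        using that f_coset by (auto simp: lcosets_iff orbit_def)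
      have "C = D" if "f (Inl C) = f (Inl D)" "C \<in> lcosets ?U" "D \<in> lcosets ?U" for C D
      proof -
        from that(2,3) obtain g h
          where "g \<in> carrier G" "C = g <# ?U" "h \<in> carrier G" "D = h <# ?U"
          unfolding lcosets_iff by blast
        then show ?thesis
          using that(1) coset_eq[of g h] f_coset by simp
      qed
      moreover have "f (Inr y) = y" for y
        by (simp add: f_def)
      ultimately show "a = b"
        using ab eq inl by (cases a; cases b) auto
    qed
    have "?O \<subseteq> f ` fst ?S"
    proof
      fix y
      assume "y \<in> ?O"
      then obtain g where "g \<in> carrier G" "y = snd X g x"
        by (auto simp: orbit_def)
      then show "y \<in> f ` fst ?S"
        unfolding S using f_coset by (intro image_eqI[of _ _ "Inl (g <# ?U)"]) (auto simp: lcosets_iff)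
    qed
    moreover have "fst X - ?O \<subseteq> f ` fst ?S"
    proof
      fix y
      assume "y \<in> fst X - ?O"
      then show "y \<in> f ` fst ?S"
        unfolding S by (intro image_eqI[of _ _ "Inr y"]) (auto simp: f_def)
    qed
    moreover have "f z \<in> fst X" if "z \<in> fst ?S" for z
    proof (cases z)
      case (Inl C)
      with that have "C \<in> lcosets ?U"
        unfolding S by auto
      then obtain g where "g \<in> carrier G" "C = g <# ?U"
        unfolding lcosets_iff by blast
      then show ?thesis
        using Inl f_coset gset_closed[OF X _ x] by simp
    qed (use that in \<open>auto simp: S f_def\<close>)
    ultimately show "f ` fst ?S = fst X"
      by blast
  qed
  moreover have "f (snd ?S g z) = snd X g (f z)" if g: "g \<in> carrier G" and z: "z \<in> fst ?S" for g z
  proof (cases z)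
    case (Inl C)
    then obtain h where h: "h \<in> carrier G" "C = h <# ?U"
      using z unfolding S by (auto simp: lcosets_iff)
    have "C \<in> lcosets ?U"
      using h by (auto simp: lcosets_iff)
    then have "snd ?S g z = Inl ((g \<otimes> h) <# ?U)"
      using g h Inl lcos_m_assoc[OF subgroup.subset[OF U] g h(1)]
      by (auto simp: gset_sum_def coset_gset_def)
    then show ?thesis
      using Inl h g f_coset gset_mult[OF X g h(1) x] by simp
  next
    case (Inr y)
    then have "y \<in> fst Y"
      using z by (auto simp: gset_sum_def)
    then show ?thesis
      using Inr by (auto simp: gset_sum_def f_def Y_def gset_restrict_def)
  qed
  ultimately have "gset_iso G ?S X"
    by (auto simp: gset_iso_def)
  then show "gset_iso G X ?S"
    by (rule gset_iso_sym[OF finite_gset_sum[OF finite_coset_gset[OF U] Y]])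
qed

text \<open>Splitting off one orbit at a time lowers the number of points.\<close>

lemma finite_gset_induct [consumes 1, case_names empty orbit]:
  assumes "finite_gset G X"
    and empty: "\<And>X. finite_gset G X \<Longrightarrow> fst X = {} \<Longrightarrow> P X"
    and orbit: "\<And>X Y U. finite_gset G X \<Longrightarrow> finite_gset G Y \<Longrightarrow> subgroup U G \<Longrightarrow>
      gset_iso G X (gset_sum (coset_gset G U) Y) \<Longrightarrow> P Y \<Longrightarrow> P X"
  shows "P X"
  using assms(1)
proof (induction "card (fst X)" arbitrary: X rule: less_induct)
  case less
  show ?case
  proof (cases "fst X = {}")
    case False
    then obtain x where x: "x \<in> fst X"
      by blast
    note split = gset_split_orbit[OF less.prems x]
    show ?thesis
      by (rule orbit[OF less.prems split(1) stabilizer_subgroup[OF less.prems x] split(3) less.hyps[OF split(2,1)]])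
  qed (rule empty[OF less.prems])
qed

text \<open>A point with stabilizer \<open>U\<close> has an orbit isomorphic to \<open>G/U\<close>, so equal counts allow isomorphic
  orbits to be split off from both sides until nothing is left.\<close>

theorem gset_iso_iff_stab_count:
  assumes X: "finite_gset G X" and Y: "finite_gset G Y"
  shows "gset_iso G X Y \<longleftrightarrow> (\<forall>U. stab_count G X U = stab_count G Y U)"
proof
  show "\<forall>U. stab_count G X U = stab_count G Y U" if "gset_iso G X Y"
    using gset_iso_stab_count[OF X that] by blast
  show "gset_iso G X Y" if "\<forall>U. stab_count G X U = stab_count G Y U"
    using X Y that
  proof (induction X arbitrary: Y rule: finite_gset_induct)
    case (empty X)
    have "fst Y = {}"
    proof (rule equals0I)
      fix y
      assume "y \<in> fst Y"
      then have "stab_count G Y (stabilizer G (snd Y) y) > 0"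
        by (rule stab_count_pos[OF empty(3)])
      then show False
        using empty(4) stab_count_empty[OF empty(2)] by simp
    qed
    then show ?case
      using empty(2) by (auto simp: gset_iso_def bij_betw_def)
  next
    case (orbit X X' U)
    note coset = finite_coset_gset[OF orbit(3)]
    have count: "stab_count G X V = stab_count G (coset_gset G U) V + stab_count G X' V" for V
      using gset_iso_stab_count[OF orbit(1,4)] stab_count_sum[OF coset orbit(2)] by simp
    \<comment> \<open>The coset \<open>U\<close> is a point of \<open>G/U\<close> with stabilizer \<open>U\<close>, so \<open>X\<close> and hence \<open>Y\<close> have such a point.\<close>
    have "stab_count G Y U > 0"
      using count[of U] orbit(7) normalizer_index_pos[OF orbit(3)]
        conj_class_self[OF subgroup.subset[OF orbit(3)]]
      by (simp add: stab_count_coset_gset[OF orbit(3)])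
    then obtain y where y: "y \<in> fst Y" and stab_y: "stabilizer G (snd Y) y = U"
      unfolding stab_count_def card_gt_0_iff by blast
    define Y' where "Y' = gset_restrict Y (fst Y - orbit G (snd Y) y)"
    have Y': "finite_gset G Y'" and iso_Y: "gset_iso G Y (gset_sum (coset_gset G U) Y')"
      using gset_split_orbit[OF orbit(6) y] stab_y by (simp_all add: Y'_def)
    have "stab_count G X' V = stab_count G Y' V" for V
      using count[of V] orbit(7) gset_iso_stab_count[OF orbit(6) iso_Y] stab_count_sum[OF coset Y'] by simp
    then have "gset_iso G X' Y'"
      using orbit(5) Y' by blast
    then have "gset_iso G (gset_sum (coset_gset G U) X') (gset_sum (coset_gset G U) Y')"
      by (intro gset_iso_sum_cong gset_iso_refl)
    then show ?case
      using gset_iso_trans[OF orbit(4)] gset_iso_trans gset_iso_sym[OF orbit(6) iso_Y] by blast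
  qed
qed

end

section \<open>The Burnside group\<close>

context finite_group
begin

lemma stab_count_gset_empty: "stab_count G gset_empty U = 0"
  by (simp add: stab_count_empty gset_empty_def)

text \<open>By the classification, cancelling an auxiliary \<open>G\<close>-set \<open>Z\<close> is cancelling its stabilizer
  counts, so a formal difference is determined by a difference of counts.\<close>

lemma burnside_diff_eq:
  assumes X: "finite_gset G X" and Y: "finite_gset G Y"
  shows "burnside_diff G X Y = {(X', Y'). finite_gset G X' \<and> finite_gset G Y' \<and>
    (\<forall>U. int (stab_count G X U) - int (stab_count G Y U) =
         int (stab_count G X' U) - int (stab_count G Y' U))}"
proof -
  have "(\<exists>Z :: ('g, nat) gset. finite_gset G Z \<and>
      gset_iso G (gset_sum (gset_sum X Y') Z) (gset_sum (gset_sum X' Y) Z)) \<longleftrightarrow>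
    (\<forall>U. int (stab_count G X U) - int (stab_count G Y U) =
         int (stab_count G X' U) - int (stab_count G Y' U))" (is "?iso \<longleftrightarrow> ?count")
    if X': "finite_gset G X'" and Y': "finite_gset G Y'" for X' Y' :: "('g, nat) gset"
  proof -
    have iso_iff: "gset_iso G (gset_sum (gset_sum X Y') Z) (gset_sum (gset_sum X' Y) Z) \<longleftrightarrow> ?count"
      if "finite_gset G Z" for Z :: "('g, nat) gset"
    proof -
      have "stab_count G X U + stab_count G Y' U + stab_count G Z U =
          stab_count G X' U + stab_count G Y U + stab_count G Z U \<longleftrightarrow>
        int (stab_count G X U) - int (stab_count G Y U) =
          int (stab_count G X' U) - int (stab_count G Y' U)" for U
        by linarith
      then show ?thesis
        using X Y X' Y' that
        by (simp add: gset_iso_iff_stab_count finite_gset_sum stab_count_sum)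
    qed
    then show ?thesis
      using finite_gset_empty by blast
  qed
  then show ?thesis
    unfolding burnside_diff_def by blast
qed

text \<open>The operations of the Burnside group are unions over all representatives of their arguments.
  These unions are taken of one and the same set, so a single representative determines them.\<close>

lemma nat_representatives:
  assumes X: "finite_gset G X" and Y: "finite_gset G Y"
  obtains X' Y' :: "('g, nat) gset" where "finite_gset G X'" and "finite_gset G Y'"
    and "\<And>U. stab_count G X' U = stab_count G X U" and "\<And>U. stab_count G Y' U = stab_count G Y U"
    and "(X', Y') \<in> burnside_diff G X Y"
proof -
  obtain X' :: "('g, nat) gset" where X': "finite_gset G X'" "gset_iso G X X'"
    using ex_nat_gset[OF X] by blast
  obtain Y' :: "('g, nat) gset" where Y': "finite_gset G Y'" "gset_iso G Y Y'"
    using ex_nat_gset[OF Y] by blast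
  note count = gset_iso_stab_count[OF X X'(2)] gset_iso_stab_count[OF Y Y'(2)]
  then have "(X', Y') \<in> burnside_diff G X Y"
    using X' Y' by (simp add: burnside_diff_eq[OF X Y])
  then show ?thesis
    using that X' Y' count by simp
qed

lemma burnside_diff_eq_iff:
  assumes X: "finite_gset G X" and Y: "finite_gset G Y"
    and X': "finite_gset G X'" and Y': "finite_gset G Y'"
  shows "burnside_diff G X Y = burnside_diff G X' Y' \<longleftrightarrow>
    (\<forall>U. int (stab_count G X U) - int (stab_count G Y U) =
         int (stab_count G X' U) - int (stab_count G Y' U))"
proof
  assume eq: "burnside_diff G X Y = burnside_diff G X' Y'"
  obtain A B where "\<And>U. stab_count G A U = stab_count G X U" "\<And>U. stab_count G B U = stab_count G Y U"
    and "(A, B) \<in> burnside_diff G X Y"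
    using nat_representatives[OF X Y] by metis
  then show "\<forall>U. int (stab_count G X U) - int (stab_count G Y U) =
         int (stab_count G X' U) - int (stab_count G Y' U)"
    unfolding eq burnside_diff_eq[OF X' Y'] by simp
qed (simp add: burnside_diff_eq assms)

lemma burnside_diff_closed:
  assumes X: "finite_gset G X" and Y: "finite_gset G Y"
  shows "burnside_diff G X Y \<in> carrier (burnside_ring G)"
proof -
  obtain A B :: "('g, nat) gset" where "finite_gset G A" "finite_gset G B"
    "\<And>U. stab_count G A U = stab_count G X U" "\<And>U. stab_count G B U = stab_count G Y U"
    using nat_representatives[OF X Y] by metis
  moreover from this have "burnside_diff G X Y = burnside_diff G A B"
    by (simp add: burnside_diff_eq_iff X Y)
  ultimately show ?thesis
    unfolding burnside_ring_def partial_object.simps by blast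
qed

lemma burnside_class_closed: "finite_gset G X \<Longrightarrow> burnside_class G X \<in> carrier (burnside_ring G)"
  by (simp add: burnside_class_def burnside_diff_closed finite_gset_empty)

lemma burnside_cases:
  assumes "b \<in> carrier (burnside_ring G)"
  obtains X Y :: "('g, nat) gset" where "finite_gset G X" and "finite_gset G Y"
    and "b = burnside_diff G X Y"
  using assms by (auto simp: burnside_ring_def)

lemma burnside_add:
  assumes X: "finite_gset G X" and Y: "finite_gset G Y"
    and X': "finite_gset G X'" and Y': "finite_gset G Y'"
  shows "burnside_diff G X Y \<oplus>\<^bsub>burnside_ring G\<^esub> burnside_diff G X' Y' =
    burnside_diff G (gset_sum X X') (gset_sum Y Y')"
proof -
  let ?D = "burnside_diff G (gset_sum X X') (gset_sum Y Y')"
  have sum_eq: "burnside_diff G (gset_sum A A') (gset_sum B B') = ?D"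
    if "(A, B) \<in> burnside_diff G X Y" "(A', B') \<in> burnside_diff G X' Y'" for A B A' B'
  proof -
    have fin: "finite_gset G A" "finite_gset G B" "finite_gset G A'" "finite_gset G B'"
      using that unfolding burnside_diff_eq[OF X Y] burnside_diff_eq[OF X' Y'] by auto
    have "int (stab_count G X U) - int (stab_count G Y U) = int (stab_count G A U) - int (stab_count G B U)"
      "int (stab_count G X' U) - int (stab_count G Y' U) = int (stab_count G A' U) - int (stab_count G B' U)" for U
      using that unfolding burnside_diff_eq[OF X Y] burnside_diff_eq[OF X' Y'] by auto
    then have "int (stab_count G A U) + int (stab_count G A' U) - (int (stab_count G B U) + int (stab_count G B' U)) =
      int (stab_count G X U) + int (stab_count G X' U) - (int (stab_count G Y U) + int (stab_count G Y' U))" for U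
      by (smt (verit))
    then show ?thesis
      using X Y X' Y' fin by (simp add: burnside_diff_eq_iff finite_gset_sum stab_count_sum)
  qed
  obtain A B where AB: "(A, B) \<in> burnside_diff G X Y"
    using nat_representatives[OF X Y] by metis
  obtain A' B' where AB': "(A', B') \<in> burnside_diff G X' Y'"
    using nat_representatives[OF X' Y'] by metis
  have "burnside_diff G X Y \<oplus>\<^bsub>burnside_ring G\<^esub> burnside_diff G X' Y' =
    (\<Union>(A, B)\<in>burnside_diff G X Y. \<Union>(A', B')\<in>burnside_diff G X' Y'.
      burnside_diff G (gset_sum A A') (gset_sum B B'))"
    by (simp add: burnside_ring_def)
  also have "\<dots> = (\<Union>(A, B)\<in>burnside_diff G X Y. \<Union>(A', B')\<in>burnside_diff G X' Y'. ?D)"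
    using sum_eq by (intro SUP_cong refl) (auto split: prod.splits)
  also have "\<dots> = ?D"
    using AB AB' by auto
  finally show ?thesis .
qed

lemma burnside_add_closed:
  assumes "b \<in> carrier (burnside_ring G)" and "c \<in> carrier (burnside_ring G)"
  shows "b \<oplus>\<^bsub>burnside_ring G\<^esub> c \<in> carrier (burnside_ring G)"
proof -
  obtain X Y :: "('g, nat) gset" where X: "finite_gset G X" "finite_gset G Y" "b = burnside_diff G X Y"
    using assms(1) by (rule burnside_cases)
  obtain X' Y' :: "('g, nat) gset" where X': "finite_gset G X'" "finite_gset G Y'" "c = burnside_diff G X' Y'"
    using assms(2) by (rule burnside_cases)
  show ?thesis
    using X X' by (simp add: burnside_add burnside_diff_closed finite_gset_sum)
qed

lemma burnside_diff_add_class: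
  assumes "finite_gset G X" and "finite_gset G Y"
  shows "burnside_diff G X Y \<oplus>\<^bsub>burnside_ring G\<^esub> burnside_class G Y = burnside_class G X"
  unfolding burnside_class_def using assms
  by (simp add: burnside_add burnside_diff_eq_iff finite_gset_sum finite_gset_empty stab_count_sum)

lemma burnside_class_add:
  assumes "finite_gset G X" and "finite_gset G Y" and "finite_gset G Z"
    and "gset_iso G Z (gset_sum X Y)"
  shows "burnside_class G X \<oplus>\<^bsub>burnside_ring G\<^esub> burnside_class G Y = burnside_class G Z"
  unfolding burnside_class_def using assms gset_iso_stab_count[OF assms(3,4)]
  by (simp add: burnside_add burnside_diff_eq_iff finite_gset_sum finite_gset_empty stab_count_sum
      stab_count_gset_empty)

text \<open>The form in which the vanishing of the class of an empty \<open>G\<close>-set carries over to tensors: an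
  additive map to a group sends idempotents to zero.\<close>

lemma burnside_class_idempotent_empty:
  assumes X: "finite_gset G X" and "fst X = {}"
  shows "burnside_class G X \<oplus>\<^bsub>burnside_ring G\<^esub> burnside_class G X = burnside_class G X"
  unfolding burnside_class_def using assms
  by (simp add: burnside_add burnside_diff_eq_iff finite_gset_sum finite_gset_empty stab_count_sum stab_count_empty
      stab_count_gset_empty)

text \<open>The value of \<^const>\<open>burnside_lift\<close> is well defined as soon as \<open>f X' - f Y'\<close> depends only on the
  differences of stabilizer counts.\<close>

lemma burnside_lift_diff:
  fixes f :: "('g, nat) gset \<Rightarrow> 'a"
  assumes X: "finite_gset G X" and Y: "finite_gset G Y"
    and f: "\<And>X' Y'. finite_gset G X' \<Longrightarrow> finite_gset G Y' \<Longrightarrow>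
      (\<And>U. int (stab_count G X' U) - int (stab_count G Y' U) =
        int (stab_count G X U) - int (stab_count G Y U)) \<Longrightarrow> f X' \<ominus>\<^bsub>M\<^esub> f Y' = v"
  shows "burnside_lift M f (burnside_diff G X Y) = v"
proof -
  have "(case A of (X', Y') \<Rightarrow> f X' \<ominus>\<^bsub>M\<^esub> f Y') = v" if "A \<in> burnside_diff G X Y" for A
    using that f unfolding burnside_diff_eq[OF X Y] by auto
  moreover obtain A where "A \<in> burnside_diff G X Y"
    using nat_representatives[OF X Y] by metis
  ultimately have "(\<lambda>(X', Y'). f X' \<ominus>\<^bsub>M\<^esub> f Y') ` burnside_diff G X Y = {v}"
    by blast
  then show ?thesis
    by (simp add: burnside_lift_def)
qed

section \<open>The maps \<open>\<alpha>\<close> and \<open>\<rho>\<close> over the integers\<close>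

lemma finite_subgroups_of: "finite (subgroups_of G)"
proof (rule finite_subset)
  show "subgroups_of G \<subseteq> Pow (carrier G)"
    using subgroup.subset by (auto simp: subgroups_of_def)
qed (simp add: finite_carrier)

lemma alpha_gset_closed: "alpha_gset G X \<in> carrier (sg_module \<Z> G)"
  unfolding alpha_gset_def sg_module_def sg_basis_def
  by (intro abelian_monoid.finsum_closed abelian_group.axioms(1) cring.abelian_group_free_module int_is_cring)
    (auto simp del: free_module_carrier intro!: cring.basis_vec_closed int_is_cring)

lemma alpha_gset_apply:
  assumes X: "finite_gset G X" and U: "U \<in> subgroups_of G"
  shows "alpha_gset G X U = int (stab_count G X U)"
proof -
  have "alpha_gset G X U =
    (\<Oplus>\<^bsub>\<Z>\<^esub>x\<in>fst X. basis_vec \<Z> (subgroups_of G) (stabilizer G (snd X) x) U)"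
    unfolding alpha_gset_def sg_module_def sg_basis_def
    by (intro cring.free_module_finsum_apply int_is_cring U finite_gset_finite[OF X])
      (auto simp del: free_module_carrier intro!: cring.basis_vec_closed int_is_cring)
  also have "\<dots> = (\<Sum>x\<in>fst X. if stabilizer G (snd X) x = U then 1 else 0)"
    unfolding int_finsum_eq using U by (intro sum.cong) (auto simp: cring.basis_vec_apply[OF int_is_cring])
  also have "\<dots> = int (stab_count G X U)"
    using finite_gset_finite[OF X] by (simp add: stab_count_def sum.If_cases Int_def)
  finally show ?thesis .
qed

lemma alpha_int_diff:
  assumes X: "finite_gset G X" and Y: "finite_gset G Y"
  shows "alpha_int G (burnside_diff G X Y) =
    (\<lambda>U\<in>subgroups_of G. int (stab_count G X U) - int (stab_count G Y U))"
  unfolding alpha_int_def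
proof (rule burnside_lift_diff[OF X Y])
  fix A B :: "('g, nat) gset"
  assume A: "finite_gset G A" and B: "finite_gset G B"
    and count: "\<And>U. int (stab_count G A U) - int (stab_count G B U) =
      int (stab_count G X U) - int (stab_count G Y U)"
  let ?M = "free_module \<Z> (subgroups_of G)"
  interpret M: abelian_group ?M
    by (rule cring.abelian_group_free_module[OF int_is_cring])
  have closed: "alpha_gset G A \<in> carrier ?M" "alpha_gset G B \<in> carrier ?M"
    using alpha_gset_closed by (simp_all only: sg_module_def)
  show "alpha_gset G A \<ominus>\<^bsub>sg_module \<Z> G\<^esub> alpha_gset G B =
    (\<lambda>U\<in>subgroups_of G. int (stab_count G X U) - int (stab_count G Y U))"
    unfolding sg_module_def
  proof (rule cring.free_module_eqI[OF int_is_cring])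
    show "alpha_gset G A \<ominus>\<^bsub>?M\<^esub> alpha_gset G B \<in> carrier ?M"
      using closed by (rule M.minus_closed)
    fix U
    assume U: "U \<in> subgroups_of G"
    then show "(alpha_gset G A \<ominus>\<^bsub>?M\<^esub> alpha_gset G B) U =
      (\<lambda>U\<in>subgroups_of G. int (stab_count G X U) - int (stab_count G Y U)) U"
      using cring.free_module_minus_apply[OF int_is_cring closed U] count[of U] A B
      by (simp add: alpha_gset_apply int_a_minus_eq)
  qed auto
qed

text \<open>The fixed points of \<open>U\<close> are the points whose stabilizer contains \<open>U\<close>.\<close>

lemma card_gset_fixed:
  assumes X: "finite_gset G X" and U: "U \<in> subgroups_of G"
  shows "card (gset_fixed X U) = (\<Sum>V\<in>subgroups_of G. if U \<subseteq> V then stab_count G X V else 0)"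
proof -
  have "U \<subseteq> carrier G"
    using U subgroup.subset by (auto simp: subgroups_of_def)
  then have "gset_fixed X U =
    (\<Union>V\<in>{V \<in> subgroups_of G. U \<subseteq> V}. {x \<in> fst X. stabilizer G (snd X) x = V})"
    using stabilizer_subgroup[OF X] by (auto simp: gset_fixed_def stabilizer_def subgroups_of_def)
  then have "card (gset_fixed X U) = (\<Sum>V\<in>{V \<in> subgroups_of G. U \<subseteq> V}. stab_count G X V)"
    unfolding stab_count_def using finite_subgroups_of finite_gset_finite[OF X]
    by (simp add: card_UN_disjoint disjoint_iff)
  also have "\<dots> = (\<Sum>V\<in>subgroups_of G. if U \<subseteq> V then stab_count G X V else 0)"
    by (rule sum.inter_filter[OF finite_subgroups_of])
  finally show ?thesis .
qed

lemma rho_gset_summand_closed: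
  "int n \<odot>\<^bsub>free_module \<Z> (subgroups_of G)\<^esub> basis_vec \<Z> (subgroups_of G) U
    \<in> carrier (free_module \<Z> (subgroups_of G))"
  by (rule module.smult_closed[OF cring.module_free_module[OF int_is_cring]])
    (auto simp del: free_module_carrier intro!: cring.basis_vec_closed int_is_cring)

lemma rho_gset_closed: "rho_gset G X \<in> carrier (sg_module \<Z> G)"
  unfolding rho_gset_def sg_module_def sg_basis_def
  by (intro abelian_monoid.finsum_closed abelian_group.axioms(1) cring.abelian_group_free_module int_is_cring
      funcsetI rho_gset_summand_closed)

lemma rho_gset_apply:
  assumes X: "finite_gset G X" and U: "U \<in> subgroups_of G"
  shows "rho_gset G X U = int (card (gset_fixed X U))"
proof -
  have "rho_gset G X U =
    (\<Oplus>\<^bsub>\<Z>\<^esub>V\<in>subgroups_of G. (int (card (gset_fixed X V)) \<odot>\<^bsub>free_module \<Z> (subgroups_of G)\<^esub>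
      basis_vec \<Z> (subgroups_of G) V) U)"
    unfolding rho_gset_def sg_module_def sg_basis_def
    by (intro cring.free_module_finsum_apply int_is_cring U finite_subgroups_of funcsetI
        rho_gset_summand_closed)
  also have "\<dots> = (\<Sum>V\<in>subgroups_of G. if V = U then int (card (gset_fixed X U)) else 0)"
    unfolding int_finsum_eq using U by (intro sum.cong) (auto simp: cring.basis_vec_apply[OF int_is_cring])
  finally show ?thesis
    using U finite_subgroups_of by simp
qed

lemma rho_int_diff:
  assumes X: "finite_gset G X" and Y: "finite_gset G Y"
  shows "rho_int G (burnside_diff G X Y) = (\<lambda>U\<in>subgroups_of G. \<Sum>V\<in>subgroups_of G.
    if U \<subseteq> V then int (stab_count G X V) - int (stab_count G Y V) else 0)"
  unfolding rho_int_def
proof (rule burnside_lift_diff[OF X Y])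
  fix A B :: "('g, nat) gset"
  assume A: "finite_gset G A" and B: "finite_gset G B"
    and count: "\<And>U. int (stab_count G A U) - int (stab_count G B U) =
      int (stab_count G X U) - int (stab_count G Y U)"
  let ?M = "free_module \<Z> (subgroups_of G)"
  interpret M: abelian_group ?M
    by (rule cring.abelian_group_free_module[OF int_is_cring])
  have closed: "rho_gset G A \<in> carrier ?M" "rho_gset G B \<in> carrier ?M"
    using rho_gset_closed by (simp_all only: sg_module_def)
  show "rho_gset G A \<ominus>\<^bsub>sg_module \<Z> G\<^esub> rho_gset G B = (\<lambda>U\<in>subgroups_of G. \<Sum>V\<in>subgroups_of G.
    if U \<subseteq> V then int (stab_count G X V) - int (stab_count G Y V) else 0)"
    unfolding sg_module_def
  proof (rule cring.free_module_eqI[OF int_is_cring])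
    show "rho_gset G A \<ominus>\<^bsub>?M\<^esub> rho_gset G B \<in> carrier ?M"
      using closed by (rule M.minus_closed)
    fix U
    assume U: "U \<in> subgroups_of G"
    then have "(rho_gset G A \<ominus>\<^bsub>?M\<^esub> rho_gset G B) U =
      int (card (gset_fixed A U)) - int (card (gset_fixed B U))"
      using cring.free_module_minus_apply[OF int_is_cring closed U] A B
      by (simp add: rho_gset_apply int_a_minus_eq)
    also have "\<dots> = (\<Sum>V\<in>subgroups_of G. if U \<subseteq> V then int (stab_count G X V) - int (stab_count G Y V) else 0)"
      unfolding card_gset_fixed[OF A U] card_gset_fixed[OF B U] of_nat_sum sum_subtractf[symmetric]
      by (intro sum.cong refl) (simp add: count)
    finally show "(rho_gset G A \<ominus>\<^bsub>?M\<^esub> rho_gset G B) U = (\<lambda>U\<in>subgroups_of G. \<Sum>V\<in>subgroups_of G.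
      if U \<subseteq> V then int (stab_count G X V) - int (stab_count G Y V) else 0) U"
      using U by simp
  qed auto
qed

text \<open>This is \<open>\<rho> = \<zeta> \<circ> \<alpha>\<close> over the integers, read off at the coefficient of \<open>U\<close>.\<close>

lemma rho_int_eq_sum_alpha_int:
  assumes "b \<in> carrier (burnside_ring G)" and "U \<in> subgroups_of G"
  shows "rho_int G b U = (\<Sum>V\<in>subgroups_of G. if U \<subseteq> V then alpha_int G b V else 0)"
  using assms(1)
proof (rule burnside_cases)
  fix X Y :: "('g, nat) gset"
  assume "finite_gset G X" "finite_gset G Y" "b = burnside_diff G X Y"
  then show ?thesis
    using assms(2) by (auto simp: rho_int_diff alpha_int_diff intro!: sum.cong)
qed

lemma alpha_int_closed:
  assumes "b \<in> carrier (burnside_ring G)"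
  shows "alpha_int G b \<in> carrier (sg_module \<Z> G)"
  using assms by (rule burnside_cases) (auto simp: alpha_int_diff sg_module_def)

lemma rho_int_closed:
  assumes "b \<in> carrier (burnside_ring G)"
  shows "rho_int G b \<in> carrier (sg_module \<Z> G)"
  using assms by (rule burnside_cases) (auto simp: rho_int_diff sg_module_def)

lemma alpha_int_add:
  assumes "b \<in> carrier (burnside_ring G)" and "c \<in> carrier (burnside_ring G)" and "U \<in> subgroups_of G"
  shows "alpha_int G (b \<oplus>\<^bsub>burnside_ring G\<^esub> c) U = alpha_int G b U + alpha_int G c U"
proof -
  obtain X Y :: "('g, nat) gset" where X: "finite_gset G X" "finite_gset G Y" "b = burnside_diff G X Y"
    using assms(1) by (rule burnside_cases)
  obtain X' Y' :: "('g, nat) gset" where X': "finite_gset G X'" "finite_gset G Y'" "c = burnside_diff G X' Y'"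
    using assms(2) by (rule burnside_cases)
  show ?thesis
    using X X' assms(3) by (simp add: burnside_add alpha_int_diff finite_gset_sum stab_count_sum)
qed

lemma rho_int_add:
  assumes "b \<in> carrier (burnside_ring G)" and "c \<in> carrier (burnside_ring G)" and "U \<in> subgroups_of G"
  shows "rho_int G (b \<oplus>\<^bsub>burnside_ring G\<^esub> c) U = rho_int G b U + rho_int G c U"
  unfolding rho_int_eq_sum_alpha_int[OF assms(1,3)] rho_int_eq_sum_alpha_int[OF assms(2,3)]
    rho_int_eq_sum_alpha_int[OF burnside_add_closed[OF assms(1,2)] assms(3)] sum.distrib[symmetric]
  by (intro sum.cong refl) (simp add: alpha_int_add assms(1,2))

lemma alpha_int_coset_class:
  assumes U: "subgroup U G" and V: "V \<in> subgroups_of G"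
  shows "alpha_int G (burnside_class G (coset_gset G U)) V =
    (if V \<in> conj_class G U then int (normalizer_index G U) else 0)"
  unfolding burnside_class_def
  using V by (simp add: alpha_int_diff finite_coset_gset[OF U] finite_gset_empty stab_count_coset_gset[OF U]
      stab_count_gset_empty)

end

section \<open>Conjugacy of subgroups\<close>

context finite_group
begin

lemma subgroups_of_subset: "U \<in> subgroups_of G \<Longrightarrow> U \<subseteq> carrier G"
  by (simp add: subgroups_of_def subgroup.subset)

lemma conj_set_closed: "U \<in> subgroups_of G \<Longrightarrow> g \<in> carrier G \<Longrightarrow> conj_set G g U \<in> subgroups_of G"
  by (simp add: subgroups_of_def conj_set_subgroup)

lemma conj_set_bij:
  assumes "g \<in> carrier G"
  shows "bij_betw (conj_set G g) (subgroups_of G) (subgroups_of G)"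
  using assms
  by (intro bij_betw_byWitness[where f' = "conj_set G (inv g)"])
    (auto simp: conj_set_closed conj_set_inv subgroups_of_subset)

lemma conj_set_subset_iff:
  assumes "U \<in> subgroups_of G" and "V \<in> subgroups_of G" and "g \<in> carrier G"
  shows "conj_set G g U \<subseteq> conj_set G g V \<longleftrightarrow> U \<subseteq> V"
  using assms conj_set_mono[of "conj_set G g U" "conj_set G g V" "inv g"] conj_set_mono[of U V g]
  by (auto simp: conj_set_inv subgroups_of_subset)

lemma conj_class_subset: "U \<in> subgroups_of G \<Longrightarrow> conj_class G U \<subseteq> subgroups_of G"
  by (auto simp: conj_class_def conj_set_closed)

lemma conj_class_eq:
  assumes U: "U \<in> subgroups_of G" and V: "V \<in> conj_class G U"
  shows "conj_class G V = conj_class G U"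
proof -
  have sub: "conj_class G V \<subseteq> conj_class G U" if "V \<in> conj_class G U" "U \<in> subgroups_of G" for U V
    using that by (auto simp: conj_class_def subgroups_of_subset simp flip: conj_set_mult)
  obtain g where g: "g \<in> carrier G" "V = conj_set G g U"
    using V by (auto simp: conj_class_def)
  then have "U = conj_set G (inv g) V"
    using U by (simp add: conj_set_inv subgroups_of_subset)
  then have "U \<in> conj_class G V"
    using g by (auto simp: conj_class_def)
  moreover have "V \<in> subgroups_of G"
    using U V conj_class_subset by blast
  ultimately show ?thesis
    using sub U V by blast
qed

lemma conj_class_conj_set:
  assumes "U \<in> subgroups_of G" and "g \<in> carrier G"
  shows "conj_class G (conj_set G g U) = conj_class G U"
  using assms by (intro conj_class_eq) (auto simp: conj_class_def)

lemma mem_conj_class_iff: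
  assumes "U \<in> subgroups_of G" and "V \<in> subgroups_of G"
  shows "V \<in> conj_class G U \<longleftrightarrow> conj_class G V = conj_class G U"
  using assms conj_class_eq conj_class_self[OF subgroups_of_subset] by metis

lemma ex_conj_transversal: "\<exists>T. conj_transversal G T"
proof -
  define rep where "rep U = (SOME V. V \<in> conj_class G U)" for U
  have rep: "rep U \<in> conj_class G U" if "U \<in> subgroups_of G" for U
    unfolding rep_def using conj_class_self[OF subgroups_of_subset[OF that]] by (rule someI)
  have rep_cong: "rep U = rep V" if "conj_class G U = conj_class G V" for U V
    by (simp add: rep_def that)
  have "conj_transversal G (rep ` subgroups_of G)"
    unfolding conj_transversal_def
  proof (intro conjI ballI)
    show "rep ` subgroups_of G \<subseteq> subgroups_of G"
      using rep conj_class_subset by blast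
    fix U
    assume U: "U \<in> subgroups_of G"
    show "\<exists>!V. V \<in> rep ` subgroups_of G \<and> V \<in> conj_class G U"
    proof (rule ex1I[of _ "rep U"])
      show "rep U \<in> rep ` subgroups_of G \<and> rep U \<in> conj_class G U"
        using U rep by blast
      fix V
      assume V: "V \<in> rep ` subgroups_of G \<and> V \<in> conj_class G U"
      then obtain W where W: "W \<in> subgroups_of G" "V = rep W"
        by blast
      then have "conj_class G W = conj_class G U"
        using V conj_class_eq[OF W(1) rep[OF W(1)]] conj_class_eq[OF U, of V] by simp
      then show "V = rep U"
        using W rep_cong[of W U] by simp
    qed
  qed
  then show ?thesis
    by blast
qed

lemma conj_transversal_finite: "conj_transversal G T \<Longrightarrow> finite T"
  using finite_subgroups_of finite_subset unfolding conj_transversal_def by blast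

lemma conj_transversal_subgroup: "conj_transversal G T \<Longrightarrow> U \<in> T \<Longrightarrow> U \<in> subgroups_of G"
  unfolding conj_transversal_def by blast

text \<open>Distinct members of a transversal are not conjugate, so restriction to \<open>T\<close> turns class sums
  into unit vectors.\<close>

lemma conj_transversal_unique:
  assumes "conj_transversal G T" and "U \<in> T" and "V \<in> T"
  shows "V \<in> conj_class G U \<longleftrightarrow> V = U"
proof
  have U: "U \<in> subgroups_of G"
    using assms by (auto intro: conj_transversal_subgroup)
  then have self: "U \<in> conj_class G U"
    by (intro conj_class_self subgroups_of_subset)
  then show "V \<in> conj_class G U" if "V = U"
    using that by simp
  show "V = U" if "V \<in> conj_class G U"
    using assms that self U unfolding conj_transversal_def by blast
qed

lemma conj_transversal_rep:
  assumes "conj_transversal G T" and "U \<in> subgroups_of G"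
  obtains V g where "V \<in> T" and "g \<in> carrier G" and "U = conj_set G g V"
    and "conj_class G V = conj_class G U"
proof -
  obtain V where V: "V \<in> T" "V \<in> conj_class G U"
    using assms unfolding conj_transversal_def by blast
  then have class_eq: "conj_class G V = conj_class G U"
    using conj_class_eq[OF assms(2)] by blast
  then have "U \<in> conj_class G V"
    using conj_class_self[OF subgroups_of_subset[OF assms(2)]] by simp
  then show ?thesis
    using that V class_eq by (auto simp: conj_class_def)
qed

text \<open>Both indices are quotients of orders, and conjugation by \<open>h\<close> maps \<open>U\<close> and its normalizer onto
  \<open>hUh\<inverse>\<close> and its normalizer.\<close>

lemma normalizer_index_conj_set:
  assumes U: "U \<in> subgroups_of G" and h: "h \<in> carrier G"
  shows "normalizer_index G (conj_set G h U) = normalizer_index G U"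
proof -
  note sub = subgroups_of_subset[OF U]
  have sub_U: "subgroup U G"
    using U by (simp add: subgroups_of_def)
  have card_conj: "card (conj_set G h S) = card S" if S: "S \<subseteq> carrier G" for S
  proof -
    have "conj_set G h S = (\<lambda>x. h \<otimes> x \<otimes> inv h) ` S"
      by (auto simp: conj_set_def l_coset_def r_coset_def)
    moreover have "inj_on (\<lambda>x. h \<otimes> x \<otimes> inv h) S"
      using S h by (auto intro!: inj_onI simp: subset_iff)
    ultimately show ?thesis
      by (simp add: card_image)
  qed
  have norm_sub: "normalizer G U \<subseteq> carrier G"
    by (auto simp: normalizer_eq[OF sub])
  have "normalizer G (conj_set G h U) = conj_set G h (normalizer G U)"
  proof (rule Set.set_eqI)
    fix x
    have "conj_set G x (conj_set G h U) = conj_set G h U \<longleftrightarrow> conj_set G (inv h \<otimes> x \<otimes> h) U = U"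
      if x: "x \<in> carrier G"
    proof
      assume "conj_set G x (conj_set G h U) = conj_set G h U"
      then show "conj_set G (inv h \<otimes> x \<otimes> h) U = U"
        using x h by (simp add: conj_set_mult[OF sub] conj_set_mult conj_set_subset[OF sub] conj_set_inv[OF sub])
    next
      assume "conj_set G (inv h \<otimes> x \<otimes> h) U = U"
      then have "conj_set G h (conj_set G (inv h) (conj_set G x (conj_set G h U))) = conj_set G h U"
        using x h by (simp add: conj_set_mult conj_set_subset sub)
      then show "conj_set G x (conj_set G h U) = conj_set G h U"
        using x h by (simp add: conj_set_inv conj_set_subset sub)
    qed
    then show "x \<in> normalizer G (conj_set G h U) \<longleftrightarrow> x \<in> conj_set G h (normalizer G U)"
      unfolding mem_conj_set_iff[OF norm_sub h]
      using h by (cases "x \<in> carrier G") (simp_all add: normalizer_eq conj_set_subset sub)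
  qed
  then have "normalizer_index G (conj_set G h U) * card U = normalizer_index G U * card U"
    using normalizer_index_mult_card[OF sub_U] normalizer_index_mult_card[OF conj_set_subgroup[OF sub_U h]]
    by (simp add: card_conj sub norm_sub)
  then show ?thesis
    using card_subgroup_pos[OF sub_U] by simp
qed

lemma normalizer_index_int_pos: "U \<in> subgroups_of G \<Longrightarrow> int (normalizer_index G U) > 0"
  using normalizer_index_pos by (simp add: subgroups_of_def)

end

section \<open>The permutation module and its fixed points\<close>

locale group_coefficients = G: finite_group G + R: cring R
  for G :: "('g, 'm) monoid_scheme" and R :: "('r, 'k) ring_scheme"
begin

abbreviation RS :: "('r, 'g set \<Rightarrow> 'r) module"
  where "RS \<equiv> sg_module R G"

abbreviation RB :: "('r, ('r \<times> 'g burnside \<Rightarrow>\<^sub>0 int) set) module"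
  where "RB \<equiv> burnside_alg R G"

lemma sg_module_carrier: "carrier RS = subgroups_of G \<rightarrow>\<^sub>E carrier R"
  by (simp add: sg_module_def)

lemma module_sg_module: "module R RS"
  unfolding sg_module_def by (rule R.module_free_module)

lemma abelian_group_sg_module: "abelian_group RS"
  using module_sg_module by (rule module.axioms(2))

lemma sg_module_coord:
  "v \<in> carrier RS \<Longrightarrow> U \<in> subgroups_of G \<Longrightarrow> v U \<in> carrier R"
  by (auto simp: sg_module_carrier)

lemma sg_module_eqI:
  assumes "v \<in> carrier RS" and "w \<in> carrier RS"
    and "\<And>U. U \<in> subgroups_of G \<Longrightarrow> v U = w U"
  shows "v = w"
  using assms unfolding sg_module_def by (rule R.free_module_eqI)

lemma sg_basis_closed: "sg_basis R G U \<in> carrier RS"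
  unfolding sg_basis_def sg_module_def by (rule R.basis_vec_closed)

lemma sg_action_hom:
  assumes "g \<in> carrier G"
  shows "sg_action R G g \<in> module_hom R RS RS"
proof -
  have "(\<lambda>U. sg_basis R G (conj_set G g U)) \<in> subgroups_of G \<rightarrow> carrier RS"
    using sg_basis_closed by blast
  then show ?thesis
    using R.linear_ext_hom[OF G.finite_subgroups_of module_sg_module]
    unfolding sg_action_def by (simp only: sg_module_def)
qed

lemma sg_action_apply:
  assumes g: "g \<in> carrier G" and v: "v \<in> carrier RS" and V: "V \<in> subgroups_of G"
  shows "sg_action R G g v V = v (conj_set G (inv\<^bsub>G\<^esub> g) V)"
proof -
  let ?W = "conj_set G (inv\<^bsub>G\<^esub> g) V"
  have W: "?W \<in> subgroups_of G"
    using g V by (simp add: G.conj_set_closed)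
  have "sg_action R G g v V =
    (\<Oplus>\<^bsub>R\<^esub>U\<in>subgroups_of G. v U \<otimes>\<^bsub>R\<^esub> sg_basis R G (conj_set G g U) V)"
    unfolding sg_action_def sg_module_def
    by (rule R.linear_ext_apply)
      (use v V G.finite_subgroups_of sg_basis_closed in \<open>simp_all only: sg_module_def Pi_iff\<close>, simp)
  also have "\<dots> = (\<Oplus>\<^bsub>R\<^esub>U\<in>subgroups_of G. if U = ?W then v ?W else \<zero>\<^bsub>R\<^esub>)"
  proof (rule R.finsum_cong')
    fix U
    assume U: "U \<in> subgroups_of G"
    have "V = conj_set G g U \<longleftrightarrow> U = ?W"
      using g U V by (auto simp: G.conj_set_inv G.subgroups_of_subset)
    then show "v U \<otimes>\<^bsub>R\<^esub> sg_basis R G (conj_set G g U) V = (if U = ?W then v ?W else \<zero>\<^bsub>R\<^esub>)"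
      using sg_module_coord[OF v U] V by (cases "U = ?W") (simp_all add: sg_basis_def)
  qed (use sg_module_coord[OF v W] in auto)
  also have "\<dots> = v ?W"
    using G.finite_subgroups_of W sg_module_coord[OF v W] by (rule R.finsum_if_eq)
  finally show ?thesis .
qed

lemma sg_fixed_iff:
  "v \<in> carrier (sg_fixed R G) \<longleftrightarrow> v \<in> carrier RS \<and>
    (\<forall>g\<in>carrier G. \<forall>U\<in>subgroups_of G. v (conj_set G g U) = v U)"
proof -
  have "(\<forall>g\<in>carrier G. sg_action R G g v = v) \<longleftrightarrow>
    (\<forall>g\<in>carrier G. \<forall>U\<in>subgroups_of G. v (conj_set G g U) = v U)" if v: "v \<in> carrier RS"
  proof
    assume *: "\<forall>g\<in>carrier G. sg_action R G g v = v"
    show "\<forall>g\<in>carrier G. \<forall>U\<in>subgroups_of G. v (conj_set G g U) = v U"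
    proof (intro ballI)
      fix g U
      assume "g \<in> carrier G" "U \<in> subgroups_of G"
      then show "v (conj_set G g U) = v U"
        using sg_action_apply[OF G.inv_closed[of g] v, of U] * by simp
    qed
  next
    assume *: "\<forall>g\<in>carrier G. \<forall>U\<in>subgroups_of G. v (conj_set G g U) = v U"
    show "\<forall>g\<in>carrier G. sg_action R G g v = v"
    proof
      fix g
      assume g: "g \<in> carrier G"
      show "sg_action R G g v = v"
        using sg_action_apply[OF g v] * g module_hom_closed[OF sg_action_hom[OF g] v] v
        by (intro sg_module_eqI) auto
    qed
  qed
  then show ?thesis
    by (auto simp: sg_fixed_def)
qed

lemma submodule_sg_fixed: "submodule (carrier (sg_fixed R G)) R RS"
proof -
  interpret M: module R "RS"
    by (rule module_sg_module)
  have hom: "abelian_group_hom RS RS (sg_action R G g)" if "g \<in> carrier G" for g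
    using module_hom_abelian_group_hom[OF _ _ sg_action_hom[OF that]] abelian_group_sg_module by blast
  have fixed: "v \<in> carrier (sg_fixed R G) \<longleftrightarrow> v \<in> carrier RS \<and>
    (\<forall>g\<in>carrier G. sg_action R G g v = v)" for v
    by (simp add: sg_fixed_def)
  show ?thesis
  proof (rule M.submoduleI)
    show "carrier (sg_fixed R G) \<subseteq> carrier RS"
      using fixed by blast
    show "\<zero>\<^bsub>RS\<^esub> \<in> carrier (sg_fixed R G)"
      using abelian_group_hom.hom_zero[OF hom] by (simp add: fixed)
    show "\<ominus>\<^bsub>RS\<^esub> v \<in> carrier (sg_fixed R G)" if "v \<in> carrier (sg_fixed R G)" for v
      using that abelian_group_hom.hom_a_inv[OF hom] by (simp add: fixed)
    show "v \<oplus>\<^bsub>RS\<^esub> w \<in> carrier (sg_fixed R G)"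
      if "v \<in> carrier (sg_fixed R G)" "w \<in> carrier (sg_fixed R G)" for v w
      using that by (simp add: fixed module_hom_add[OF sg_action_hom])
    show "r \<odot>\<^bsub>RS\<^esub> v \<in> carrier (sg_fixed R G)"
      if "r \<in> carrier R" "v \<in> carrier (sg_fixed R G)" for r v
      using that by (simp add: fixed module_hom_smult[OF sg_action_hom])
  qed
qed

lemma module_sg_fixed: "module R (sg_fixed R G)"
  using submodule.submodule_is_module[OF submodule_sg_fixed module_sg_module]
  by (simp add: sg_fixed_def)

lemma sg_fixed_subset: "carrier (sg_fixed R G) \<subseteq> carrier RS"
  by (auto simp: sg_fixed_def)

lemma module_hom_into_sg_fixed:
  assumes "f \<in> module_hom R M RS" and "f ` carrier M \<subseteq> carrier (sg_fixed R G)"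
  shows "f \<in> module_hom R M (sg_fixed R G)"
  using assms by (auto simp: module_hom_def sg_fixed_def)

lemma module_hom_from_sg_fixed:
  assumes "f \<in> module_hom R RS M"
  shows "f \<in> module_hom R (sg_fixed R G) M"
  using assms by (auto simp: module_hom_def sg_fixed_def)

lemma class_sum_apply:
  assumes U: "U \<in> subgroups_of G" and V: "V \<in> subgroups_of G"
  shows "class_sum R G U V = (if V \<in> conj_class G U then \<one>\<^bsub>R\<^esub> else \<zero>\<^bsub>R\<^esub>)"
proof -
  have fin: "finite (conj_class G U)"
    using G.conj_class_subset[OF U] G.finite_subgroups_of by (rule finite_subset)
  have "class_sum R G U V = (\<Oplus>\<^bsub>R\<^esub>W\<in>conj_class G U. sg_basis R G W V)"
    unfolding class_sum_def sg_module_def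
    by (rule R.free_module_finsum_apply)
      (use fin V sg_basis_closed in \<open>simp_all only: sg_module_def Pi_iff\<close>, simp)
  also have "\<dots> = (\<Oplus>\<^bsub>R\<^esub>W\<in>conj_class G U. if W = V then \<one>\<^bsub>R\<^esub> else \<zero>\<^bsub>R\<^esub>)"
    using V by (intro R.finsum_cong') (auto simp: sg_basis_def)
  also have "\<dots> = (if V \<in> conj_class G U then \<one>\<^bsub>R\<^esub> else \<zero>\<^bsub>R\<^esub>)"
  proof (cases "V \<in> conj_class G U")
    case False
    then have "(\<Oplus>\<^bsub>R\<^esub>W\<in>conj_class G U. if W = V then \<one>\<^bsub>R\<^esub> else \<zero>\<^bsub>R\<^esub>) =
      (\<Oplus>\<^bsub>R\<^esub>W\<in>conj_class G U. \<zero>\<^bsub>R\<^esub>)"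
      by (intro R.finsum_cong') auto
    then show ?thesis
      using False by simp
  qed (simp add: R.finsum_if_eq[OF fin])
  finally show ?thesis .
qed

lemma class_sum_closed:
  assumes "U \<in> subgroups_of G"
  shows "class_sum R G U \<in> carrier (sg_fixed R G)"
proof -
  have "class_sum R G U \<in> carrier RS"
    unfolding class_sum_def using sg_basis_closed
    by (intro abelian_monoid.finsum_closed abelian_group.axioms(1) abelian_group_sg_module) blast
  moreover have "class_sum R G U (conj_set G g V) = class_sum R G U V"
    if "g \<in> carrier G" "V \<in> subgroups_of G" for g V
    using that assms
    by (simp add: class_sum_apply G.conj_set_closed G.mem_conj_class_iff G.conj_class_conj_set)
  ultimately show ?thesis
    by (simp add: sg_fixed_iff)
qed

text \<open>A fixed vector is constant on conjugacy classes.\<close>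

lemma sg_fixed_eqI:
  assumes v: "v \<in> carrier (sg_fixed R G)" and w: "w \<in> carrier (sg_fixed R G)"
    and T: "conj_transversal G T" and eq: "\<And>U. U \<in> T \<Longrightarrow> v U = w U"
  shows "v = w"
proof (rule sg_module_eqI)
  fix U
  assume "U \<in> subgroups_of G"
  then obtain V g where "V \<in> T" "g \<in> carrier G" "U = conj_set G g V"
    by (rule G.conj_transversal_rep[OF T])
  then show "v U = w U"
    using v w eq[of V] G.conj_transversal_subgroup[OF T] by (auto simp: sg_fixed_iff)
qed (use v w in \<open>auto simp: sg_fixed_iff\<close>)

section \<open>The automorphism \<open>\<zeta>\<close>\<close>

lemma zeta_hom: "zeta R G \<in> module_hom R RS RS"
proof -
  have "(\<lambda>U. finsum RS (sg_basis R G) {V \<in> subgroups_of G. V \<subseteq> U})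
    \<in> subgroups_of G \<rightarrow> carrier RS"
    using sg_basis_closed
    by (intro funcsetI abelian_monoid.finsum_closed abelian_group.axioms(1) abelian_group_sg_module) blast
  then show ?thesis
    using R.linear_ext_hom[OF G.finite_subgroups_of module_sg_module]
    unfolding zeta_def by (simp only: sg_module_def)
qed

lemma zeta_apply:
  assumes v: "v \<in> carrier RS" and V: "V \<in> subgroups_of G"
  shows "zeta R G v V = (\<Oplus>\<^bsub>R\<^esub>U\<in>subgroups_of G. if V \<subseteq> U then v U else \<zero>\<^bsub>R\<^esub>)"
proof -
  let ?s = "\<lambda>U. finsum RS (sg_basis R G) {W \<in> subgroups_of G. W \<subseteq> U}"
  have closed: "?s U \<in> carrier RS" for U
    using sg_basis_closed
    by (intro abelian_monoid.finsum_closed abelian_group.axioms(1) abelian_group_sg_module) blast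
  have s: "?s U V = (if V \<subseteq> U then \<one>\<^bsub>R\<^esub> else \<zero>\<^bsub>R\<^esub>)" for U
  proof -
    have fin: "finite {W \<in> subgroups_of G. W \<subseteq> U}"
      using G.finite_subgroups_of by simp
    have "?s U V = (\<Oplus>\<^bsub>R\<^esub>W\<in>{W \<in> subgroups_of G. W \<subseteq> U}. sg_basis R G W V)"
      unfolding sg_module_def
      by (rule R.free_module_finsum_apply)
        (use fin V sg_basis_closed in \<open>simp_all only: sg_module_def Pi_iff\<close>, simp)
    also have "\<dots> = (\<Oplus>\<^bsub>R\<^esub>W\<in>{W \<in> subgroups_of G. W \<subseteq> U}. if W = V then \<one>\<^bsub>R\<^esub> else \<zero>\<^bsub>R\<^esub>)"
      using V by (intro R.finsum_cong') (auto simp: sg_basis_def)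
    also have "\<dots> = (if V \<subseteq> U then \<one>\<^bsub>R\<^esub> else \<zero>\<^bsub>R\<^esub>)"
    proof (cases "V \<subseteq> U")
      case False
      then have "(\<Oplus>\<^bsub>R\<^esub>W\<in>{W \<in> subgroups_of G. W \<subseteq> U}. if W = V then \<one>\<^bsub>R\<^esub> else \<zero>\<^bsub>R\<^esub>) =
        (\<Oplus>\<^bsub>R\<^esub>W\<in>{W \<in> subgroups_of G. W \<subseteq> U}. \<zero>\<^bsub>R\<^esub>)"
        by (intro R.finsum_cong') auto
      then show ?thesis
        using False by simp
    qed (use V in \<open>simp add: R.finsum_if_eq[OF fin]\<close>)
    finally show ?thesis .
  qed
  have "zeta R G v V = (\<Oplus>\<^bsub>R\<^esub>U\<in>subgroups_of G. v U \<otimes>\<^bsub>R\<^esub> ?s U V)"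
    unfolding zeta_def sg_module_def
    by (rule R.linear_ext_apply)
      (use v V G.finite_subgroups_of closed in \<open>simp_all only: sg_module_def Pi_iff\<close>, simp)
  also have "\<dots> = (\<Oplus>\<^bsub>R\<^esub>U\<in>subgroups_of G. if V \<subseteq> U then v U else \<zero>\<^bsub>R\<^esub>)"
    using sg_module_coord[OF v] by (intro R.finsum_cong') (auto simp: s)
  finally show ?thesis .
qed

lemma zeta_closed: "v \<in> carrier RS \<Longrightarrow> zeta R G v \<in> carrier RS"
  by (rule module_hom_closed[OF zeta_hom])

lemma zeta_apply_split:
  assumes v: "v \<in> carrier RS" and V: "V \<in> subgroups_of G"
  shows "zeta R G v V =
    v V \<oplus>\<^bsub>R\<^esub> (\<Oplus>\<^bsub>R\<^esub>U\<in>subgroups_of G - {V}. if V \<subseteq> U then v U else \<zero>\<^bsub>R\<^esub>)"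
proof -
  have "(\<Oplus>\<^bsub>R\<^esub>U\<in>insert V (subgroups_of G - {V}). if V \<subseteq> U then v U else \<zero>\<^bsub>R\<^esub>) =
    (if V \<subseteq> V then v V else \<zero>\<^bsub>R\<^esub>) \<oplus>\<^bsub>R\<^esub>
    (\<Oplus>\<^bsub>R\<^esub>U\<in>subgroups_of G - {V}. if V \<subseteq> U then v U else \<zero>\<^bsub>R\<^esub>)"
    using sg_module_coord[OF v] V G.finite_subgroups_of by (intro R.finsum_insert) auto
  then show ?thesis
    using V by (simp add: zeta_apply[OF v V] insert_absorb)
qed

text \<open>The matrix of \<open>\<zeta>\<close> is triangular for the inclusion order, with ones on the diagonal: at a
  maximal subgroup in the support of \<open>v\<close> the coefficients of \<open>v\<close> and of \<open>\<zeta> v\<close> agree.\<close>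

lemma zeta_eq_zero:
  assumes v: "v \<in> carrier RS" and "zeta R G v = \<zero>\<^bsub>RS\<^esub>"
  shows "v = \<zero>\<^bsub>RS\<^esub>"
proof -
  let ?A = "{U \<in> subgroups_of G. v U \<noteq> \<zero>\<^bsub>R\<^esub>}"
  have zero: "\<zero>\<^bsub>RS\<^esub> U = \<zero>\<^bsub>R\<^esub>" if "U \<in> subgroups_of G" for U
    using that by (simp add: sg_module_def)
  have "?A = {}"
  proof (rule ccontr)
    assume "?A \<noteq> {}"
    moreover have "finite ?A"
      using G.finite_subgroups_of by simp
    ultimately obtain V where V: "V \<in> ?A" and max: "\<forall>U\<in>?A. V \<subseteq> U \<longrightarrow> V = U"
      using finite_has_maximal[of ?A] by blast
    have "(\<Oplus>\<^bsub>R\<^esub>U\<in>subgroups_of G - {V}. if V \<subseteq> U then v U else \<zero>\<^bsub>R\<^esub>) =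
      (\<Oplus>\<^bsub>R\<^esub>U\<in>subgroups_of G - {V}. \<zero>\<^bsub>R\<^esub>)"
      using max by (intro R.finsum_cong') auto
    then have "zeta R G v V = v V"
      using V v sg_module_coord[OF v] by (simp add: zeta_apply_split)
    then show False
      using V zero assms(2) by simp
  qed
  then show ?thesis
    using zero v abelian_group.axioms(1)[OF abelian_group_sg_module]
    by (intro sg_module_eqI) (auto intro: abelian_monoid.zero_closed)
qed

lemma zeta_inj: "inj_on (zeta R G) (carrier RS)"
proof (rule inj_onI)
  interpret M: abelian_group "RS"
    by (rule abelian_group_sg_module)
  fix v w
  assume v: "v \<in> carrier RS" and w: "w \<in> carrier RS"
    and "zeta R G v = zeta R G w"
  then have "zeta R G (v \<ominus>\<^bsub>RS\<^esub> w) = \<zero>\<^bsub>RS\<^esub>"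
    using module_hom_minus[OF M.abelian_group_axioms M.abelian_group_axioms zeta_hom v w]
    by (simp add: M.minus_eq_zero_iff zeta_closed)
  then have "v \<ominus>\<^bsub>RS\<^esub> w = \<zero>\<^bsub>RS\<^esub>"
    by (rule zeta_eq_zero[OF M.minus_closed[OF v w]])
  then show "v = w"
    using v w by (simp add: M.minus_eq_zero_iff)
qed

text \<open>A preimage of \<open>w\<close> is found by correcting the coefficients from large to small subgroups:
  changing the coefficient at \<open>V\<close> affects \<open>\<zeta> v\<close> only at subgroups of \<open>V\<close>.\<close>

lemma zeta_approximate:
  assumes w: "w \<in> carrier RS"
  shows "\<exists>v\<in>carrier RS. \<forall>V\<in>subgroups_of G. order G < card V + n \<longrightarrow> zeta R G v V = w V"
proof (induction n)
  case 0
  have "card V \<le> order G" if "V \<in> subgroups_of G" for V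
    using that G.finite_carrier by (auto simp: order_def intro!: card_mono dest: G.subgroups_of_subset)
  moreover have "\<zero>\<^bsub>RS\<^esub> \<in> carrier RS"
    using abelian_monoid.zero_closed abelian_group.axioms(1) abelian_group_sg_module by blast
  ultimately show ?case
    by force
next
  case (Suc n)
  then obtain v where v: "v \<in> carrier RS"
    and v_eq: "\<And>V. V \<in> subgroups_of G \<Longrightarrow> order G < card V + n \<Longrightarrow> zeta R G v V = w V"
    by blast
  \<comment> \<open>The coefficients at the subgroups of order \<open>|G| - n\<close> are corrected by the remaining error.\<close>
  define v' where "v' = (\<lambda>V\<in>subgroups_of G.
    if card V + n = order G then v V \<oplus>\<^bsub>R\<^esub> (w V \<ominus>\<^bsub>R\<^esub> zeta R G v V) else v V)"
  have closed: "v V \<in> carrier R" "w V \<in> carrier R" "zeta R G v V \<in> carrier R"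
    if "V \<in> subgroups_of G" for V
    using that v w zeta_closed[OF v] sg_module_coord by blast+
  have v': "v' \<in> carrier RS"
    using closed by (auto simp: v'_def sg_module_carrier)
  have rest: "(\<Oplus>\<^bsub>R\<^esub>U\<in>subgroups_of G - {V}. if V \<subseteq> U then v' U else \<zero>\<^bsub>R\<^esub>) =
      (\<Oplus>\<^bsub>R\<^esub>U\<in>subgroups_of G - {V}. if V \<subseteq> U then v U else \<zero>\<^bsub>R\<^esub>)"
    if V: "V \<in> subgroups_of G" "order G \<le> card V + n" for V
  proof (rule R.finsum_cong')
    fix U
    assume U: "U \<in> subgroups_of G - {V}"
    have "card V < card U" if "V \<subseteq> U"
      using that U finite_subset[OF G.subgroups_of_subset G.finite_carrier]
      by (intro psubset_card_mono) auto
    then show "(if V \<subseteq> U then v' U else \<zero>\<^bsub>R\<^esub>) = (if V \<subseteq> U then v U else \<zero>\<^bsub>R\<^esub>)"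
      using U V(2) by (auto simp: v'_def)
  qed (use closed in auto)
  have rest_closed: "(\<Oplus>\<^bsub>R\<^esub>U\<in>subgroups_of G - {V}. if V \<subseteq> U then v U else \<zero>\<^bsub>R\<^esub>) \<in> carrier R" for V
    using closed by (intro R.finsum_closed) auto
  have "zeta R G v' V = w V" if V: "V \<in> subgroups_of G" "order G < card V + Suc n" for V
  proof (cases "card V + n = order G")
    case True
    let ?r = "\<Oplus>\<^bsub>R\<^esub>U\<in>subgroups_of G - {V}. if V \<subseteq> U then v U else \<zero>\<^bsub>R\<^esub>"
    have "zeta R G v' V = (v V \<oplus>\<^bsub>R\<^esub> (w V \<ominus>\<^bsub>R\<^esub> zeta R G v V)) \<oplus>\<^bsub>R\<^esub> ?r"
      using True V rest[OF V(1)] by (simp add: zeta_apply_split[OF v' V(1)]) (simp add: v'_def)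
    also have "\<dots> = (v V \<oplus>\<^bsub>R\<^esub> ?r) \<oplus>\<^bsub>R\<^esub> (w V \<ominus>\<^bsub>R\<^esub> zeta R G v V)"
      using closed[OF V(1)] rest_closed[of V] by (simp add: R.a_ac)
    also have "\<dots> = zeta R G v V \<oplus>\<^bsub>R\<^esub> (w V \<ominus>\<^bsub>R\<^esub> zeta R G v V)"
      by (simp add: zeta_apply_split[OF v V(1)])
    also have "\<dots> = w V"
      using closed[OF V(1)] by (simp add: a_minus_def R.a_lcomm R.r_neg)
    finally show ?thesis .
  next
    case False
    then have "zeta R G v' V = zeta R G v V"
      using V rest[OF V(1)] by (simp add: zeta_apply_split[OF v' V(1)] zeta_apply_split[OF v V(1)]) (simp add: v'_def)
    then show ?thesis
      using False V v_eq by simp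
  qed
  then show ?case
    using v' by blast
qed

lemma zeta_surj:
  assumes w: "w \<in> carrier RS"
  shows "\<exists>v\<in>carrier RS. zeta R G v = w"
proof -
  obtain v where v: "v \<in> carrier RS"
    and v_eq: "\<forall>V\<in>subgroups_of G. order G < card V + Suc (order G) \<longrightarrow> zeta R G v V = w V"
    using zeta_approximate[OF w, of "Suc (order G)"] by blast
  then show ?thesis
    using w zeta_closed[OF v] by (intro bexI[of _ v] sg_module_eqI) auto
qed

theorem zeta_iso: "zeta R G \<in> module_iso R RS RS"
proof -
  have "zeta R G ` carrier RS = carrier RS"
    using zeta_closed zeta_surj by blast
  then show ?thesis
    using zeta_hom zeta_inj by (simp add: module_iso_def bij_betw_def)
qed

text \<open>Conjugation permutes the subgroups and preserves inclusion.\<close>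

lemma zeta_equivariant:
  assumes v: "v \<in> carrier RS" and g: "g \<in> carrier G"
  shows "zeta R G (sg_action R G g v) = sg_action R G g (zeta R G v)"
proof (rule sg_module_eqI)
  let ?c = "conj_set G (inv\<^bsub>G\<^esub> g)"
  have ig: "inv\<^bsub>G\<^esub> g \<in> carrier G"
    using g by simp
  have act: "sg_action R G g v \<in> carrier RS"
    using module_hom_closed[OF sg_action_hom[OF g] v] .
  then show "zeta R G (sg_action R G g v) \<in> carrier RS"
    by (rule zeta_closed)
  show "sg_action R G g (zeta R G v) \<in> carrier RS"
    using module_hom_closed[OF sg_action_hom[OF g] zeta_closed[OF v]] .
  fix V
  assume V: "V \<in> subgroups_of G"
  have "zeta R G (sg_action R G g v) V =
    (\<Oplus>\<^bsub>R\<^esub>U\<in>subgroups_of G. if ?c V \<subseteq> ?c U then v (?c U) else \<zero>\<^bsub>R\<^esub>)"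
    unfolding zeta_apply[OF act V]
    using sg_module_coord[OF v G.conj_set_closed[OF _ ig]]
    by (intro R.finsum_cong') (auto simp: sg_action_apply[OF g v] G.conj_set_subset_iff[OF V _ ig])
  also have "\<dots> = (\<Oplus>\<^bsub>R\<^esub>U\<in>?c ` subgroups_of G. if ?c V \<subseteq> U then v U else \<zero>\<^bsub>R\<^esub>)"
    using bij_betw_imp_inj_on[OF G.conj_set_bij[OF ig]] sg_module_coord[OF v] G.conj_set_closed[OF _ ig]
    by (subst R.finsum_reindex) auto
  also have "\<dots> = sg_action R G g (zeta R G v) V"
    using bij_betw_imp_surj_on[OF G.conj_set_bij[OF ig]] G.conj_set_closed[OF V ig]
    by (simp add: sg_action_apply[OF g zeta_closed[OF v] V] zeta_apply[OF v])
  finally show "zeta R G (sg_action R G g v) V = sg_action R G g (zeta R G v) V" .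
qed

text \<open>By equivariance \<open>\<zeta>\<close> preserves fixed vectors; since it is injective, it also reflects them, so
  its inverse restricts to the fixed vectors.\<close>

lemma zeta_fixed_iff:
  assumes v: "v \<in> carrier RS"
  shows "zeta R G v \<in> carrier (sg_fixed R G) \<longleftrightarrow> v \<in> carrier (sg_fixed R G)"
proof -
  have "sg_action R G g (zeta R G v) = zeta R G v \<longleftrightarrow> sg_action R G g v = v" if g: "g \<in> carrier G" for g
    using zeta_equivariant[OF v g] inj_onD[OF zeta_inj, of "sg_action R G g v" v]
      module_hom_closed[OF sg_action_hom[OF g] v] v by metis
  then show ?thesis
    using v zeta_closed[OF v] by (simp add: sg_fixed_def)
qed

lemma zeta_image_fixed: "zeta R G ` carrier (sg_fixed R G) = carrier (sg_fixed R G)"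
proof
  show "zeta R G ` carrier (sg_fixed R G) \<subseteq> carrier (sg_fixed R G)"
    using zeta_fixed_iff sg_fixed_subset by blast
  show "carrier (sg_fixed R G) \<subseteq> zeta R G ` carrier (sg_fixed R G)"
  proof
    fix w
    assume w: "w \<in> carrier (sg_fixed R G)"
    then obtain v where "v \<in> carrier RS" "zeta R G v = w"
      using zeta_surj sg_fixed_subset by blast
    then show "w \<in> zeta R G ` carrier (sg_fixed R G)"
      using w zeta_fixed_iff by blast
  qed
qed

theorem zeta_fixed_iso: "zeta R G \<in> module_iso R (sg_fixed R G) (sg_fixed R G)"
  using module_hom_into_sg_fixed[OF module_hom_from_sg_fixed[OF zeta_hom]] zeta_image_fixed
    inj_on_subset[OF zeta_inj sg_fixed_subset]
  by (simp add: module_iso_def bij_betw_def)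

end

section \<open>The maps \<open>\<alpha>\<close> and \<open>\<rho>\<close> over a commutative ring\<close>

context group_coefficients
begin

interpretation tensor: scalar_extension R "burnside_ring G"
  by unfold_locales (rule G.burnside_add_closed)

lemma module_burnside_alg: "module R RB"
  by (rule tensor.module_base_change)

lemma abelian_group_burnside_alg: "abelian_group RB"
  by (rule tensor.abelian_group_base_change)

lemma alpha_hom: "alpha R G \<in> module_hom R RB RS"
  unfolding alpha_def sg_module_def by (rule tensor.scalar_ext_hom) (rule G.alpha_int_add)

lemma rho_hom: "rho R G \<in> module_hom R RB RS"
  unfolding rho_def sg_module_def by (rule tensor.scalar_ext_hom) (rule G.rho_int_add)

lemma alpha_closed: "t \<in> carrier RB \<Longrightarrow> alpha R G t \<in> carrier RS"
  by (rule module_hom_closed[OF alpha_hom])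

lemma alpha_pure:
  assumes "r \<in> carrier R" and "b \<in> carrier (burnside_ring G)"
  shows "alpha R G (pure_tensor R (burnside_ring G) r b) =
    r \<odot>\<^bsub>RS\<^esub> int_coeffs R (subgroups_of G) (alpha_int G b)"
  unfolding alpha_def sg_module_def by (rule tensor.scalar_ext_pure[OF G.alpha_int_add assms])

lemma rho_pure:
  assumes "r \<in> carrier R" and "b \<in> carrier (burnside_ring G)"
  shows "rho R G (pure_tensor R (burnside_ring G) r b) =
    r \<odot>\<^bsub>RS\<^esub> int_coeffs R (subgroups_of G) (rho_int G b)"
  unfolding rho_def sg_module_def by (rule tensor.scalar_ext_pure[OF G.rho_int_add assms])

lemma int_coeffs_sg_closed: "int_coeffs R (subgroups_of G) a \<in> carrier RS"
  unfolding sg_module_def by (rule tensor.int_coeffs_closed)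

text \<open>Two linear maps on \<open>R \<otimes> B(G)\<close> agree if they agree on pure tensors; there the claim is the
  integral identity, multiplied by \<open>r\<close>.\<close>

theorem zeta_alpha:
  assumes "t \<in> carrier RB"
  shows "zeta R G (alpha R G t) = rho R G t"
proof (rule tensor.module_hom_eq_on_base_change[OF abelian_group_sg_module
      module_hom_compose[OF alpha_hom zeta_hom] rho_hom _ assms])
  fix r b
  assume r: "r \<in> carrier R" and b: "b \<in> carrier (burnside_ring G)"
  let ?i = "int_coeffs R (subgroups_of G)"
  have "zeta R G (?i (alpha_int G b)) = ?i (rho_int G b)"
  proof (rule sg_module_eqI[OF zeta_closed[OF int_coeffs_sg_closed] int_coeffs_sg_closed])
    fix V
    assume V: "V \<in> subgroups_of G"
    have "zeta R G (?i (alpha_int G b)) V =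
      (\<Oplus>\<^bsub>R\<^esub>U\<in>subgroups_of G. [(if V \<subseteq> U then alpha_int G b U else 0)] \<cdot>\<^bsub>R\<^esub> \<one>\<^bsub>R\<^esub>)"
      unfolding zeta_apply[OF int_coeffs_sg_closed V]
      by (intro R.finsum_cong') (auto simp: int_coeffs_def add_pow_def[of R "0::int"])
    also have "\<dots> = ?i (rho_int G b) V"
      using V
      by (simp add: int_coeffs_def G.rho_int_eq_sum_alpha_int[OF b V] R.add_pow_sum[OF G.finite_subgroups_of])
    finally show "zeta R G (?i (alpha_int G b)) V = ?i (rho_int G b) V" .
  qed
  then show "zeta R G (alpha R G (pure_tensor R (burnside_ring G) r b)) =
    rho R G (pure_tensor R (burnside_ring G) r b)"
    using r b by (simp add: alpha_pure rho_pure module_hom_smult[OF zeta_hom] int_coeffs_sg_closed)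
qed

abbreviation coset_tensor :: "'g set \<Rightarrow> ('r \<times> 'g burnside \<Rightarrow>\<^sub>0 int) set"
  where "coset_tensor U \<equiv>
    pure_tensor R (burnside_ring G) \<one>\<^bsub>R\<^esub> (burnside_class G (coset_gset G U))"

lemma coset_class_closed: "U \<in> subgroups_of G \<Longrightarrow> burnside_class G (coset_gset G U) \<in> carrier (burnside_ring G)"
  by (simp add: subgroups_of_def G.burnside_class_closed G.finite_coset_gset)

lemma coset_tensor_closed: "U \<in> subgroups_of G \<Longrightarrow> coset_tensor U \<in> carrier RB"
  by (simp add: tensor.pure_tensor_closed coset_class_closed)

lemma alpha_coset_tensor_apply:
  assumes U: "U \<in> subgroups_of G" and V: "V \<in> subgroups_of G"
  shows "alpha R G (coset_tensor U) V =
    (if V \<in> conj_class G U then [normalizer_index G U] \<cdot>\<^bsub>R\<^esub> \<one>\<^bsub>R\<^esub> else \<zero>\<^bsub>R\<^esub>)"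
proof -
  have "alpha R G (coset_tensor U) V =
    [(alpha_int G (burnside_class G (coset_gset G U)) V)] \<cdot>\<^bsub>R\<^esub> \<one>\<^bsub>R\<^esub>"
    using V by (simp add: alpha_pure[OF R.one_closed coset_class_closed[OF U]] sg_module_def int_coeffs_def)
  then show ?thesis
    using U V by (simp add: G.alpha_int_coset_class subgroups_of_def R.add_pow_int_of_nat add_pow_def[of R "0::int"])
qed

theorem alpha_coset_tensor:
  assumes U: "U \<in> subgroups_of G"
  shows "alpha R G (coset_tensor U) = [normalizer_index G U] \<cdot>\<^bsub>RS\<^esub> class_sum R G U"
proof (rule sg_module_eqI)
  interpret M: abelian_group "RS"
    by (rule abelian_group_sg_module)
  have closed: "class_sum R G U \<in> carrier RS"
    using class_sum_closed[OF U] sg_fixed_subset by blast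
  then show "[normalizer_index G U] \<cdot>\<^bsub>RS\<^esub> class_sum R G U \<in> carrier RS"
    by simp
  show "alpha R G (coset_tensor U) \<in> carrier RS"
    using U by (intro alpha_closed coset_tensor_closed)
  fix V
  assume V: "V \<in> subgroups_of G"
  have "([normalizer_index G U] \<cdot>\<^bsub>RS\<^esub> class_sum R G U) V =
    [normalizer_index G U] \<cdot>\<^bsub>R\<^esub> class_sum R G U V"
    using closed V unfolding sg_module_def by (rule R.free_module_nat_pow_apply)
  then show "alpha R G (coset_tensor U) V = ([normalizer_index G U] \<cdot>\<^bsub>RS\<^esub> class_sum R G U) V"
    using U V by (simp add: alpha_coset_tensor_apply class_sum_apply R.add.nat_pow_one)
qed

lemma alpha_coset_tensor_fixed:
  assumes U: "U \<in> subgroups_of G"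
  shows "alpha R G (coset_tensor U) \<in> carrier (sg_fixed R G)"
  using U alpha_closed[OF coset_tensor_closed[OF U]]
  by (simp add: sg_fixed_iff alpha_coset_tensor_apply G.conj_set_closed G.mem_conj_class_iff G.conj_class_conj_set)

context
  fixes T
  assumes T: "conj_transversal G T"
begin

definition coset_combination :: "('g set \<Rightarrow> 'r) \<Rightarrow> ('r \<times> 'g burnside \<Rightarrow>\<^sub>0 int) set"
  where "coset_combination = linear_ext RB T coset_tensor"

lemma coset_tensor_funcset: "coset_tensor \<in> T \<rightarrow> carrier RB"
  using coset_tensor_closed G.conj_transversal_subgroup[OF T] by blast

lemma coset_combination_hom: "coset_combination \<in> module_hom R (free_module R T) RB"
  unfolding coset_combination_def
  by (rule R.linear_ext_hom[OF G.conj_transversal_finite[OF T] module_burnside_alg coset_tensor_funcset])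

lemma coset_combination_closed:
  "c \<in> carrier (free_module R T) \<Longrightarrow> coset_combination c \<in> carrier RB"
  by (rule module_hom_closed[OF coset_combination_hom])

text \<open>Orbits are split off \<open>X\<close> one at a time.  An orbit \<open>G/U\<close> has the same class as \<open>G/V\<close> for the
  conjugate \<open>V\<close> of \<open>U\<close> in \<open>T\<close>, because both have the same stabilizer counts.\<close>

lemma pure_class_combination:
  assumes X: "finite_gset G X" and r: "r \<in> carrier R"
  shows "\<exists>c\<in>carrier (free_module R T).
    pure_tensor R (burnside_ring G) r (burnside_class G X) = coset_combination c"
  using X
proof (induction X rule: G.finite_gset_induct)
  case (empty X)
  interpret A: abelian_group RB
    by (rule abelian_group_burnside_alg)
  let ?p = "pure_tensor R (burnside_ring G) r (burnside_class G X)"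
  have p: "?p \<in> carrier RB"
    using r empty(1) by (intro tensor.pure_tensor_closed G.burnside_class_closed)
  have "?p \<oplus>\<^bsub>RB\<^esub> ?p = ?p"
    using tensor.pure_tensor_add_right[OF r G.burnside_class_closed G.burnside_class_closed, OF empty(1) empty(1)]
      G.burnside_class_idempotent_empty[OF empty] by simp
  then have "?p = \<zero>\<^bsub>RB\<^esub>"
    using p A.add.r_cancel_one' by metis
  also have "\<dots> = coset_combination \<zero>\<^bsub>free_module R T\<^esub>"
    using abelian_group_hom.hom_zero[OF module_hom_abelian_group_hom[OF R.abelian_group_free_module
          abelian_group_burnside_alg coset_combination_hom]] by simp
  finally show ?case
    using abelian_monoid.zero_closed[OF abelian_group.axioms(1)[OF R.abelian_group_free_module]] by blast
next
  case (orbit X Y U)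
  interpret M: module R "free_module R T"
    by (rule R.module_free_module)
  interpret A: module R "RB"
    by (rule module_burnside_alg)
  obtain c where c: "c \<in> carrier (free_module R T)"
    and Y_eq: "pure_tensor R (burnside_ring G) r (burnside_class G Y) = coset_combination c"
    using orbit(5) by blast
  have U: "U \<in> subgroups_of G"
    using orbit(3) by (simp add: subgroups_of_def)
  obtain V where V: "V \<in> T" and class_V: "conj_class G V = conj_class G U"
    using G.conj_transversal_rep[OF T U] by metis
  have V': "V \<in> subgroups_of G" "subgroup V G"
    using V G.conj_transversal_subgroup[OF T] by (auto simp: subgroups_of_def)
  have "U \<in> conj_class G V"
    using G.mem_conj_class_iff[OF V'(1) U] class_V by simp
  then obtain g where "g \<in> carrier G" "U = conj_set G g V"
    by (auto simp: conj_class_def)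
  have coset_fin: "finite_gset G (coset_gset G U)" "finite_gset G (coset_gset G V)"
    using G.finite_coset_gset orbit(3) V'(2) by auto
  have "normalizer_index G U = normalizer_index G V"
    using G.normalizer_index_conj_set[OF V'(1)] \<open>g \<in> carrier G\<close> \<open>U = conj_set G g V\<close> by simp
  then have "burnside_class G (coset_gset G U) = burnside_class G (coset_gset G V)"
    unfolding burnside_class_def
    by (subst G.burnside_diff_eq_iff)
      (simp_all add: coset_fin G.finite_gset_empty G.stab_count_coset_gset orbit(3) V'(2) class_V)
  then have "pure_tensor R (burnside_ring G) r (burnside_class G (coset_gset G U)) =
    r \<odot>\<^bsub>RB\<^esub> coset_tensor V"
    using r by (simp add: tensor.base_change_smult_pure)
  also have "\<dots> = coset_combination (r \<odot>\<^bsub>free_module R T\<^esub> basis_vec R T V)"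
    unfolding module_hom_smult[OF coset_combination_hom r R.basis_vec_closed]
    using R.linear_ext_basis_vec[OF G.conj_transversal_finite[OF T] module_burnside_alg coset_tensor_funcset V]
    by (simp add: coset_combination_def)
  finally have U_eq: "pure_tensor R (burnside_ring G) r (burnside_class G (coset_gset G U)) =
    coset_combination (r \<odot>\<^bsub>free_module R T\<^esub> basis_vec R T V)" .
  have closed: "r \<odot>\<^bsub>free_module R T\<^esub> basis_vec R T V \<in> carrier (free_module R T)"
    using r R.basis_vec_closed by (rule M.smult_closed)
  have "pure_tensor R (burnside_ring G) r (burnside_class G X) =
    pure_tensor R (burnside_ring G) r (burnside_class G (coset_gset G U)) \<oplus>\<^bsub>RB\<^esub>
    pure_tensor R (burnside_ring G) r (burnside_class G Y)"
    using r coset_fin(1) orbit(2)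
    by (simp add: tensor.pure_tensor_add_right G.burnside_class_closed
        flip: G.burnside_class_add[OF coset_fin(1) orbit(2) orbit(1) orbit(4)])
  also have "\<dots> = coset_combination ((r \<odot>\<^bsub>free_module R T\<^esub> basis_vec R T V) \<oplus>\<^bsub>free_module R T\<^esub> c)"
    unfolding U_eq Y_eq by (rule module_hom_add[OF coset_combination_hom closed c, symmetric])
  finally show ?case
    using M.add.m_closed[OF closed c] by blast
qed

text \<open>Every element of \<open>B(G)\<close> is a difference of classes of \<open>G\<close>-sets, and these are sums of classes
  of orbits.\<close>

lemma coset_combination_surj:
  assumes "t \<in> carrier RB"
  shows "\<exists>c\<in>carrier (free_module R T). t = coset_combination c"
  using assms
proof (induction t rule: tensor.base_change_induct)
  case zero
  have "\<zero>\<^bsub>RB\<^esub> = coset_combination \<zero>\<^bsub>free_module R T\<^esub>"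
    using abelian_group_hom.hom_zero[OF module_hom_abelian_group_hom[OF R.abelian_group_free_module
          abelian_group_burnside_alg coset_combination_hom]] by simp
  then show ?case
    using abelian_monoid.zero_closed[OF abelian_group.axioms(1)[OF R.abelian_group_free_module]] by blast
next
  case (minus t u)
  then obtain c d where "c \<in> carrier (free_module R T)" "t = coset_combination c"
    "d \<in> carrier (free_module R T)" "u = coset_combination d"
    by blast
  then show ?case
    using module_hom_minus[OF R.abelian_group_free_module abelian_group_burnside_alg coset_combination_hom, symmetric]
      abelian_group.minus_closed[OF R.abelian_group_free_module] by blast
next
  case (pure r b)
  interpret A: abelian_group RB
    by (rule abelian_group_burnside_alg)
  obtain X Y :: "('g, nat) gset" where X: "finite_gset G X" and Y: "finite_gset G Y"
    and b: "b = burnside_diff G X Y"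
    using pure(2) by (rule G.burnside_cases)
  let ?p = "pure_tensor R (burnside_ring G) r"
  have closed: "?p b \<in> carrier RB" "?p (burnside_class G Y) \<in> carrier RB"
    using pure Y by (auto intro!: tensor.pure_tensor_closed G.burnside_class_closed)
  have "?p b \<oplus>\<^bsub>RB\<^esub> ?p (burnside_class G Y) = ?p (burnside_class G X)"
    using tensor.pure_tensor_add_right[OF pure G.burnside_class_closed[OF Y]]
      G.burnside_diff_add_class[OF X Y] b by simp
  then have "?p b = ?p (burnside_class G X) \<ominus>\<^bsub>RB\<^esub> ?p (burnside_class G Y)"
    using closed by (metis A.add.inv_solve_right A.add.m_closed a_minus_def)
  moreover obtain c d where "c \<in> carrier (free_module R T)" "?p (burnside_class G X) = coset_combination c"
    "d \<in> carrier (free_module R T)" "?p (burnside_class G Y) = coset_combination d"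
    using pure_class_combination[OF X pure(1)] pure_class_combination[OF Y pure(1)] by blast
  ultimately show ?case
    using module_hom_minus[OF R.abelian_group_free_module abelian_group_burnside_alg coset_combination_hom, symmetric]
      abelian_group.minus_closed[OF R.abelian_group_free_module] by metis
qed

lemma alpha_combination:
  assumes c: "c \<in> carrier (free_module R T)"
  shows "alpha R G (coset_combination c) =
    finsum RS (\<lambda>U. c U \<odot>\<^bsub>RS\<^esub> alpha R G (coset_tensor U)) T"
proof -
  interpret A: module R "RB"
    by (rule module_burnside_alg)
  interpret M: module R "RS"
    by (rule module_sg_module)
  have c': "c U \<in> carrier R" "coset_tensor U \<in> carrier RB" if "U \<in> T" for U
    using c that coset_tensor_funcset by auto
  have "alpha R G (coset_combination c) =
    finsum RS (\<lambda>U. alpha R G (c U \<odot>\<^bsub>RB\<^esub> coset_tensor U)) T"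
    unfolding coset_combination_def linear_ext_def using c'
    by (intro module_hom_finsum[OF abelian_group_burnside_alg abelian_group_sg_module alpha_hom]
        G.conj_transversal_finite[OF T]) auto
  also have "\<dots> = finsum RS (\<lambda>U. c U \<odot>\<^bsub>RS\<^esub> alpha R G (coset_tensor U)) T"
    using c' by (intro M.finsum_cong') (auto simp: module_hom_smult[OF alpha_hom] alpha_closed)
  finally show ?thesis .
qed

text \<open>Among the members of \<open>T\<close> only \<open>V\<close> is conjugate to \<open>V\<close>, so on \<open>T\<close> the map \<open>\<alpha>\<close> is diagonal with
  entries \<open>[N(V) : V]\<close>.\<close>

lemma alpha_combination_apply:
  assumes c: "c \<in> carrier (free_module R T)" and V: "V \<in> T"
  shows "alpha R G (coset_combination c) V = c V \<otimes>\<^bsub>R\<^esub> ([normalizer_index G V] \<cdot>\<^bsub>R\<^esub> \<one>\<^bsub>R\<^esub>)"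
proof -
  interpret M: module R "RS"
    by (rule module_sg_module)
  have V': "V \<in> subgroups_of G"
    using G.conj_transversal_subgroup[OF T V] .
  have c': "c U \<in> carrier R" if "U \<in> T" for U
    using c that by auto
  have closed: "alpha R G (coset_tensor U) \<in> carrier RS" if "U \<in> T" for U
    using that coset_tensor_funcset by (intro alpha_closed) auto
  have "alpha R G (coset_combination c) V =
    (\<Oplus>\<^bsub>R\<^esub>U\<in>T. (c U \<odot>\<^bsub>RS\<^esub> alpha R G (coset_tensor U)) V)"
  proof -
    have "(\<lambda>U. c U \<odot>\<^bsub>RS\<^esub> alpha R G (coset_tensor U)) \<in> T \<rightarrow> carrier RS"
      using c' closed M.smult_closed by blast
    then show ?thesis
      using R.free_module_finsum_apply[OF G.conj_transversal_finite[OF T] _ V']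
      unfolding alpha_combination[OF c] by (simp only: sg_module_def)
  qed
  also have "\<dots> = (\<Oplus>\<^bsub>R\<^esub>U\<in>T. if U = V then c V \<otimes>\<^bsub>R\<^esub> ([normalizer_index G V] \<cdot>\<^bsub>R\<^esub> \<one>\<^bsub>R\<^esub>) else \<zero>\<^bsub>R\<^esub>)"
  proof (rule R.finsum_cong')
    fix U
    assume U: "U \<in> T"
    show "(c U \<odot>\<^bsub>RS\<^esub> alpha R G (coset_tensor U)) V =
      (if U = V then c V \<otimes>\<^bsub>R\<^esub> ([normalizer_index G V] \<cdot>\<^bsub>R\<^esub> \<one>\<^bsub>R\<^esub>) else \<zero>\<^bsub>R\<^esub>)"
      using c'[OF U] V' G.conj_transversal_unique[OF T U V] G.conj_transversal_subgroup[OF T U]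
      by (auto simp: sg_module_def alpha_coset_tensor_apply)
  qed (use c' V in auto)
  also have "\<dots> = c V \<otimes>\<^bsub>R\<^esub> ([normalizer_index G V] \<cdot>\<^bsub>R\<^esub> \<one>\<^bsub>R\<^esub>)"
    using G.conj_transversal_finite[OF T] V c'[OF V] by (intro R.finsum_if_eq) auto
  finally show ?thesis .
qed

lemma alpha_mem_sg_fixed:
  assumes "t \<in> carrier RB"
  shows "alpha R G t \<in> carrier (sg_fixed R G)"
proof -
  obtain c where c: "c \<in> carrier (free_module R T)" "t = coset_combination c"
    using coset_combination_surj[OF assms] by blast
  have "c U \<odot>\<^bsub>RS\<^esub> alpha R G (coset_tensor U) \<in> carrier (sg_fixed R G)" if "U \<in> T" for U
    using c(1) that alpha_coset_tensor_fixed[OF G.conj_transversal_subgroup[OF T that]]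
      submodule.smult_closed[OF submodule_sg_fixed] by auto
  then show ?thesis
    unfolding c(2) alpha_combination[OF c(1)]
    by (intro submodule_finsum_closed[OF module_sg_module submodule_sg_fixed]) auto
qed

lemma alpha_image_iff:
  assumes v: "v \<in> carrier (sg_fixed R G)"
  shows "v \<in> alpha R G ` carrier RB \<longleftrightarrow>
    (\<forall>U\<in>T. \<exists>r\<in>carrier R. v U = r \<otimes>\<^bsub>R\<^esub> ([normalizer_index G U] \<cdot>\<^bsub>R\<^esub> \<one>\<^bsub>R\<^esub>))"
proof
  assume "v \<in> alpha R G ` carrier RB"
  then obtain t where "t \<in> carrier RB" "v = alpha R G t"
    by blast
  then obtain c where "c \<in> carrier (free_module R T)" "v = alpha R G (coset_combination c)"
    using coset_combination_surj by blast
  then show "\<forall>U\<in>T. \<exists>r\<in>carrier R. v U = r \<otimes>\<^bsub>R\<^esub> ([normalizer_index G U] \<cdot>\<^bsub>R\<^esub> \<one>\<^bsub>R\<^esub>)"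
    by (auto simp: alpha_combination_apply)
next
  assume "\<forall>U\<in>T. \<exists>r\<in>carrier R. v U = r \<otimes>\<^bsub>R\<^esub> ([normalizer_index G U] \<cdot>\<^bsub>R\<^esub> \<one>\<^bsub>R\<^esub>)"
  then obtain r where r: "\<And>U. U \<in> T \<Longrightarrow> r U \<in> carrier R"
    "\<And>U. U \<in> T \<Longrightarrow> v U = r U \<otimes>\<^bsub>R\<^esub> ([normalizer_index G U] \<cdot>\<^bsub>R\<^esub> \<one>\<^bsub>R\<^esub>)"
    by metis
  have c: "restrict r T \<in> carrier (free_module R T)"
    using r(1) by simp
  have "v = alpha R G (coset_combination (restrict r T))"
    using r(2) c
    by (intro sg_fixed_eqI[OF v _ T] alpha_mem_sg_fixed coset_combination_closed)
      (auto simp: alpha_combination_apply simp del: free_module_carrier)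
  then show "v \<in> alpha R G ` carrier RB"
    using coset_combination_closed[OF c] by blast
qed

text \<open>Each diagonal entry \<open>[N(V) : V]\<close> divides \<open>|G|\<close>, so what it annihilates is annihilated by \<open>|G|\<close>.\<close>

lemma alpha_inj_of_transversal:
  assumes torsion: "\<And>r. r \<in> carrier R \<Longrightarrow> [order G] \<cdot>\<^bsub>R\<^esub> r = \<zero>\<^bsub>R\<^esub> \<Longrightarrow> r = \<zero>\<^bsub>R\<^esub>"
  shows "inj_on (alpha R G) (carrier RB)"
proof (rule inj_onI)
  fix t u
  assume "t \<in> carrier RB" "u \<in> carrier RB" and eq: "alpha R G t = alpha R G u"
  then obtain c d where c: "c \<in> carrier (free_module R T)" "t = coset_combination c"
    and d: "d \<in> carrier (free_module R T)" "u = coset_combination d"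
    using coset_combination_surj by blast
  have "c V = d V" if V: "V \<in> T" for V
  proof -
    let ?n = "normalizer_index G V"
    have cd: "c V \<in> carrier R" "d V \<in> carrier R"
      using c d V by auto
    have "subgroup V G"
      using G.conj_transversal_subgroup[OF T V] by (simp add: subgroups_of_def)
    then obtain k where k: "order G = ?n * k"
      using G.normalizer_index_dvd_order by blast
    have "c V \<otimes>\<^bsub>R\<^esub> ([?n] \<cdot>\<^bsub>R\<^esub> \<one>\<^bsub>R\<^esub>) = d V \<otimes>\<^bsub>R\<^esub> ([?n] \<cdot>\<^bsub>R\<^esub> \<one>\<^bsub>R\<^esub>)"
      using eq c(2) d(2) alpha_combination_apply[OF c(1) V] alpha_combination_apply[OF d(1) V] by simp
    then have "(c V \<ominus>\<^bsub>R\<^esub> d V) \<otimes>\<^bsub>R\<^esub> ([?n] \<cdot>\<^bsub>R\<^esub> \<one>\<^bsub>R\<^esub>) = \<zero>\<^bsub>R\<^esub>"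
      using cd by (simp add: a_minus_def R.l_distr R.l_minus R.r_neg)
    then have "[?n] \<cdot>\<^bsub>R\<^esub> (c V \<ominus>\<^bsub>R\<^esub> d V) = \<zero>\<^bsub>R\<^esub>"
      using cd R.add_pow_rdistr[of "c V \<ominus>\<^bsub>R\<^esub> d V" "\<one>\<^bsub>R\<^esub>" ?n] by simp
    then have "[order G] \<cdot>\<^bsub>R\<^esub> (c V \<ominus>\<^bsub>R\<^esub> d V) = \<zero>\<^bsub>R\<^esub>"
      using cd R.add.nat_pow_pow[of "c V \<ominus>\<^bsub>R\<^esub> d V" k ?n] by (simp add: k)
    then show "c V = d V"
      using torsion[of "c V \<ominus>\<^bsub>R\<^esub> d V"] cd R.minus_eq_zero_iff by simp
  qed
  then show "t = u"
    using c d R.free_module_eqI[of c T d] by simp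
qed

end

theorem alpha_fixed: "alpha R G ` carrier RB \<subseteq> carrier (sg_fixed R G)"
  using G.ex_conj_transversal alpha_mem_sg_fixed by blast

theorem alpha_inj:
  assumes "\<And>r. r \<in> carrier R \<Longrightarrow> [order G] \<cdot>\<^bsub>R\<^esub> r = \<zero>\<^bsub>R\<^esub> \<Longrightarrow> r = \<zero>\<^bsub>R\<^esub>"
  shows "inj_on (alpha R G) (carrier RB)"
  using G.ex_conj_transversal alpha_inj_of_transversal assms by blast

theorem rho_fixed: "rho R G ` carrier RB \<subseteq> carrier (sg_fixed R G)"
proof
  fix w
  assume "w \<in> rho R G ` carrier RB"
  then obtain t where "t \<in> carrier RB" "w = zeta R G (alpha R G t)"
    by (auto simp: zeta_alpha)
  then show "w \<in> carrier (sg_fixed R G)"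
    using alpha_fixed zeta_image_fixed by blast
qed

text \<open>Each diagonal entry \<open>[N(V) : V]\<close> divides the unit \<open>|G|\<close>, hence is itself invertible.\<close>

theorem alpha_iso:
  assumes unit: "[order G] \<cdot>\<^bsub>R\<^esub> \<one>\<^bsub>R\<^esub> \<in> Units R"
  shows "alpha R G \<in> module_iso R RB (sg_fixed R G)"
proof -
  obtain T where T: "conj_transversal G T"
    using G.ex_conj_transversal by blast
  obtain s where s: "s \<in> carrier R" "s \<otimes>\<^bsub>R\<^esub> ([order G] \<cdot>\<^bsub>R\<^esub> \<one>\<^bsub>R\<^esub>) = \<one>\<^bsub>R\<^esub>"
    using unit by (auto simp: Units_def)
  have order: "([order G] \<cdot>\<^bsub>R\<^esub> \<one>\<^bsub>R\<^esub>) \<otimes>\<^bsub>R\<^esub> r = [order G] \<cdot>\<^bsub>R\<^esub> r" if "r \<in> carrier R" for r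
    using that R.add_pow_ldistr[of "\<one>\<^bsub>R\<^esub>" r "order G"] by simp
  have "inj_on (alpha R G) (carrier RB)"
  proof (rule alpha_inj)
    fix r
    assume r: "r \<in> carrier R" "[order G] \<cdot>\<^bsub>R\<^esub> r = \<zero>\<^bsub>R\<^esub>"
    then have "s \<otimes>\<^bsub>R\<^esub> (([order G] \<cdot>\<^bsub>R\<^esub> \<one>\<^bsub>R\<^esub>) \<otimes>\<^bsub>R\<^esub> r) = \<zero>\<^bsub>R\<^esub>"
      using s order by simp
    then show "r = \<zero>\<^bsub>R\<^esub>"
      using s r by (simp add: R.m_assoc[symmetric])
  qed
  moreover have "v \<in> alpha R G ` carrier RB" if v: "v \<in> carrier (sg_fixed R G)" for v
  proof -
    have "\<exists>r\<in>carrier R. v U = r \<otimes>\<^bsub>R\<^esub> ([normalizer_index G U] \<cdot>\<^bsub>R\<^esub> \<one>\<^bsub>R\<^esub>)" if U: "U \<in> T" for U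
    proof -
      let ?n = "normalizer_index G U"
      have "subgroup U G"
        using G.conj_transversal_subgroup[OF T U] by (simp add: subgroups_of_def)
      then obtain k where k: "order G = k * ?n"
        using G.normalizer_index_dvd_order by (metis dvd_def mult.commute)
      have vU: "v U \<in> carrier R"
        using v sg_fixed_subset sg_module_coord G.conj_transversal_subgroup[OF T U] by blast
      have "[order G] \<cdot>\<^bsub>R\<^esub> \<one>\<^bsub>R\<^esub> = ([k] \<cdot>\<^bsub>R\<^esub> \<one>\<^bsub>R\<^esub>) \<otimes>\<^bsub>R\<^esub> ([?n] \<cdot>\<^bsub>R\<^esub> \<one>\<^bsub>R\<^esub>)"
        using R.add_pow_rdistr[of "[k] \<cdot>\<^bsub>R\<^esub> \<one>\<^bsub>R\<^esub>" "\<one>\<^bsub>R\<^esub>" ?n] R.add.nat_pow_pow[of "\<one>\<^bsub>R\<^esub>" ?n k]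
        by (simp add: k)
      then have "v U = (v U \<otimes>\<^bsub>R\<^esub> s \<otimes>\<^bsub>R\<^esub> ([k] \<cdot>\<^bsub>R\<^esub> \<one>\<^bsub>R\<^esub>)) \<otimes>\<^bsub>R\<^esub> ([?n] \<cdot>\<^bsub>R\<^esub> \<one>\<^bsub>R\<^esub>)"
        using s vU by (simp add: R.m_assoc)
      then show ?thesis
        using s vU by (intro bexI[of _ "v U \<otimes>\<^bsub>R\<^esub> s \<otimes>\<^bsub>R\<^esub> ([k] \<cdot>\<^bsub>R\<^esub> \<one>\<^bsub>R\<^esub>)"]) auto
    qed
    then show ?thesis
      using alpha_image_iff[OF T v] by blast
  qed
  ultimately show ?thesis
    using module_hom_into_sg_fixed[OF alpha_hom alpha_fixed] alpha_fixed
    by (auto simp: module_iso_def bij_betw_def)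
qed

lemma rho_image: "rho R G ` carrier RB = zeta R G ` alpha R G ` carrier RB"
  using zeta_alpha by (force simp: image_image)

theorem rho_iso:
  assumes unit: "[order G] \<cdot>\<^bsub>R\<^esub> \<one>\<^bsub>R\<^esub> \<in> Units R"
  shows "rho R G \<in> module_iso R RB (sg_fixed R G)"
proof -
  have "bij_betw (zeta R G \<circ> alpha R G) (carrier RB) (carrier (sg_fixed R G))"
    using alpha_iso[OF unit] zeta_fixed_iso by (intro bij_betw_trans) (auto simp: module_iso_def)
  then have "bij_betw (rho R G) (carrier RB) (carrier (sg_fixed R G))"
    using zeta_alpha by (subst bij_betw_cong[of _ _ "zeta R G \<circ> alpha R G"]) auto
  then show ?thesis
    using module_hom_into_sg_fixed[OF rho_hom rho_fixed] by (simp add: module_iso_def)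
qed

end

section \<open>The index over the integers\<close>

lemma card_image_eq_card_image:
  assumes "\<And>a b. a \<in> A \<Longrightarrow> b \<in> A \<Longrightarrow> f a = f b \<longleftrightarrow> g a = g b"
  shows "card (f ` A) = card (g ` A)"
proof (rule bij_betw_same_card)
  have inv: "inv_into A f (f a) \<in> A" "f (inv_into A f (f a)) = f a" if "a \<in> A" for a
    using that by (auto intro: inv_into_into f_inv_into_f)
  have "(\<lambda>y. g (inv_into A f y)) (f a) = g a" if "a \<in> A" for a
    using assms[OF inv(1)[OF that] that] inv(2)[OF that] by simp
  then show "bij_betw (\<lambda>y. g (inv_into A f y)) (f ` A) (g ` A)"
    using assms by (auto simp: bij_betw_def inj_on_def image_image)
qed

lemma card_a_rcosets:
  fixes A (structure)
  assumes "abelian_group A" and "additive_subgroup H A"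
    and f: "\<And>a b. a \<in> carrier A \<Longrightarrow> b \<in> carrier A \<Longrightarrow> f a = f b \<longleftrightarrow> a \<ominus> b \<in> H"
  shows "card (a_rcosets H) = card (f ` carrier A)"
proof -
  interpret abelian_group A by fact
  interpret H: subgroup H "add_monoid A"
    using assms(2) by (rule additive_subgroup.a_subgroup)
  have "H #>\<^bsub>add_monoid A\<^esub> a = H #>\<^bsub>add_monoid A\<^esub> b \<longleftrightarrow> a \<ominus> b \<in> H"
    if a: "a \<in> carrier A" and b: "b \<in> carrier A" for a b
  proof -
    have "a \<ominus> b \<in> H \<longleftrightarrow> a \<in> H #>\<^bsub>add_monoid A\<^esub> b"
      using H.rcos_module[OF a_group, of b a] a b by (simp add: a_minus_def a_inv_def)
    also have "\<dots> \<longleftrightarrow> H #>\<^bsub>add_monoid A\<^esub> a = H #>\<^bsub>add_monoid A\<^esub> b"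
      using group.repr_independence[OF a_group, of a H b] group.rcos_self[OF a_group, of a H] a b
        H.subgroup_axioms by auto
    finally show ?thesis
      by simp
  qed
  then have "card ((\<lambda>a. H #>\<^bsub>add_monoid A\<^esub> a) ` carrier A) = card (f ` carrier A)"
    using f by (intro card_image_eq_card_image) simp
  moreover have "a_rcosets H = (\<lambda>a. H #>\<^bsub>add_monoid A\<^esub> a) ` carrier A"
    by (auto simp: A_RCOSETS_def RCOSETS_def)
  ultimately show ?thesis
    by simp
qed

lemma int_ring_add_pow_nat: "[(n :: nat)] \<cdot>\<^bsub>\<Z>\<^esub> x = int n * x"
  by (induction n) (simp_all add: add_pow_def nat_pow_def algebra_simps)

lemma int_ring_add_pow: "[(k :: int)] \<cdot>\<^bsub>\<Z>\<^esub> x = k * x"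
proof (cases "k \<ge> 0")
  case False
  then have "[k] \<cdot>\<^bsub>\<Z>\<^esub> x = \<ominus>\<^bsub>\<Z>\<^esub> ([nat (- k)] \<cdot>\<^bsub>\<Z>\<^esub> x)"
    by (intro add_pow_int_lt) simp
  then show ?thesis
    using False by (simp only: int_ring_add_pow_nat int_a_inv_eq) simp
qed (simp add: add_pow_int_ge int_ring_add_pow_nat)

context finite_group
begin

interpretation Z: group_coefficients G \<Z>
  by (intro group_coefficients.intro finite_group_axioms int_is_cring)

interpretation tensor: scalar_extension \<Z> "burnside_ring G"
  by (intro scalar_extension.intro scalar_extension_axioms.intro int_is_cring burnside_add_closed)

abbreviation alpha_range :: "('g set \<Rightarrow> int) set"
  where "alpha_range \<equiv> alpha_int G ` carrier (burnside_ring G)"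

theorem alpha_int_coset:
  assumes U: "subgroup U G"
  shows "alpha_int G (burnside_class G (coset_gset G U)) =
    [normalizer_index G U] \<cdot>\<^bsub>Z.RS\<^esub> class_sum \<Z> G U"
proof (rule Z.sg_module_eqI)
  interpret M: abelian_group "Z.RS"
    by (rule Z.abelian_group_sg_module)
  have U': "U \<in> subgroups_of G"
    using U by (simp add: subgroups_of_def)
  have closed: "class_sum \<Z> G U \<in> carrier Z.RS"
    using Z.class_sum_closed[OF U'] Z.sg_fixed_subset by blast
  then show "[normalizer_index G U] \<cdot>\<^bsub>Z.RS\<^esub> class_sum \<Z> G U \<in> carrier Z.RS"
    by simp
  show "alpha_int G (burnside_class G (coset_gset G U)) \<in> carrier Z.RS"
    using U by (intro alpha_int_closed burnside_class_closed finite_coset_gset)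
  fix V
  assume V: "V \<in> subgroups_of G"
  have "([normalizer_index G U] \<cdot>\<^bsub>Z.RS\<^esub> class_sum \<Z> G U) V =
    [normalizer_index G U] \<cdot>\<^bsub>\<Z>\<^esub> class_sum \<Z> G U V"
    using closed V unfolding sg_module_def by (rule cring.free_module_nat_pow_apply[OF int_is_cring])
  then show "alpha_int G (burnside_class G (coset_gset G U)) V =
    ([normalizer_index G U] \<cdot>\<^bsub>Z.RS\<^esub> class_sum \<Z> G U) V"
    using V U' by (simp add: alpha_int_coset_class[OF U] Z.class_sum_apply int_ring_add_pow_nat)
qed

lemma sg_module_int_add_apply:
  "U \<in> subgroups_of G \<Longrightarrow> (v \<oplus>\<^bsub>Z.RS\<^esub> w) U = v U + w U"
  by (simp add: sg_module_def)

lemma sg_module_int_minus_apply: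
  assumes "v \<in> carrier Z.RS" and "w \<in> carrier Z.RS" and "U \<in> subgroups_of G"
  shows "(v \<ominus>\<^bsub>Z.RS\<^esub> w) U = v U - w U"
  using cring.free_module_minus_apply[OF int_is_cring, of v "subgroups_of G" w U] assms
  by (simp only: sg_module_def int_a_minus_eq)

lemma int_coeffs_int:
  assumes "v \<in> carrier Z.RS"
  shows "int_coeffs \<Z> (subgroups_of G) v = v"
  using assms
  by (intro Z.sg_module_eqI) (simp_all add: Z.sg_module_carrier int_coeffs_def int_ring_add_pow)

lemma alpha_range_minus:
  assumes "v \<in> alpha_range" and "w \<in> alpha_range"
  shows "v \<ominus>\<^bsub>Z.RS\<^esub> w \<in> alpha_range"
proof -
  obtain X Y :: "('g, nat) gset" where X: "finite_gset G X" "finite_gset G Y"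
    and v: "v = alpha_int G (burnside_diff G X Y)"
    using assms(1) burnside_cases by blast
  obtain X' Y' :: "('g, nat) gset" where X': "finite_gset G X'" "finite_gset G Y'"
    and w: "w = alpha_int G (burnside_diff G X' Y')"
    using assms(2) burnside_cases by blast
  interpret M: abelian_group "Z.RS"
    by (rule Z.abelian_group_sg_module)
  have closed: "v \<in> carrier Z.RS" "w \<in> carrier Z.RS"
    using X X' by (simp_all add: v w alpha_int_closed burnside_diff_closed)
  have sum: "finite_gset G (gset_sum X Y')" "finite_gset G (gset_sum Y X')"
    using X X' by (simp_all add: finite_gset_sum)
  have "v \<ominus>\<^bsub>Z.RS\<^esub> w = alpha_int G (burnside_diff G (gset_sum X Y') (gset_sum Y X'))"
  proof (rule Z.sg_module_eqI)
    fix U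
    assume U: "U \<in> subgroups_of G"
    show "(v \<ominus>\<^bsub>Z.RS\<^esub> w) U = alpha_int G (burnside_diff G (gset_sum X Y') (gset_sum Y X')) U"
      unfolding sg_module_int_minus_apply[OF closed U]
      using U X X' sum by (simp add: v w alpha_int_diff stab_count_sum)
  qed (use closed sum in \<open>simp_all add: alpha_int_closed burnside_diff_closed\<close>)
  then show ?thesis
    using sum by (auto simp: burnside_diff_closed)
qed

lemma alpha_range_zero: "\<zero>\<^bsub>Z.RS\<^esub> \<in> alpha_range"
proof -
  interpret M: abelian_group "Z.RS"
    by (rule Z.abelian_group_sg_module)
  let ?b = "burnside_class G (gset_empty :: ('g, nat) gset)"
  have b: "?b \<in> carrier (burnside_ring G)"
    by (intro burnside_class_closed finite_gset_empty)
  have "alpha_int G ?b \<ominus>\<^bsub>Z.RS\<^esub> alpha_int G ?b = \<zero>\<^bsub>Z.RS\<^esub>"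
    using alpha_int_closed[OF b] by (simp add: M.minus_eq_zero_iff)
  then show ?thesis
    using alpha_range_minus[of "alpha_int G ?b" "alpha_int G ?b"] b by simp
qed

text \<open>The image is closed under subtraction, and an integral multiple is obtained by repeatedly
  adding or subtracting.\<close>

lemma alpha_range_scale:
  assumes v: "v \<in> alpha_range"
  shows "k \<odot>\<^bsub>Z.RS\<^esub> v \<in> alpha_range"
proof -
  interpret M: module \<Z> "Z.RS"
    by (rule Z.module_sg_module)
  let ?I = "alpha_range"
  have sub: "w \<in> carrier Z.RS" if "w \<in> ?I" for w
    using that alpha_int_closed by blast
  have neg: "\<zero>\<^bsub>Z.RS\<^esub> \<ominus>\<^bsub>Z.RS\<^esub> v \<in> ?I"
    using alpha_range_zero v by (rule alpha_range_minus)
  have scale: "k \<odot>\<^bsub>Z.RS\<^esub> v \<in> carrier Z.RS" for k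
    using v sub by simp
  have scale_apply: "(k \<odot>\<^bsub>Z.RS\<^esub> v) U = k * v U" if "U \<in> subgroups_of G" for k U
    using that by (simp add: sg_module_def)
  show ?thesis
  proof (induction k rule: int_induct[where k = 0])
    case base
    then show ?case
      using alpha_range_zero M.smult_l_null[OF sub[OF v]] by simp
  next
    case (step1 k)
    have "(k + 1) \<odot>\<^bsub>Z.RS\<^esub> v =
      k \<odot>\<^bsub>Z.RS\<^esub> v \<ominus>\<^bsub>Z.RS\<^esub> (\<zero>\<^bsub>Z.RS\<^esub> \<ominus>\<^bsub>Z.RS\<^esub> v)"
    proof (rule Z.sg_module_eqI[OF scale M.minus_closed[OF scale sub[OF neg]]])
      fix U
      assume U: "U \<in> subgroups_of G"
      show "((k + 1) \<odot>\<^bsub>Z.RS\<^esub> v) U =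
        (k \<odot>\<^bsub>Z.RS\<^esub> v \<ominus>\<^bsub>Z.RS\<^esub> (\<zero>\<^bsub>Z.RS\<^esub> \<ominus>\<^bsub>Z.RS\<^esub> v)) U"
        unfolding sg_module_int_minus_apply[OF scale sub[OF neg] U]
          sg_module_int_minus_apply[OF M.zero_closed sub[OF v] U] scale_apply[OF U]
        using U by (simp add: sg_module_def algebra_simps)
    qed
    then show ?case
      using alpha_range_minus[OF step1(2) neg] by simp
  next
    case (step2 k)
    have "(k - 1) \<odot>\<^bsub>Z.RS\<^esub> v = k \<odot>\<^bsub>Z.RS\<^esub> v \<ominus>\<^bsub>Z.RS\<^esub> v"
      by (rule Z.sg_module_eqI[OF scale M.minus_closed[OF scale sub[OF v]]])
        (simp add: sg_module_int_minus_apply[OF scale sub[OF v]] scale_apply left_diff_distrib)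
    then show ?case
      using alpha_range_minus[OF step2(2) v] by simp
  qed
qed

text \<open>The tensor product with \<open>\<int>\<close> adds nothing to the image: the value at \<open>k \<otimes> b\<close> is \<open>k \<alpha>(b)\<close>, which
  the image of \<open>B(G)\<close> contains together with \<open>\<alpha>(b)\<close>.\<close>

lemma alpha_range_eq:
  "alpha_range = alpha \<Z> G ` carrier Z.RB"
proof (intro equalityI image_subsetI)
  fix b
  assume b: "b \<in> carrier (burnside_ring G)"
  interpret M: module \<Z> "Z.RS"
    by (rule Z.module_sg_module)
  have "alpha \<Z> G (pure_tensor \<Z> (burnside_ring G) 1 b) = alpha_int G b"
    using Z.alpha_pure[OF _ b, of 1] M.smult_one alpha_int_closed[OF b] by (simp add: int_coeffs_int)
  moreover have "pure_tensor \<Z> (burnside_ring G) 1 b \<in> carrier Z.RB"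
    using tensor.pure_tensor_closed[OF _ b, of 1] by simp
  ultimately show "alpha_int G b \<in> alpha \<Z> G ` carrier Z.RB"
    by (rule image_eqI[OF sym])
next
  fix t
  assume "t \<in> carrier Z.RB"
  then show "alpha \<Z> G t \<in> alpha_range"
  proof (induction t rule: tensor.base_change_induct)
    case zero
    then show ?case
      using alpha_range_zero abelian_group_hom.hom_zero[OF module_hom_abelian_group_hom[OF
            Z.abelian_group_burnside_alg Z.abelian_group_sg_module Z.alpha_hom]] by simp
  next
    case (pure k b)
    then show ?case
      using alpha_range_scale[of "alpha_int G b" k]
      by (simp add: Z.alpha_pure int_coeffs_int alpha_int_closed)
  next
    case (minus t u)
    then show ?case
      using alpha_range_minus[OF minus(3,4)]
        module_hom_minus[OF Z.abelian_group_burnside_alg Z.abelian_group_sg_module Z.alpha_hom minus(1,2)]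
      by simp
  qed
qed

lemma rho_int_image:
  "rho_int G ` carrier (burnside_ring G) = zeta \<Z> G ` alpha_range"
proof -
  have "rho_int G b = zeta \<Z> G (alpha_int G b)" if b: "b \<in> carrier (burnside_ring G)" for b
  proof (rule Z.sg_module_eqI[OF rho_int_closed[OF b] Z.zeta_closed[OF alpha_int_closed[OF b]]])
    fix U
    assume U: "U \<in> subgroups_of G"
    show "rho_int G b U = zeta \<Z> G (alpha_int G b) U"
      using Z.zeta_apply[OF alpha_int_closed[OF b] U] by (simp add: rho_int_eq_sum_alpha_int[OF b U] int_finsum_eq)
  qed
  then show ?thesis
    by (simp add: image_image)
qed

lemma abelian_group_sg_fixed_int: "abelian_group (sg_fixed \<Z> G)"
  using Z.module_sg_fixed by (rule module.axioms(2))

lemma additive_subgroup_image: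
  assumes M: "abelian_group M" and N: "abelian_group N" and f: "f \<in> module_hom R M N"
  shows "additive_subgroup (f ` carrier M) N"
proof (rule additive_subgroupI)
  interpret abelian_group_hom M N f
    by (rule module_hom_abelian_group_hom[OF M N f])
  show "subgroup (f ` carrier M) (add_monoid N)"
    using group_hom.img_is_subgroup[OF a_group_hom] by simp
qed

theorem additive_subgroup_alpha_int:
  "additive_subgroup (alpha_range) (sg_fixed \<Z> G)"
  unfolding alpha_range_eq
  by (rule additive_subgroup_image[OF Z.abelian_group_burnside_alg abelian_group_sg_fixed_int
        Z.module_hom_into_sg_fixed[OF Z.alpha_hom Z.alpha_fixed]])

theorem additive_subgroup_rho_int:
  "additive_subgroup (rho_int G ` carrier (burnside_ring G)) (sg_fixed \<Z> G)"
  unfolding rho_int_image alpha_range_eq Z.rho_image[symmetric]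
  by (rule additive_subgroup_image[OF Z.abelian_group_burnside_alg abelian_group_sg_fixed_int
        Z.module_hom_into_sg_fixed[OF Z.rho_hom Z.rho_fixed]])

lemma sg_fixed_int_minus_apply:
  assumes v: "v \<in> carrier (sg_fixed \<Z> G)" and w: "w \<in> carrier (sg_fixed \<Z> G)" and U: "U \<in> subgroups_of G"
  shows "(v \<ominus>\<^bsub>sg_fixed \<Z> G\<^esub> w) U = v U - w U"
proof -
  interpret F: abelian_group "sg_fixed \<Z> G"
    by (rule abelian_group_sg_fixed_int)
  have "(v \<ominus>\<^bsub>sg_fixed \<Z> G\<^esub> w) \<oplus>\<^bsub>sg_fixed \<Z> G\<^esub> w = v"
    using v w by (simp add: a_minus_def F.a_assoc F.l_neg)
  moreover have "((v \<ominus>\<^bsub>sg_fixed \<Z> G\<^esub> w) \<oplus>\<^bsub>sg_fixed \<Z> G\<^esub> w) U = (v \<ominus>\<^bsub>sg_fixed \<Z> G\<^esub> w) U + w U"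
    using U by (simp add: sg_fixed_def sg_module_int_add_apply)
  ultimately show ?thesis
    by simp
qed

lemma alpha_range_iff:
  assumes T: "conj_transversal G T" and v: "v \<in> carrier (sg_fixed \<Z> G)"
  shows "v \<in> alpha_range \<longleftrightarrow>
    (\<forall>U\<in>T. int (normalizer_index G U) dvd v U)"
  unfolding alpha_range_eq Z.alpha_image_iff[OF T v]
  by (simp add: int_ring_add_pow_nat dvd_def mult.commute)

text \<open>A fixed vector is determined by its values on \<open>T\<close>, which can be prescribed.  The residues of
  these values modulo the indices \<open>[N(U) : U]\<close> identify the quotient by the image of \<open>\<alpha>\<close> with a
  product of cyclic groups.\<close>

definition residues_on :: "'g set set \<Rightarrow> ('g set \<Rightarrow> int) \<Rightarrow> 'g set \<Rightarrow> int"
  where "residues_on T v = (\<lambda>U\<in>T. v U mod int (normalizer_index G U))"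

lemma residues_on_eq_iff:
  assumes T: "conj_transversal G T" and v: "v \<in> carrier (sg_fixed \<Z> G)" and w: "w \<in> carrier (sg_fixed \<Z> G)"
  shows "residues_on T v = residues_on T w \<longleftrightarrow>
    v \<ominus>\<^bsub>sg_fixed \<Z> G\<^esub> w \<in> alpha_range"
proof -
  interpret F: abelian_group "sg_fixed \<Z> G"
    by (rule abelian_group_sg_fixed_int)
  have "residues_on T v = residues_on T w \<longleftrightarrow>
    (\<forall>U\<in>T. v U mod int (normalizer_index G U) = w U mod int (normalizer_index G U))"
    by (auto simp: residues_on_def fun_eq_iff restrict_def)
  also have "\<dots> \<longleftrightarrow> (\<forall>U\<in>T. int (normalizer_index G U) dvd (v \<ominus>\<^bsub>sg_fixed \<Z> G\<^esub> w) U)"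
    using conj_transversal_subgroup[OF T]
    by (simp add: sg_fixed_int_minus_apply[OF v w] mod_eq_dvd_iff)
  also have "\<dots> \<longleftrightarrow> v \<ominus>\<^bsub>sg_fixed \<Z> G\<^esub> w \<in> alpha_range"
    using v w by (simp add: alpha_range_iff[OF T])
  finally show ?thesis .
qed

lemma residues_on_image:
  assumes T: "conj_transversal G T"
  shows "residues_on T ` carrier (sg_fixed \<Z> G) = (\<Pi>\<^sub>E U\<in>T. {0..<int (normalizer_index G U)})"
proof (intro equalityI subsetI)
  fix y
  assume "y \<in> residues_on T ` carrier (sg_fixed \<Z> G)"
  then show "y \<in> (\<Pi>\<^sub>E U\<in>T. {0..<int (normalizer_index G U)})"
    using normalizer_index_int_pos[OF conj_transversal_subgroup[OF T]]
    by (auto simp: residues_on_def)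
next
  fix y
  assume y: "y \<in> (\<Pi>\<^sub>E U\<in>T. {0..<int (normalizer_index G U)})"
  define rep where "rep V = (THE U. U \<in> T \<and> U \<in> conj_class G V)" for V
  define v where "v = (\<lambda>V\<in>subgroups_of G. y (rep V))"
  have "v (conj_set G g V) = v V" if "g \<in> carrier G" "V \<in> subgroups_of G" for g V
    using that by (simp add: v_def rep_def conj_set_closed conj_class_conj_set)
  then have v: "v \<in> carrier (sg_fixed \<Z> G)"
    by (simp add: Z.sg_fixed_iff Z.sg_module_carrier v_def)
  have "residues_on T v U = y U" for U
  proof (cases "U \<in> T")
    case True
    then have U: "U \<in> subgroups_of G"
      using conj_transversal_subgroup[OF T] by blast
    have "rep U = U"
      unfolding rep_def using True conj_transversal_unique[OF T True]
        conj_class_self[OF subgroups_of_subset[OF U]] by (intro the_equality) auto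
    moreover have "y U \<in> {0..<int (normalizer_index G U)}"
      using y True by (rule PiE_mem)
    ultimately show ?thesis
      using True U by (simp add: residues_on_def v_def)
  next
    case False
    then show ?thesis
      using PiE_arb[OF y] by (simp add: residues_on_def)
  qed
  then have "residues_on T v = y"
    by (rule ext)
  then show "y \<in> residues_on T ` carrier (sg_fixed \<Z> G)"
    using v by blast
qed

lemma card_residues_on_image:
  assumes "conj_transversal G T"
  shows "card (residues_on T ` carrier (sg_fixed \<Z> G)) = (\<Prod>U\<in>T. normalizer_index G U)"
  unfolding residues_on_image[OF assms] using conj_transversal_finite[OF assms] by (simp add: card_PiE)

theorem index_alpha_int:
  assumes T: "conj_transversal G T"
  shows "card (a_rcosets\<^bsub>sg_fixed \<Z> G\<^esub> (alpha_range)) =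
    (\<Prod>U\<in>T. normalizer_index G U)"
  using card_a_rcosets[OF abelian_group_sg_fixed_int additive_subgroup_alpha_int residues_on_eq_iff[OF T]]
  by (simp add: card_residues_on_image[OF T])

text \<open>Since \<open>\<rho> = \<zeta> \<circ> \<alpha>\<close>, the automorphism \<open>\<zeta>\<close> of the fixed vectors carries the image of \<open>\<alpha>\<close> to that of
  \<open>\<rho>\<close>; the cosets are separated by the residues of the preimage under \<open>\<zeta>\<close>.\<close>

theorem index_rho_int:
  assumes T: "conj_transversal G T"
  shows "card (a_rcosets\<^bsub>sg_fixed \<Z> G\<^esub> (rho_int G ` carrier (burnside_ring G))) =
    (\<Prod>U\<in>T. normalizer_index G U)"
proof -
  let ?F = "carrier (sg_fixed \<Z> G)" and ?z = "zeta \<Z> G"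
  interpret F: abelian_group "sg_fixed \<Z> G"
    by (rule abelian_group_sg_fixed_int)
  have bij: "bij_betw ?z ?F ?F" and hom: "?z \<in> module_hom \<Z> (sg_fixed \<Z> G) (sg_fixed \<Z> G)"
    using Z.zeta_fixed_iso by (simp_all add: module_iso_def)
  let ?y = "inv_into ?F ?z"
  have y: "?y v \<in> ?F" "?z (?y v) = v" if "v \<in> ?F" for v
    using bij_betw_inv_into_right[OF bij that] bij_betw_inv_into[OF bij] that by (auto simp: bij_betw_def)
  have I_sub: "alpha_range \<subseteq> ?F"
    using additive_subgroup.a_subset[OF additive_subgroup_alpha_int] .
  have "card (a_rcosets\<^bsub>sg_fixed \<Z> G\<^esub> (rho_int G ` carrier (burnside_ring G))) =
    card ((\<lambda>v. residues_on T (?y v)) ` ?F)"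
  proof (rule card_a_rcosets[OF abelian_group_sg_fixed_int additive_subgroup_rho_int])
    fix v w
    assume v: "v \<in> ?F" and w: "w \<in> ?F"
    let ?d = "?y v \<ominus>\<^bsub>sg_fixed \<Z> G\<^esub> ?y w"
    have d: "?d \<in> ?F"
      using y(1)[OF v] y(1)[OF w] by (rule F.minus_closed)
    have "?z ?d = v \<ominus>\<^bsub>sg_fixed \<Z> G\<^esub> w"
      using module_hom_minus[OF F.abelian_group_axioms F.abelian_group_axioms hom y(1)[OF v] y(1)[OF w]]
      by (simp add: y(2) v w)
    then have "v \<ominus>\<^bsub>sg_fixed \<Z> G\<^esub> w \<in> rho_int G ` carrier (burnside_ring G) \<longleftrightarrow>
      ?z ?d \<in> ?z ` alpha_range"
      by (simp add: rho_int_image)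
    also have "\<dots> \<longleftrightarrow> ?d \<in> alpha_range"
      using inj_on_image_mem_iff[OF bij_betw_imp_inj_on[OF bij] d I_sub] .
    also have "\<dots> \<longleftrightarrow> residues_on T (?y v) = residues_on T (?y w)"
      using residues_on_eq_iff[OF T y(1)[OF v] y(1)[OF w]] by simp
    finally show "residues_on T (?y v) = residues_on T (?y w) \<longleftrightarrow>
      v \<ominus>\<^bsub>sg_fixed \<Z> G\<^esub> w \<in> rho_int G ` carrier (burnside_ring G)"
      by simp
  qed
  also have "(\<lambda>v. residues_on T (?y v)) ` ?F = residues_on T ` ?y ` ?F"
    by (simp add: image_image)
  also have "?y ` ?F = ?F"
    using bij_betw_inv_into[OF bij] by (simp add: bij_betw_def)
  finally show ?thesis
    by (simp add: card_residues_on_image[OF T])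
qed

end

theorem proposition3p2:
  fixes G :: "('g, 'm) monoid_scheme" and R :: "('r, 'k) ring_scheme"
  assumes "group G" and "finite (carrier G)" and "cring R"
  shows
    \<comment> \<open>(a)\<close>
    "(\<forall>U. subgroup U G \<longrightarrow>
        alpha_int G (burnside_class G (coset_gset G U))
          = [normalizer_index G U] \<cdot>\<^bsub>sg_module \<Z> G\<^esub> class_sum \<Z> G U \<and>
        alpha R G (pure_tensor R (burnside_ring G) \<one>\<^bsub>R\<^esub> (burnside_class G (coset_gset G U)))
          = [normalizer_index G U] \<cdot>\<^bsub>sg_module R G\<^esub> class_sum R G U) \<and>
     ((\<forall>r\<in>carrier R. [order G] \<cdot>\<^bsub>R\<^esub> r = \<zero>\<^bsub>R\<^esub> \<longrightarrow> r = \<zero>\<^bsub>R\<^esub>) \<longrightarrow>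
        inj_on (alpha R G) (carrier (burnside_alg R G))) \<and>
     \<comment> \<open>(b)\<close>
     (\<forall>t\<in>carrier (burnside_alg R G). zeta R G (alpha R G t) = rho R G t) \<and>
     \<comment> \<open>(c)\<close>
     alpha R G ` carrier (burnside_alg R G) \<subseteq> carrier (sg_fixed R G) \<and>
     rho R G ` carrier (burnside_alg R G) \<subseteq> carrier (sg_fixed R G) \<and>
     module R (burnside_alg R G) \<and> module R (sg_module R G) \<and> module R (sg_fixed R G) \<and>
     alpha R G \<in> module_hom R (burnside_alg R G) (sg_module R G) \<and>
     alpha R G \<in> module_hom R (burnside_alg R G) (sg_fixed R G) \<and>
     rho R G \<in> module_hom R (burnside_alg R G) (sg_module R G) \<and>
     rho R G \<in> module_hom R (burnside_alg R G) (sg_fixed R G) \<and>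
     zeta R G \<in> module_iso R (sg_fixed R G) (sg_fixed R G) \<and>
     zeta R G \<in> module_iso R (sg_module R G) (sg_module R G) \<and>
     ([order G] \<cdot>\<^bsub>R\<^esub> \<one>\<^bsub>R\<^esub> \<in> Units R \<longrightarrow>
        alpha R G \<in> module_iso R (burnside_alg R G) (sg_fixed R G) \<and>
        rho R G \<in> module_iso R (burnside_alg R G) (sg_fixed R G)) \<and>
     additive_subgroup (alpha_int G ` carrier (burnside_ring G)) (sg_fixed \<Z> G) \<and>
     additive_subgroup (rho_int G ` carrier (burnside_ring G)) (sg_fixed \<Z> G) \<and>
     (\<forall>T. conj_transversal G T \<longrightarrow>
        card (a_rcosets\<^bsub>sg_fixed \<Z> G\<^esub> (alpha_int G ` carrier (burnside_ring G)))
          = (\<Prod>U\<in>T. normalizer_index G U) \<and>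
        card (a_rcosets\<^bsub>sg_fixed \<Z> G\<^esub> (rho_int G ` carrier (burnside_ring G)))
          = (\<Prod>U\<in>T. normalizer_index G U))"
proof -
  interpret finite_group G
    using assms by (intro finite_group.intro finite_group_axioms.intro)
  interpret RG: group_coefficients G R
    using assms by (intro group_coefficients.intro finite_group_axioms)
  have a_alg: "alpha R G (RG.coset_tensor U) =
      [normalizer_index G U] \<cdot>\<^bsub>sg_module R G\<^esub> class_sum R G U" if "subgroup U G" for U
    using that RG.alpha_coset_tensor by (simp add: subgroups_of_def)
  have a_inj: "inj_on (alpha R G) (carrier (burnside_alg R G))"
    if "\<forall>r\<in>carrier R. [order G] \<cdot>\<^bsub>R\<^esub> r = \<zero>\<^bsub>R\<^esub> \<longrightarrow> r = \<zero>\<^bsub>R\<^esub>"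
    using that RG.alpha_inj by blast
  show ?thesis
    by (intro conjI allI impI ballI)
      (rule alpha_int_coset a_alg a_inj RG.zeta_alpha RG.alpha_fixed RG.rho_fixed
        RG.module_burnside_alg RG.module_sg_module RG.module_sg_fixed
        RG.alpha_hom RG.module_hom_into_sg_fixed[OF RG.alpha_hom RG.alpha_fixed]
        RG.rho_hom RG.module_hom_into_sg_fixed[OF RG.rho_hom RG.rho_fixed]
        RG.zeta_fixed_iso RG.zeta_iso RG.alpha_iso RG.rho_iso
        additive_subgroup_alpha_int additive_subgroup_rho_int index_alpha_int index_rho_int; assumption?)+
qed

end
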